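(* Let $p$ be an odd prime, $\Gamma=C_p\rtimes C_r=\langle \sigma, \tau : \sigma^p = 1 = \tau^r,\ \tau\sigma\tau^{-1} = \sigma^s\rangle$ with the class of $s$ in $(\mathbb{Z}/p\mathbb{Z})^\times$ of exact order $r$, and $C_p=\langle\sigma\rangle$. Let $\{(D_i,I_i)\}_{1\le i\le n}$ be any family of pairs of subgroups of $\Gamma$ with $D_i\supset C_p$ and $I_i=D_i$. Then the family is realizable in finite extensions of $\mathbb{Q}$: there are a number field $K$ and a finite Galois extension $L/K$ with $L,K$ totally real, an isomorphism $\psi:\mathrm{Gal}(L/K)\cong\Gamma$, and finite primes $w_1,\dots,w_n$ of $L$ lying above distinct primes of $K$ such that $\psi(D_{w_i}(L/K))=D_i$ and $\psi(I_{w_i}(L/K))=I_i$ for all $i$.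
   Context: $D_w(L/K)$ and $I_w(L/K)$ denote the decomposition and inertia groups of $w$ in $\mathrm{Gal}(L/K)$. *)

theory Defs
  imports "HOL-Algebra.Algebra" "HOL-Algebra.Algebraic_Closure_Type" "HOL-Number_Theory.Number_Theory"
begin

section \<open>The group \<open>C\<^sub>p \<rtimes> C\<^sub>r\<close>\<close>

definition semidirect_product ::
  "('a, 'c) monoid_scheme \<Rightarrow> ('b, 'd) monoid_scheme \<Rightarrow> ('b \<Rightarrow> 'a \<Rightarrow> 'a) \<Rightarrow> ('a \<times> 'b) monoid"
  where "semidirect_product N H \<phi> =
    \<lparr>carrier = carrier N \<times> carrier H,
     monoid.mult = (\<lambda>(a, g) (b, h). (a \<otimes>\<^bsub>N\<^esub> \<phi> g b, g \<otimes>\<^bsub>H\<^esub> h)),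
     one = (\<one>\<^bsub>N\<^esub>, \<one>\<^bsub>H\<^esub>)\<rparr>"

text \<open>
  \<open>C\<^sub>n\<close> is written additively on \<open>{0..<n}\<close>, so that \<open>a [^] m\<close> is \<open>m * a mod n\<close>.  The element
  \<open>j\<close> of \<open>C\<^sub>r\<close> acts on \<open>C\<^sub>p\<close> by raising to the power \<open>s ^ j\<close>; this is an action
  because \<open>s\<close> has order \<open>r\<close> modulo \<open>p\<close>.
\<close>

definition metacyclic_group :: "nat \<Rightarrow> nat \<Rightarrow> nat \<Rightarrow> (int \<times> int) monoid"
  where "metacyclic_group p r s =
    semidirect_product (integer_mod_group p) (integer_mod_group r)
      (\<lambda>j a. a [^]\<^bsub>integer_mod_group p\<^esub> (s ^ nat j))"

definition metacyclic_sigma :: "int \<times> int"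
  where "metacyclic_sigma = (1, 0)"

text \<open>The reduction modulo \<open>r\<close> only matters for \<open>r = 1\<close>, where \<open>\<tau>\<close> is trivial.\<close>

definition metacyclic_tau :: "nat \<Rightarrow> int \<times> int"
  where "metacyclic_tau r = (0, 1 mod int r)"

lemma metacyclic_carrier:
  "p > 0 \<Longrightarrow> r > 0 \<Longrightarrow> carrier (metacyclic_group p r s) = {0..<int p} \<times> {0..<int r}"
  by (simp add: metacyclic_group_def semidirect_product_def carrier_integer_mod_group)

lemma metacyclic_one: "\<one>\<^bsub>metacyclic_group p r s\<^esub> = (0, 0)"
  by (simp add: metacyclic_group_def semidirect_product_def)

lemma metacyclic_mult:
  assumes "p > 0" "r > 0" "b \<in> {0..<int p}"
  shows "(a, i) \<otimes>\<^bsub>metacyclic_group p r s\<^esub> (b, j)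
    = ((a + int s ^ nat i * b) mod int p, (i + j) mod int r)"
  using assms
  by (simp add: metacyclic_group_def semidirect_product_def mult_integer_mod_group
      pow_integer_mod_group mod_simps)

lemma power_mod_order:
  assumes "coprime p s" "ord p s = r"
  shows "[int s ^ (n mod r) = int s ^ n] (mod int p)"
proof -
  have "[s ^ r = 1] (mod p)"
    using assms(2) ord[of s p] by simp
  then have "[s ^ (r * (n div r)) = 1] (mod p)"
    using cong_pow[of "s ^ r" 1 p "n div r"] by (simp add: power_mult)
  then have "[s ^ (r * (n div r)) * s ^ (n mod r) = 1 * s ^ (n mod r)] (mod p)"
    by (rule cong_scalar_right)
  then have "[s ^ n = s ^ (n mod r)] (mod p)"
    by (simp flip: power_add)
  then show ?thesis
    by (metis cong_int_iff cong_sym of_nat_power)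
qed

lemma group_metacyclic_group:
  assumes "Factorial_Ring.prime p" "coprime p s" "ord p s = r"
  shows "group (metacyclic_group p r s)"
proof -
  have p: "p > 0" using assms(1) prime_gt_0_nat by blast
  have r: "r > 0" using assms(2,3) coprime_ord by blast
  note [simp] = metacyclic_carrier[OF p r] metacyclic_one
  have pw: "int s ^ nat ((i + j) mod int r) * c mod int p = int s ^ nat i * int s ^ nat j * c mod int p"
    if "0 \<le> i" "0 \<le> j" for i j c
  proof -
    have "nat ((i + j) mod int r) = (nat i + nat j) mod r"
      using that by (simp add: nat_mod_distrib nat_add_distrib)
    moreover have "[int s ^ ((nat i + nat j) mod r) * c = int s ^ (nat i + nat j) * c] (mod int p)"
      by (intro cong_scalar_right power_mod_order assms)
    ultimately show ?thesis by (simp add: cong_def power_add)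
  qed
  show ?thesis
  proof (rule groupI)
    fix x y assume "x \<in> carrier (metacyclic_group p r s)" "y \<in> carrier (metacyclic_group p r s)"
    then show "x \<otimes>\<^bsub>metacyclic_group p r s\<^esub> y \<in> carrier (metacyclic_group p r s)"
      using p r by (auto simp: metacyclic_mult)
  next
    fix x y z assume "x \<in> carrier (metacyclic_group p r s)" "y \<in> carrier (metacyclic_group p r s)"
      "z \<in> carrier (metacyclic_group p r s)"
    then obtain a i b j c k where *: "x = (a, i)" "y = (b, j)" "z = (c, k)"
      "b \<in> {0..<int p}" "c \<in> {0..<int p}" "0 \<le> i" "0 \<le> j" by auto
    have "((a + int s ^ nat i * b) mod int p + int s ^ nat ((i + j) mod int r) * c) mod int p
      = (a + int s ^ nat i * b + int s ^ nat i * int s ^ nat j * c) mod int p"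
      using pw[OF *(6,7), of c] by (metis mod_add_left_eq mod_add_right_eq)
    also have "\<dots> = (a + int s ^ nat i * (b + int s ^ nat j * c)) mod int p"
      by (simp add: algebra_simps)
    also have "\<dots> = (a + int s ^ nat i * ((b + int s ^ nat j * c) mod int p)) mod int p"
      by (metis mod_add_right_eq mod_mult_right_eq)
    finally show "x \<otimes>\<^bsub>metacyclic_group p r s\<^esub> y \<otimes>\<^bsub>metacyclic_group p r s\<^esub> z
      = x \<otimes>\<^bsub>metacyclic_group p r s\<^esub> (y \<otimes>\<^bsub>metacyclic_group p r s\<^esub> z)"
      using * p r by (simp add: metacyclic_mult mod_simps add.assoc)
  next
    fix x assume "x \<in> carrier (metacyclic_group p r s)"
    then obtain a i where *: "x = (a, i)" "a \<in> {0..<int p}" "i \<in> {0..<int r}" by auto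
    show "\<exists>y\<in>carrier (metacyclic_group p r s).
      y \<otimes>\<^bsub>metacyclic_group p r s\<^esub> x = \<one>\<^bsub>metacyclic_group p r s\<^esub>"
      using * p r
      by (intro bexI[of _ "((- (int s ^ nat ((- i) mod int r) * a)) mod int p, (- i) mod int r)"])
        (auto simp: metacyclic_mult mod_simps)
  qed (use p r in \<open>auto simp: metacyclic_mult\<close>)
qed

lemma metacyclic_sigma_pow:
  fixes n :: nat
  assumes "p > 1" "r > 0"
  shows "metacyclic_sigma [^]\<^bsub>metacyclic_group p r s\<^esub> n = (int n mod int p, 0)"
  using assms
  by (induction n)
    (auto simp: metacyclic_sigma_def metacyclic_one nat_pow_def metacyclic_mult mod_simps add.commute)

lemma metacyclic_tau_pow:
  fixes n :: nat
  assumes "p > 0" "r > 0"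
  shows "metacyclic_tau r [^]\<^bsub>metacyclic_group p r s\<^esub> n = (0, int n mod int r)"
  using assms
  by (induction n)
    (auto simp: metacyclic_tau_def metacyclic_one nat_pow_def metacyclic_mult mod_simps add.commute)

text \<open>
  The defining relations hold and the group has order \<open>p * r\<close>.  As a group with this presentation
  has at most \<open>p * r\<close> elements, these facts identify the concrete group with the presented one.
\<close>

lemma metacyclic_relations:
  assumes "Factorial_Ring.prime p" "coprime p s" "ord p s = r"
  defines "G \<equiv> metacyclic_group p r s"
  shows "metacyclic_sigma [^]\<^bsub>G\<^esub> p = \<one>\<^bsub>G\<^esub>" "metacyclic_tau r [^]\<^bsub>G\<^esub> r = \<one>\<^bsub>G\<^esub>"
    "metacyclic_tau r \<otimes>\<^bsub>G\<^esub> metacyclic_sigma \<otimes>\<^bsub>G\<^esub> inv\<^bsub>G\<^esub> metacyclic_tau r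
      = metacyclic_sigma [^]\<^bsub>G\<^esub> s"
    "card (carrier G) = p * r"
    "generate G {metacyclic_sigma, metacyclic_tau r} = carrier G"
proof -
  have p: "p > 1" "p > 0" using assms(1) prime_gt_1_nat prime_gt_0_nat by blast+
  have r: "r > 0" using assms(2,3) coprime_ord by blast
  interpret group G unfolding G_def by (rule group_metacyclic_group[OF assms(1-3)])
  have car: "metacyclic_sigma \<in> carrier G" "metacyclic_tau r \<in> carrier G"
    using p r by (auto simp: G_def metacyclic_carrier metacyclic_sigma_def metacyclic_tau_def)
  show "metacyclic_sigma [^]\<^bsub>G\<^esub> p = \<one>\<^bsub>G\<^esub>" "metacyclic_tau r [^]\<^bsub>G\<^esub> r = \<one>\<^bsub>G\<^esub>"
    using p r by (simp_all add: G_def metacyclic_sigma_pow metacyclic_tau_pow metacyclic_one)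
  show "card (carrier G) = p * r"
    using p r by (simp add: G_def metacyclic_carrier)
  have "[int s ^ (1 mod r) = int s ^ 1] (mod int p)"
    by (rule power_mod_order) (fact assms)+
  moreover have "nat (1 mod int r) = 1 mod r"
    using nat_mod_distrib[of 1 "int r"] by simp
  ultimately have "metacyclic_tau r \<otimes>\<^bsub>G\<^esub> metacyclic_sigma
      = metacyclic_sigma [^]\<^bsub>G\<^esub> s \<otimes>\<^bsub>G\<^esub> metacyclic_tau r"
    using p r unfolding G_def
    by (simp add: metacyclic_sigma_pow)
      (simp add: metacyclic_tau_def metacyclic_sigma_def metacyclic_mult cong_def)
  then show "metacyclic_tau r \<otimes>\<^bsub>G\<^esub> metacyclic_sigma \<otimes>\<^bsub>G\<^esub> inv\<^bsub>G\<^esub> metacyclic_tau r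
      = metacyclic_sigma [^]\<^bsub>G\<^esub> s"
    using car by (simp add: m_assoc)
  let ?H = "generate G {metacyclic_sigma, metacyclic_tau r}"
  have sub: "subgroup ?H G" using car by (intro generate_is_subgroup) auto
  have "x \<in> ?H" if x: "x \<in> carrier G" for x
  proof -
    from x p r obtain a' i' where "x = (a', i')" "a' \<in> {0..<int p}" "i' \<in> {0..<int r}"
      by (auto simp: G_def metacyclic_carrier)
    then obtain a i where "x = (int a, int i)" "a < p" "i < r"
      by (cases a'; cases i') auto
    then have "x = metacyclic_sigma [^]\<^bsub>G\<^esub> a \<otimes>\<^bsub>G\<^esub> metacyclic_tau r [^]\<^bsub>G\<^esub> i"
      using p r by (simp add: G_def metacyclic_sigma_pow metacyclic_tau_pow metacyclic_mult)
    moreover have "metacyclic_sigma [^]\<^bsub>G\<^esub> a \<in> ?H" "metacyclic_tau r [^]\<^bsub>G\<^esub> i \<in> ?H"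
      using subgroup_int_pow_closed[OF sub, of metacyclic_sigma "int a"]
        subgroup_int_pow_closed[OF sub, of "metacyclic_tau r" "int i"]
      by (simp_all add: generate.incl int_pow_int)
    ultimately show ?thesis using subgroup.m_closed[OF sub] by simp
  qed
  then show "?H = carrier G"
    using subgroup.subset[OF sub] by blast
qed


section \<open>Number fields and their primes\<close>

text \<open>Number fields are taken inside the complex numbers; every number field embeds there.\<close>

abbreviation complex_ring :: "complex ring"
  where "complex_ring \<equiv> ring_of_type_algebra"

definition number_field :: "complex set \<Rightarrow> bool"
  where "number_field K \<longleftrightarrow> subfield K complex_ring \<and> ring.finite_dimension complex_ring \<rat> K"

definition totally_real :: "complex set \<Rightarrow> bool"
  where "totally_real K \<longleftrightarrow>
    (\<forall>\<phi> \<in> ring_hom (complex_ring\<lparr>carrier := K\<rparr>) complex_ring. \<phi> ` K \<subseteq> \<real>)"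

text \<open>Automorphisms of \<open>L\<close> are extensional functions, i.e. \<open>undefined\<close> outside \<open>L\<close>.\<close>

definition Gal :: "complex set \<Rightarrow> complex set \<Rightarrow> (complex \<Rightarrow> complex) monoid"
  where "Gal L K = (BijGroup L)
    \<lparr>carrier := {f \<in> Bij L. f \<in> ring_hom (complex_ring\<lparr>carrier := L\<rparr>) (complex_ring\<lparr>carrier := L\<rparr>)
                   \<and> (\<forall>x\<in>K. f x = x)}\<rparr>"

text \<open>Artin's definition: \<open>L/K\<close> is finite and \<open>K\<close> is the fixed field of \<open>Aut(L/K)\<close>.\<close>

definition finite_galois_extension :: "complex set \<Rightarrow> complex set \<Rightarrow> bool"
  where "finite_galois_extension L K \<longleftrightarrow>
    subfield K complex_ring \<and> subfield L complex_ring \<and> K \<subseteq> L \<and>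
    ring.finite_dimension complex_ring K L \<and>
    {x \<in> L. \<forall>f \<in> carrier (Gal L K). f x = x} = K"

definition ring_of_integers :: "complex set \<Rightarrow> complex ring"
  where "ring_of_integers L = complex_ring\<lparr>carrier := {x \<in> L. algebraic_int x}\<rparr>"

text \<open>Finite primes are the nonzero prime ideals of the ring of integers.\<close>

definition finite_primes :: "complex set \<Rightarrow> complex set set"
  where "finite_primes L = {w. primeideal w (ring_of_integers L) \<and> w \<noteq> {0}}"

definition prime_below :: "complex set \<Rightarrow> complex set \<Rightarrow> complex set"
  where "prime_below K w = w \<inter> carrier (ring_of_integers K)"

definition decomposition_group ::
  "complex set \<Rightarrow> complex set \<Rightarrow> complex set \<Rightarrow> (complex \<Rightarrow> complex) set"
  where "decomposition_group L K w = {f \<in> carrier (Gal L K). f ` w = w}"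

definition inertia_group ::
  "complex set \<Rightarrow> complex set \<Rightarrow> complex set \<Rightarrow> (complex \<Rightarrow> complex) set"
  where "inertia_group L K w =
    {f \<in> decomposition_group L K w. \<forall>x \<in> carrier (ring_of_integers L). f x - x \<in> w}"

end

theory Submission
  imports Defs
begin

text \<open>
  Let \<open>N\<close> be an extension of the \<open>p\<close>-adic absolute value to the algebraic numbers, and
  \<open>d\<^sub>i e\<^sub>i = p - 1\<close> with \<open>d\<^sub>i\<close> the index of \<open>C\<^sub>p\<close> in \<open>D\<^sub>i\<close>.  Approximation yields monic integer
  polynomials with only real roots: \<open>f\<close>, \<open>p\<close>-adically close to \<open>X\<^sup>p - p\<close>, and \<open>h\<close>, close to
  the product of the \<open>(X - 3pi)\<^bsup>e\<^sub>i\<^esup> + p\<close>, of prime degree \<open>q > p\<close> and Eisenstein at \<open>2\<close>.  By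
  Krasner's argument the decomposition group of \<open>N\<close> over the rationals acts on the roots of \<open>f\<close> and
  \<open>h\<close> as on those of the polynomials they approximate.  Hence it is totally ramified, acts on the
  roots of \<open>f\<close> as the full affine group \<open>AGL(1, p)\<close>, and the stabiliser of a suitable root
  \<open>\<theta>\<^sub>i\<close> of \<open>h\<close> consists of the maps of slope \<open>u\<close> with \<open>u\<^bsup>d\<^sub>i\<^esup> = 1\<close>.  On the other hand an element
  of order \<open>q\<close> in the global Galois group fixes the roots of \<open>f\<close> and permutes those of \<open>h\<close>
  cyclically.  So take \<open>L\<close> to be generated by the roots of \<open>f\<close> and one root \<open>t\<close> of \<open>h\<close>, and
  \<open>K\<close> to be the fixed field of \<open>\<Gamma>\<close>, viewed in \<open>AGL(1, p)\<close> and fixing \<open>t\<close>: the prime of \<open>L\<close>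
  induced by \<open>N\<close> through an embedding over the roots of \<open>f\<close> with \<open>t \<mapsto> \<theta>\<^sub>i\<close> is \<open>w\<^sub>i\<close>.
\<close>

section \<open>Valuation rings and absolute values\<close>

text \<open>No completions are formed: the local Galois group is the stabiliser of \<open>N\<close>
  in the Galois group of one large splitting field. Its order is squeezed. A pair (slope,
  translation) determines an automorphism, so there are at most p (p - 1) of them, while elements of
  value p^(-1/p) and p^(-1/(p - 1)) force divisibility by p and by p - 1. Equality yields the full
  affine group and total ramification at once, and the latter gives I_i = D_i. The exponents e_i
  arise because X^(p - 1) + p defines the p-adic p-th cyclotomic field: d_i-th powers of its roots
  are roots of X^(e_i) + p, and slope u multiplies such a power by u^(d_i) up to higher order. The
  shifts 3pi join these factors in one polynomial h and keep the primes of K apart. The global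
  obstacle is to see several local situations in a single field: the conjugates of t must be
  permuted without disturbing the roots of f. The prime degree q and the Eisenstein condition at 2,
  a prime other than p, supply an element of order q, which cannot move the members of an invariant
  set with fewer than q elements.\<close>

definition subrng :: "'a::field set \<Rightarrow> bool"
  where "subrng A \<longleftrightarrow> 1 \<in> A \<and> (\<forall>x\<in>A. \<forall>y\<in>A. x - y \<in> A \<and> x * y \<in> A)"

lemma subrngD:
  assumes "subrng A"
  shows subrng_1: "1 \<in> A"
    and subrng_0: "0 \<in> A"
    and subrng_diff: "x \<in> A \<Longrightarrow> y \<in> A \<Longrightarrow> x - y \<in> A"
    and subrng_mult: "x \<in> A \<Longrightarrow> y \<in> A \<Longrightarrow> x * y \<in> A"
    and subrng_uminus: "x \<in> A \<Longrightarrow> - x \<in> A"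
    and subrng_add: "x \<in> A \<Longrightarrow> y \<in> A \<Longrightarrow> x + y \<in> A"
proof -
  show 1: "1 \<in> A" and d: "\<And>x y. x \<in> A \<Longrightarrow> y \<in> A \<Longrightarrow> x - y \<in> A"
    and "x \<in> A \<Longrightarrow> y \<in> A \<Longrightarrow> x * y \<in> A"
    using assms by (auto simp: subrng_def)
  show z: "0 \<in> A" using d[OF 1 1] by simp
  show u: "\<And>x. x \<in> A \<Longrightarrow> - x \<in> A" using d[OF z] by fastforce
  show "x \<in> A \<Longrightarrow> y \<in> A \<Longrightarrow> x + y \<in> A" using d[of x "- y"] u by simp
qed

lemma subrng_sum: "subrng A \<Longrightarrow> (\<And>i. i \<in> I \<Longrightarrow> f i \<in> A) \<Longrightarrow> sum f I \<in> A"
  by (induction I rule: infinite_finite_induct) (auto intro: subrng_0 subrng_1 subrng_add subrng_mult)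

lemma subrng_pow: "subrng A \<Longrightarrow> x \<in> A \<Longrightarrow> x ^ n \<in> A"
  by (induction n) (auto intro: subrng_0 subrng_1 subrng_add subrng_mult)

lemma subrng_poly:
  assumes "subrng A" "\<And>i. coeff q i \<in> A" "x \<in> A"
  shows "poly q x \<in> A"
  unfolding poly_altdef using assms by (intro subrng_sum subrng_mult subrng_pow) auto

lemma subrng_of_int: "subrng A \<Longrightarrow> of_int n \<in> A"
proof -
  assume A: "subrng A"
  have "of_nat m \<in> A" for m by (induction m) (use A in \<open>auto intro: subrng_0 subrng_1 subrng_add\<close>)
  then show ?thesis using A by (cases n rule: int_cases2) (auto intro: subrng_uminus)
qed

definition ring_adjoin :: "'a::field set \<Rightarrow> 'a \<Rightarrow> 'a set"
  where "ring_adjoin A x = {poly q x | q. \<forall>i. coeff q i \<in> A}"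

lemma subrng_ring_adjoin:
  assumes "subrng A"
  shows "subrng (ring_adjoin A x)" "A \<subseteq> ring_adjoin A x" "x \<in> ring_adjoin A x"
proof -
  note A = subrngD[OF assms]
  show s: "A \<subseteq> ring_adjoin A x"
  proof
    fix a assume "a \<in> A"
    then have "poly [:a:] x \<in> ring_adjoin A x"
      unfolding ring_adjoin_def using A by (intro CollectI exI[of _ "[:a:]"]) (auto simp: coeff_pCons split: nat.split)
    then show "a \<in> ring_adjoin A x" by simp
  qed
  have "poly [:0, 1:] x \<in> ring_adjoin A x"
    unfolding ring_adjoin_def using A by (intro CollectI exI[of _ "[:0, 1:]"]) (auto simp: coeff_pCons split: nat.split)
  then show "x \<in> ring_adjoin A x" by simp
  show "subrng (ring_adjoin A x)"
    unfolding subrng_def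
  proof (intro conjI ballI)
    show "1 \<in> ring_adjoin A x" using s A by blast
    fix a b assume "a \<in> ring_adjoin A x" "b \<in> ring_adjoin A x"
    then obtain q r where q: "a = poly q x" "\<And>i. coeff q i \<in> A" "b = poly r x" "\<And>i. coeff r i \<in> A"
      by (auto simp: ring_adjoin_def)
    have "a - b = poly (q - r) x" "\<forall>i. coeff (q - r) i \<in> A" using q A by auto
    then show "a - b \<in> ring_adjoin A x" unfolding ring_adjoin_def by blast
    have "a * b = poly (q * r) x" "\<forall>i. coeff (q * r) i \<in> A"
      using q by (auto simp: coeff_mult intro!: subrng_sum assms A)
    then show "a * b \<in> ring_adjoin A x" unfolding ring_adjoin_def by blast
  qed
qed

lemma sum_poly_times_inverse_power:
  fixes y :: "'a::field"
  assumes "y \<noteq> 0" "degree q \<le> n"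
  shows "poly q (inverse y) * y ^ n = (\<Sum>i\<le>n. coeff q i * y ^ (n - i))"
proof -
  have "poly q (inverse y) * y ^ n = (\<Sum>i\<le>n. coeff q i * inverse y ^ i) * y ^ n"
    using assms(2) unfolding poly_altdef
    by (intro arg_cong2[where f = "(*)"] sum.mono_neutral_left refl) (auto simp: coeff_eq_0)
  also have "\<dots> = (\<Sum>i\<le>n. coeff q i * y ^ (n - i))"
    unfolding sum_distrib_right
  proof (intro sum.cong refl)
    fix i assume "i \<in> {..n}"
    then have "y ^ n = y ^ i * y ^ (n - i)" by (simp flip: power_add)
    then show "coeff q i * inverse y ^ i * y ^ n = coeff q i * y ^ (n - i)"
      using assms(1) by (simp add: field_simps)
  qed
  finally show ?thesis .
qed

text \<open>
  A subring that is maximal among those not containing \<open>1 / t\<close> is a valuation ring; this is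
  Chevalley's extension theorem.
\<close>

lemma exists_valuation_ring:
  fixes A :: "'a::field set"
  assumes A: "subrng A" "t \<in> A" "inverse t \<notin> A"
  obtains V where "subrng V" "A \<subseteq> V" "inverse t \<notin> V"
    "\<And>x. x \<in> V \<or> inverse x \<in> V"
    "\<And>b. b \<in> V \<Longrightarrow> inverse (1 - t * b) \<in> V"
proof -
  define \<A> where "\<A> = {W. subrng W \<and> A \<subseteq> W \<and> inverse t \<notin> W}"
  have "\<exists>M\<in>\<A>. \<forall>Z\<in>\<A>. M \<subseteq> Z \<longrightarrow> Z = M"
  proof (rule subset_Zorn_nonempty)
    show "\<A> \<noteq> {}" using A by (auto simp: \<A>_def)
    fix \<C> assume "\<C> \<noteq> {}" and C: "subset.chain \<A> \<C>"
    then have sub: "\<C> \<subseteq> \<A>" by (auto simp: subset.chain_def)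
    have lin: "Z \<subseteq> Z' \<or> Z' \<subseteq> Z" if "Z \<in> \<C>" "Z' \<in> \<C>" for Z Z'
      using C that by (auto simp: subset.chain_def)
    have "subrng (\<Union>\<C>)"
      unfolding subrng_def
    proof (intro conjI ballI)
      show "1 \<in> \<Union>\<C>" using \<open>\<C> \<noteq> {}\<close> sub by (auto simp: \<A>_def subrng_def)
      fix x y assume "x \<in> \<Union>\<C>" "y \<in> \<Union>\<C>"
      then obtain Z where "Z \<in> \<C>" "x \<in> Z" "y \<in> Z" using lin by blast
      moreover have "subrng Z" using \<open>Z \<in> \<C>\<close> sub by (auto simp: \<A>_def)
      ultimately show "x - y \<in> \<Union>\<C>" "x * y \<in> \<Union>\<C>" using subrng_diff subrng_mult by blast+
    qed
    then show "\<Union>\<C> \<in> \<A>" using \<open>\<C> \<noteq> {}\<close> sub by (auto simp: \<A>_def)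
  qed
  then obtain V where V: "subrng V" "A \<subseteq> V" "inverse t \<notin> V"
    and max: "\<And>W. subrng W \<Longrightarrow> V \<subseteq> W \<Longrightarrow> inverse t \<notin> W \<Longrightarrow> W = V"
    unfolding \<A>_def by auto
  note r = subrngD[OF V(1)]
  have t: "t \<in> V" "t \<noteq> 0" using A V r by auto
  have adj: "inverse t \<in> ring_adjoin V x" if "x \<notin> V" for x
    using max[of "ring_adjoin V x"] subrng_ring_adjoin[OF V(1), of x] that by blast
  \<comment> \<open>For y = 1 - t b, maximality would give 1/t as a polynomial in 1/y. Multiplying
    by a power of y, which is 1 modulo t, puts 1/t minus an element of \<open>V\<close> into
    \<open>V\<close>.\<close>
  have unit: "inverse (1 - t * b) \<in> V" if b: "b \<in> V" for b
  proof (rule ccontr)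
    define y where "y = 1 - t * b"
    assume "inverse (1 - t * b) \<notin> V"
    then obtain q where q: "inverse t = poly q (inverse y)" "\<And>i. coeff q i \<in> V"
      using adj[of "inverse y"] by (auto simp: ring_adjoin_def y_def)
    have y: "y \<in> V" "y \<noteq> 0"
      using V b r t by (auto simp: y_def dest!: inverse_unique)
    have "\<exists>c\<in>V. y ^ n = 1 - t * c" for n
    proof (induction n)
      case (Suc n)
      then obtain c where "c \<in> V" "y ^ n = 1 - t * c" by blast
      then have "y ^ Suc n = (1 - t * b) * (1 - t * c)" by (simp add: y_def)
      then have "y ^ Suc n = 1 - t * (b + c - t * b * c)" by (simp add: algebra_simps)
      moreover have "b + c - t * b * c \<in> V" using b t(1) \<open>c \<in> V\<close> by (intro r(3,4,6))
      ultimately show ?case by blast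
    qed (use r in auto)
    then obtain c where c: "c \<in> V" "y ^ degree q = 1 - t * c" by blast
    have "inverse t * y ^ degree q \<in> V"
      using q y sum_poly_times_inverse_power[of y q "degree q"]
      by (auto intro!: subrng_sum subrng_mult subrng_pow V)
    then have "inverse t - c \<in> V"
      using c t by (simp add: algebra_simps)
    then show False using c r(6)[of "inverse t - c" c] V by simp
  qed
  \<comment> \<open>\<open>P x n\<close> records that 1/t is a polynomial in x of degree at most n
    over \<open>V\<close>; by maximality this happens for some n whenever x is outside
    \<open>V\<close>.\<close>
  define P where "P x n \<longleftrightarrow> (\<exists>f. (\<forall>i. f i \<in> V) \<and> t * (\<Sum>i\<le>n. f i * x ^ i) = 1)" for x and n :: nat
  have P: "\<exists>n. P x n" if x: "x \<notin> V" for x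
  proof -
    obtain q where q: "inverse t = poly q x" "\<And>i. coeff q i \<in> V"
      using adj[OF x] by (auto simp: ring_adjoin_def)
    then have "t * (\<Sum>i\<le>degree q. coeff q i * x ^ i) = 1"
      using t right_inverse[of t] by (simp flip: poly_altdef)
    then show ?thesis unfolding P_def using q by blast
  qed
  have P0: False if x: "P x 0" for x
  proof -
    obtain f where "f 0 \<in> V" "t * f (0 :: nat) = 1" using x unfolding P_def by auto
    then show False using V inverse_unique[of t "f 0"] by simp
  qed
  \<comment> \<open>In the relation for 1/x the constant term is moved to the other side, where 1 -
    t g(0) is a unit. Multiplying by x^(n+1) expresses x^(n+1) by lower powers, which removes the
    top term of the relation for x.\<close>
  have step: "P x n" if *: "P x (Suc n)" "P (inverse x) m" "m \<le> Suc n" "x \<noteq> 0" for x n m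
  proof -
    obtain f where f: "\<And>i. f i \<in> V" "t * (\<Sum>i\<le>Suc n. f i * x ^ i) = 1"
      using * unfolding P_def by blast
    obtain g where g: "\<And>i. g i \<in> V" "t * (\<Sum>i\<le>m. g i * inverse x ^ i) = 1"
      using * unfolding P_def by blast
    define u where "u = inverse (1 - t * g 0)"
    have u: "u \<in> V" using unit g by (simp add: u_def)
    have nz: "1 - t * g 0 \<noteq> 0" using g V inverse_unique[of t "g 0"] by auto
    define g' where "g' i = (if i \<le> m then g i else 0)" for i
    have g': "g' i \<in> V" for i using g r by (simp add: g'_def)
    have "(\<Sum>i\<le>m. g i * inverse x ^ i) = (\<Sum>i\<le>Suc n. g' i * inverse x ^ i)"
      using that(3) by (intro sum.mono_neutral_cong_left) (auto simp: g'_def)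
    then have "t * (g' 0 + (\<Sum>i\<le>n. g' (Suc i) * inverse x ^ Suc i)) = 1"
      using g by (simp add: sum.atMost_Suc_shift del: power_Suc sum.atMost_Suc)
    then have "t * (\<Sum>i\<le>n. g' (Suc i) * inverse x ^ Suc i) = 1 - t * g 0"
      by (simp add: g'_def algebra_simps)
    then have "1 = u * t * (\<Sum>i\<le>n. g' (Suc i) * inverse x ^ Suc i)"
      using nz by (simp add: u_def field_simps)
    then have "x ^ Suc n = u * t * (\<Sum>i\<le>n. g' (Suc i) * (inverse x ^ Suc i * x ^ Suc n))"
      by (metis (no_types, lifting) mult.assoc mult_1 sum.cong sum_distrib_right)
    also have "(\<Sum>i\<le>n. g' (Suc i) * (inverse x ^ Suc i * x ^ Suc n)) = (\<Sum>i\<le>n. g' (Suc i) * x ^ (n - i))"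
    proof (intro sum.cong refl)
      fix i assume "i \<in> {..n}"
      then have "x ^ Suc n = x ^ Suc i * x ^ (n - i)" by (simp flip: power_add power_Suc)
      then show "g' (Suc i) * (inverse x ^ Suc i * x ^ Suc n) = g' (Suc i) * x ^ (n - i)"
        using that(4) by (simp add: power_inverse field_simps del: power_Suc)
    qed
    also have "\<dots> = (\<Sum>i\<le>n. g' (Suc (n - i)) * x ^ i)"
      by (rule sum.reindex_bij_witness[of _ "\<lambda>i. n - i" "\<lambda>i. n - i"]) auto
    finally have "f (Suc n) * x ^ Suc n = (\<Sum>i\<le>n. f (Suc n) * u * t * g' (Suc (n - i)) * x ^ i)"
      by (simp add: sum_distrib_left mult.assoc)
    then have "(\<Sum>i\<le>Suc n. f i * x ^ i) = (\<Sum>i\<le>n. (f i + f (Suc n) * u * t * g' (Suc (n - i))) * x ^ i)"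
      by (simp add: distrib_right sum.distrib)
    then show "P x n"
      unfolding P_def using f g' u t r by (intro exI[of _ "\<lambda>i. f i + f (Suc n) * u * t * g' (Suc (n - i))"]) auto
  qed
  \<comment> \<open>Descent on n + m: the longer of the two relations can always be shortened, until
    one of them has degree 0.\<close>
  have no: "\<not> (P x n \<and> P (inverse x) m)" if "x \<noteq> 0" for x n m
    using that
  proof (induction "n + m" arbitrary: n m x rule: less_induct)
    case less
    show ?case
    proof
      assume *: "P x n \<and> P (inverse x) m"
      then have "n \<noteq> 0" "m \<noteq> 0" using P0 by (metis, metis)
      then obtain n' m' where n': "n = Suc n'" "m = Suc m'" by (metis not0_implies_Suc)
      show False
      proof (cases "m \<le> n")
        case True
        then have "P x n'" using step[of x n' m] * n' less.prems by auto
        then show False using less.hyps[of n' m x] * n' less.prems by auto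
      next
        case False
        then have "P (inverse x) m'" using step[of "inverse x" m' n] * n' less.prems by auto
        then show False using less.hyps[of n m' x] * n' less.prems by auto
      qed
    qed
  qed
  have "x \<in> V \<or> inverse x \<in> V" for x
  proof (rule ccontr)
    assume *: "\<not> ?thesis"
    then have "x \<noteq> 0" using r by auto
    then show False using no[of x] P[of x] P[of "inverse x"] * by blast
  qed
  then show ?thesis using that V unit by blast
qed

section \<open>Algebraic integers and algebraic numbers through valuation rings\<close>

text \<open>Otherwise x is outside \<open>V\<close>, so 1/x lies in \<open>V\<close>; dividing the
  equation by a power of x then writes the leading coefficient times x as a polynomial in 1/x over
  \<open>V\<close>.\<close>

lemma valuation_ring_lead_coeff_mult:
  fixes V :: "'a::field set"
  assumes V: "subrng V" "\<And>x. x \<in> V \<or> inverse x \<in> V"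
    and q: "\<And>i. coeff q i \<in> V" "poly q x = 0"
  shows "lead_coeff q * x \<in> V"
proof (rule ccontr)
  assume x: "lead_coeff q * x \<notin> V"
  have "x \<notin> V" using x q(1) subrng_mult[OF V(1)] by blast
  then have i: "inverse x \<in> V" using V by blast
  have x0: "x \<noteq> 0" using x subrngD[OF V(1)] by auto
  have "degree q \<noteq> 0"
  proof
    assume "degree q = 0"
    then obtain a where "q = [:a:]" by (rule degree_eq_zeroE)
    then show False using q(2) x subrngD[OF V(1)] by simp
  qed
  then obtain n where n: "degree q = Suc n" by (metis not0_implies_Suc)
  have "0 = (\<Sum>i\<le>Suc n. coeff q i * x ^ i)" using q(2) n by (simp add: poly_altdef)
  also have "\<dots> = lead_coeff q * x ^ Suc n + (\<Sum>i\<le>n. coeff q i * x ^ i)" using n by simp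
  finally have "lead_coeff q * x ^ Suc n * inverse x ^ n = - (\<Sum>i\<le>n. coeff q i * x ^ i) * inverse x ^ n"
    by (simp add: add_eq_0_iff2)
  also have "\<dots> = - (\<Sum>i\<le>n. coeff q i * inverse x ^ (n - i))"
  proof -
    have "(\<Sum>i\<le>n. coeff q i * x ^ i) * inverse x ^ n = (\<Sum>i\<le>n. coeff q i * inverse x ^ (n - i))"
      unfolding sum_distrib_right
    proof (intro sum.cong refl)
      fix i assume "i \<in> {..n}"
      then have "inverse x ^ n = inverse x ^ i * inverse x ^ (n - i)" by (simp flip: power_add)
      then show "coeff q i * x ^ i * inverse x ^ n = coeff q i * inverse x ^ (n - i)"
        using x0 by (simp add: power_inverse field_simps)
    qed
    then show ?thesis by simp
  qed
  also have "\<dots> \<in> V" using V q i by (intro subrng_uminus subrng_sum subrng_mult subrng_pow)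
  finally show False using x x0 by (simp add: power_inverse field_simps)
qed

lemma valuation_ring_integrally_closed:
  fixes V :: "'a::field set"
  assumes "subrng V" "\<And>x. x \<in> V \<or> inverse x \<in> V"
    and "\<And>i. coeff q i \<in> V" "lead_coeff q = 1" "poly q x = 0"
  shows "x \<in> V"
  using valuation_ring_lead_coeff_mult[OF assms(1,2,3,5)] assms(4) by simp

lemma algebraic_int_in_valuation_ring:
  assumes "subrng V" "\<And>x. x \<in> V \<or> inverse x \<in> V" "algebraic_int x"
  shows "x \<in> V"
proof -
  obtain q where q: "\<forall>i. coeff q i \<in> \<int>" "poly q x = 0" "lead_coeff q = 1"
    using assms(3) unfolding algebraic_int.simps by blast
  have "coeff q i \<in> V" for i
    using q(1) subrng_of_int[OF assms(1)] by (metis Ints_cases)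
  then show ?thesis
    using valuation_ring_integrally_closed[OF assms(1,2)] q by blast
qed

text \<open>A non-integral z does not lie in Z[1/z], so Chevalley's theorem with t = 1/z gives a
  valuation ring that misses z. Integrality thus becomes membership in rings, which makes sums and
  products of algebraic integers integral.\<close>

lemma algebraic_int_valuation_ringI:
  fixes z :: "'a::field_char_0"
  assumes "\<And>V. subrng V \<Longrightarrow> (\<And>x. x \<in> V \<or> inverse x \<in> V) \<Longrightarrow> z \<in> V"
  shows "algebraic_int z"
proof (rule ccontr)
  assume nz: "\<not> algebraic_int z"
  then have z: "z \<noteq> 0" by auto
  have sI: "subrng (\<int> :: 'a set)" by (auto simp: subrng_def)
  define A where "A = ring_adjoin \<int> (inverse z)"
  have A: "subrng A" "inverse z \<in> A" unfolding A_def using subrng_ring_adjoin[OF sI] by auto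
  have "inverse (inverse z) \<notin> A"
  proof
    assume "inverse (inverse z) \<in> A"
    then obtain q where q: "z = poly q (inverse z)" "\<And>i. coeff q i \<in> \<int>"
      by (auto simp: A_def ring_adjoin_def)
    define n where "n = degree q"
    have "z ^ Suc n = (\<Sum>i\<le>n. coeff q i * z ^ (n - i))"
      using q sum_poly_times_inverse_power[OF z, of q n] by (simp add: n_def)
    also have "\<dots> = (\<Sum>i\<le>n. coeff q (n - i) * z ^ i)"
      by (rule sum.reindex_bij_witness[of _ "\<lambda>i. n - i" "\<lambda>i. n - i"]) auto
    finally have e: "z ^ Suc n = (\<Sum>i\<le>n. coeff q (n - i) * z ^ i)" .
    \<comment> \<open>The equation z = q(1/z), multiplied by z^n, is a monic integral equation of
      degree n + 1.\<close>
    define P where "P = monom 1 (Suc n) - (\<Sum>i\<le>n. monom (coeff q (n - i)) i)"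
    have c: "coeff P i = (if i = Suc n then 1 else if i \<le> n then - coeff q (n - i) else 0)" for i
      by (auto simp: P_def coeff_sum coeff_monom if_distrib[of "\<lambda>x. x = _"] sum.delta cong: if_cong)
    have d: "degree P = Suc n"
      by (intro antisym degree_le le_degree) (auto simp: c)
    have "poly P z = 0" using e by (simp add: P_def poly_sum poly_monom)
    moreover have "lead_coeff P = 1" "\<And>i. coeff P i \<in> \<int>" using q d by (auto simp: c)
    ultimately show False using nz by (auto simp: algebraic_int.simps)
  qed
  then obtain V where "subrng V" "inverse (inverse z) \<notin> V" "\<And>x. x \<in> V \<or> inverse x \<in> V"
    using exists_valuation_ring[OF A] by metis
  then show False using assms[of V] by simp
qed

lemma
  fixes x y :: "'a::field_char_0"
  assumes "algebraic_int x" "algebraic_int y"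
  shows algebraic_int_plus: "algebraic_int (x + y)"
    and algebraic_int_diff: "algebraic_int (x - y)"
    and algebraic_int_mult: "algebraic_int (x * y)"
  by (rule algebraic_int_valuation_ringI;
      metis assms algebraic_int_in_valuation_ring subrng_add subrng_diff subrng_mult)+

lemma subrng_algebraic_int: "subrng {x::'a::field_char_0. algebraic_int x}"
  by (auto simp: subrng_def algebraic_int_diff algebraic_int_mult intro: int_imp_algebraic_int)

lemma algebraic_int_lead_coeff_mult:
  fixes x :: "'a::field_char_0"
  assumes "\<And>i. algebraic_int (coeff q i)" "poly q x = 0"
  shows "algebraic_int (lead_coeff q * x)"
proof (rule algebraic_int_valuation_ringI)
  fix V :: "'a set" assume V: "subrng V" "\<And>x. x \<in> V \<or> inverse x \<in> V"
  show "lead_coeff q * x \<in> V"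
    by (rule valuation_ring_lead_coeff_mult[OF V _ assms(2)])
      (rule algebraic_int_in_valuation_ring[OF V assms(1)])
qed

lemma algebraic_iff_int_multiple:
  fixes x :: "'a::field_char_0"
  shows "algebraic x \<longleftrightarrow> (\<exists>n. n \<noteq> 0 \<and> algebraic_int (of_int n * x))"
proof
  assume "algebraic x"
  then obtain q where q: "\<And>i. coeff q i \<in> \<int>" "q \<noteq> 0" "poly q x = 0"
    by (auto simp: algebraic_def)
  obtain n where n: "lead_coeff q = of_int n" using q(1) by (metis Ints_cases)
  have "algebraic_int (lead_coeff q * x)"
    by (rule algebraic_int_lead_coeff_mult[OF int_imp_algebraic_int[OF q(1)] q(3)])
  then show "\<exists>n. n \<noteq> 0 \<and> algebraic_int (of_int n * x)" using n q(2) by (intro exI[of _ n]) auto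
next
  assume "\<exists>n. n \<noteq> 0 \<and> algebraic_int (of_int n * x)"
  then obtain n q where n: "n \<noteq> 0" and q: "\<And>i. coeff q i \<in> \<int>" "lead_coeff q = 1" "poly q (of_int n * x) = 0"
    by (auto simp: algebraic_int.simps)
  have "poly (pcompose q [:0, of_int n:]) x = 0" using q by (simp add: poly_pcompose mult.commute)
  moreover have "pcompose q [:0, of_int n:] \<noteq> 0"
    using n q(2) by (subst pcompose_eq_0_iff) auto
  moreover have "coeff (pcompose q [:0, of_int n:]) i \<in> \<int>" for i
    using q(1) by (simp add: coeff_pcompose_linear)
  ultimately show "algebraic x" unfolding algebraic_def by blast
qed

lemma
  fixes x y :: "'a::field_char_0"
  assumes "algebraic x" "algebraic y"
  shows algebraic_plus: "algebraic (x + y)"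
    and algebraic_diff: "algebraic (x - y)"
    and algebraic_mult: "algebraic (x * y)"
proof -
  obtain n m where n: "n \<noteq> 0" "algebraic_int (of_int n * x)" and m: "m \<noteq> 0" "algebraic_int (of_int m * y)"
    using assms by (auto simp: algebraic_iff_int_multiple)
  have "algebraic_int (of_int m * (of_int n * x))" "algebraic_int (of_int n * (of_int m * y))"
    using n m algebraic_int_mult[OF int_imp_algebraic_int[OF Ints_of_int]] by blast+
  from algebraic_int_plus[OF this] algebraic_int_diff[OF this] algebraic_int_mult[OF n(2) m(2)]
  have "algebraic_int (of_int (n * m) * (x + y))" "algebraic_int (of_int (n * m) * (x - y))"
    "algebraic_int (of_int (n * m) * (x * y))"
    by (simp_all add: algebra_simps)
  moreover have "n * m \<noteq> 0" using n m by simp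
  ultimately show "algebraic (x + y)" "algebraic (x - y)" "algebraic (x * y)"
    unfolding algebraic_iff_int_multiple by blast+
qed

lemma algebraic_of_int: "algebraic (of_int n :: 'a::field_char_0)"
  by (intro algebraic_int_imp_algebraic int_imp_algebraic_int) simp

lemma algebraic_Rats: "x \<in> \<rat> \<Longrightarrow> algebraic (x :: 'a::field_char_0)"
proof (elim Rats_cases')
  fix a b :: int assume "b > 0" "x = of_int a / of_int b"
  then show "algebraic x"
    unfolding algebraic_iff_int_multiple by (intro exI[of _ b]) (auto intro: int_imp_algebraic_int)
qed

text \<open>
  Every nonzero algebraic number \<open>x\<close> has a power \<open>x\<^sup>b\<close> that is a power \<open>l\<^sup>k\<close> times a unit of
  the valuation ring, which determines the value of \<open>x\<close> as \<open>l\<close> to the power \<open>- k / b\<close>.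
\<close>

lemma exists_absolute_value:
  assumes l: "Factorial_Ring.prime (l::nat)"
  obtains N :: "complex \<Rightarrow> real" where
    "N 0 = 0"
    "\<And>x. algebraic x \<Longrightarrow> x \<noteq> 0 \<Longrightarrow> N x > 0"
    "\<And>x y. algebraic x \<Longrightarrow> algebraic y \<Longrightarrow> N (x * y) = N x * N y"
    "\<And>x y. algebraic x \<Longrightarrow> algebraic y \<Longrightarrow> N (x + y) \<le> max (N x) (N y)"
    "\<And>x. algebraic_int x \<Longrightarrow> N x \<le> 1"
    "N (of_nat l) = inverse (real l)"
    "\<And>x. algebraic x \<Longrightarrow> x \<noteq> 0 \<Longrightarrow> \<exists>b>0. \<exists>k. N x ^ b = real l powi k"
proof -
  have l1: "l > 1" and l0: "l > 0" using l prime_gt_1_nat prime_gt_0_nat by auto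
  let ?t = "of_nat l :: complex"
  have sI: "subrng (\<int> :: complex set)" by (auto simp: subrng_def)
  have "inverse ?t \<notin> \<int>"
  proof
    assume "inverse ?t \<in> \<int>"
    then obtain k :: int where "inverse ?t = of_int k" by (auto elim: Ints_cases)
    then have "(of_int (k * int l) :: complex) = of_int 1" using l0 by (simp add: field_simps)
    then have "k * int l = 1" by (simp only: of_int_eq_iff)
    then show False using l1 by (simp add: zmult_eq_1_iff)
  qed
  then obtain V :: "complex set" where V: "subrng V" and ninv: "inverse ?t \<notin> V"
    and val: "\<And>x. x \<in> V \<or> inverse x \<in> V"
    and unit: "\<And>b. b \<in> V \<Longrightarrow> inverse (1 - ?t * b) \<in> V"
    using exists_valuation_ring[OF sI, of ?t] by (metis Ints_of_nat)
  note r = subrngD[OF V]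
  have intV: "of_int n \<in> V" for n using subrng_of_int[OF V] .
  have natV: "of_nat n \<in> V" for n using intV[of "int n"] by simp
  have t0: "?t \<noteq> 0" using l0 by simp
  define U where "U y \<longleftrightarrow> y \<noteq> 0 \<and> y \<in> V \<and> inverse y \<in> V" for y
  have U_mult: "U (x * y)" if "U x" "U y" for x y using that r(4) by (auto simp: U_def)
  have U_inv: "U (inverse x)" if "U x" for x using that by (auto simp: U_def)
  have U_pow: "U (x ^ n)" if "U x" for x n
    by (induction n) (use that r(1) U_mult in \<open>auto simp: U_def[of 1]\<close>)
  have U_dvd: "U x \<and> U y" if "U (x * y)" "x \<in> V" "y \<in> V" for x y
  proof -
    have nz: "x \<noteq> 0" "y \<noteq> 0" and inv: "inverse (x * y) \<in> V" using that by (auto simp: U_def)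
    have i: "y * inverse (x * y) = inverse x" "x * inverse (x * y) = inverse y"
      using nz by (simp_all add: field_simps)
    show ?thesis
      using that(2,3) nz r(4)[OF that(3) inv, unfolded i(1)] r(4)[OF that(2) inv, unfolded i(2)]
      by (simp add: U_def)
  qed
  have U_powi: "U (x powi k)" if "U x" for x k
    using U_pow[OF that] U_pow[OF U_inv[OF that]] by (auto simp: power_int_def)
  have ntU: "\<not> U ?t" using ninv by (auto simp: U_def)
  have pos_k: "k \<ge> 0" if "?t powi k \<in> V" for k
  proof (rule ccontr)
    assume "\<not> ?thesis"
    then obtain n where n: "k = - int (Suc n)" by (metis int_cases not_le of_nat_0_le_iff linorder_not_le nonneg_int_cases neg_int_cases Suc_pred')
    then have "?t ^ n * ?t powi k = inverse ?t" using t0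
      by (simp add: power_int_minus field_simps del: of_nat_Suc)
    then show False using r(4)[OF subrng_pow[OF V natV] that, of l n] ninv by metis
  qed
  have k0: "k = 0" if "U (?t powi k)" for k
    using that pos_k[of k] pos_k[of "- k"] by (auto simp: U_def power_int_minus)
  have intU: "U (of_int c)" if c: "coprime c (int l)" for c
  proof -
    obtain u w where "u * c + w * int l = 1"
      using bezout_int[of c "int l"] c by auto
    then have "(of_int u * of_int c :: complex) = 1 - ?t * of_int w"
      by (metis (no_types, opaque_lifting) add_diff_cancel_right' mult.commute of_int_add of_int_mult of_int_of_nat_eq of_int_1)
    moreover have "1 - ?t * of_int w \<noteq> 0" using ninv intV inverse_unique[of ?t "of_int w"] by auto
    ultimately have "U (of_int u * of_int c)" using unit[OF intV, of w] r(4)[OF intV intV, of u c] unfolding U_def by metis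
    then show ?thesis using U_dvd intV by blast
  qed
  have int_dec: "\<exists>a. U (of_int c / ?t powi a)" if c: "c \<noteq> 0" for c
  proof -
    obtain y where y: "c = int l ^ multiplicity (int l) c * y" "\<not> int l dvd y"
      using multiplicity_decompose'[of c "int l"] c l1 by (auto simp: zdvd1_eq)
    have "coprime y (int l)" using y(2) l
      by (metis coprime_commute prime_imp_coprime prime_nat_int_transfer)
    then have "U (of_int y)" by (rule intU)
    moreover have "of_int c / ?t powi int (multiplicity (int l) c) = of_int y"
      using t0 by (subst y(1)) simp
    ultimately show ?thesis by metis
  qed
  \<comment> \<open>Among finitely many nonzero terms one has the largest value.\<close>
  have maxT: "\<exists>i\<in>S. \<forall>j\<in>S. T j / T i \<in> V"
    if "finite S" "S \<noteq> {}" "\<And>i. i \<in> S \<Longrightarrow> T i \<noteq> 0" for S :: "nat set" and T :: "nat \<Rightarrow> complex"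
    using that
  proof (induction S rule: finite_ne_induct)
    case (singleton x)
    then show ?case using r(1) by simp
  next
    case (insert x F)
    then obtain i where i: "i \<in> F" "\<And>j. j \<in> F \<Longrightarrow> T j / T i \<in> V" by auto
    have nz: "T i \<noteq> 0" "T x \<noteq> 0" using insert.prems i by auto
    show ?case
    proof (cases "T x / T i \<in> V")
      case True
      then show ?thesis using i by auto
    next
      case False
      then have *: "T i / T x \<in> V" using val[of "T x / T i"] by simp
      have "T j / T x \<in> V" if "j \<in> F" for j
      proof -
        have e: "T j / T x = (T j / T i) * (T i / T x)" using nz by simp
        show ?thesis unfolding e by (rule r(4)[OF i(2)[OF that] *])
      qed
      then show ?thesis using nz r(1) by (intro bexI[of _ x]) auto
    qed
  qed
  \<comment> \<open>The maximal ideal of \<open>V\<close>.\<close>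
  define M where "M y \<longleftrightarrow> y \<in> V \<and> \<not> U y" for y
  have M_add: "M (x + y)" if "M x" "M y" for x y
  proof -
    have aux: "M (x + y)" if *: "M x" "M y" "x / y \<in> V" "y \<noteq> 0" for x y
    proof -
      have "x + y = (x / y + 1) * y" using *(4) by (simp add: field_simps)
      moreover have "x / y + 1 \<in> V" using * r(1,6) by blast
      ultimately show ?thesis using * U_dvd[of "x / y + 1" y] r(4) by (auto simp: M_def)
    qed
    show ?thesis
    proof (cases "x = 0 \<or> y = 0")
      case True
      then show ?thesis using that by auto
    next
      case False
      then show ?thesis
        using aux[of x y] aux[of y x] that val[of "x / y"] by (auto simp: add.commute)
    qed
  qed
  have M_sum: "M (sum f S)" if "finite S" "\<And>i. i \<in> S \<Longrightarrow> M (f i)" for f and S :: "nat set"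
    using that
  proof (induction S rule: finite_induct)
    case empty
    then show ?case using r(2) by (simp add: M_def U_def)
  next
    case (insert x F)
    then show ?case using M_add[of "f x" "sum f F"] by simp
  qed
  define R where "R x b k \<longleftrightarrow> U (x ^ b / ?t powi k)" for x b k
  have R_ex: "\<exists>b>0. \<exists>k. R x b k" if x: "algebraic x" "x \<noteq> 0" for x
  proof -
    obtain q where q: "\<And>i. coeff q i \<in> \<int>" "q \<noteq> 0" "poly q x = 0"
      using x by (auto simp: algebraic_def)
    define S where "S = {i. i \<le> degree q \<and> coeff q i \<noteq> 0}"
    define T where "T i = coeff q i * x ^ i" for i
    have S: "finite S" by (simp add: S_def)
    have T0: "T i \<noteq> 0" if "i \<in> S" for i using that \<open>x \<noteq> 0\<close> by (auto simp: S_def T_def)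
    have "0 = (\<Sum>i\<le>degree q. T i)" using q(3) by (simp add: poly_altdef T_def)
    also have "\<dots> = sum T S" by (intro sum.mono_neutral_right) (auto simp: S_def T_def)
    finally have sum0: "sum T S = 0" by simp
    have "degree q \<in> S" using q(2) by (simp add: S_def)
    then obtain i where i: "i \<in> S" "\<And>j. j \<in> S \<Longrightarrow> T j / T i \<in> V"
      using maxT[OF S] T0 by (metis empty_iff)
    have "(\<Sum>j\<in>S. T j / T i) = 0" using sum0 by (simp flip: sum_divide_distrib)
    then have "1 + (\<Sum>j\<in>S - {i}. T j / T i) = 0"
      using S i T0[OF i(1)] by (simp add: sum.remove[of S i])
    then have e: "(\<Sum>j\<in>S - {i}. T j / T i) = - 1" by (simp add: add_eq_0_iff)
    have "\<not> M (- 1)" using r(1,5) by (auto simp: M_def U_def)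
    \<comment> \<open>If all other quotients were in the maximal ideal, so would be -1. Hence two
      different terms of the equation have equal value, and comparing them determines the value of a
      power of x.\<close>
    then have "\<exists>j\<in>S - {i}. \<not> M (T j / T i)"
      using M_sum[of "S - {i}" "\<lambda>j. T j / T i"] S e by auto
    then obtain j where j: "j \<in> S" "j \<noteq> i" "U (T j / T i)" using i by (auto simp: M_def)
    obtain ci cj :: int where c: "coeff q i = of_int ci" "coeff q j = of_int cj"
      using Ints_cases[OF q(1)] by metis
    have "ci \<noteq> 0" "cj \<noteq> 0" using i(1) j(1) c by (auto simp: S_def)
    then obtain a a' where a: "U (of_int ci / ?t powi a)" "U (of_int cj / ?t powi a')"
      using int_dec by meson
    have main: "\<exists>b>0. \<exists>k. R x b k"
      if *: "U (of_int c * x ^ i / (of_int c' * x ^ j))" "i > j" "U (of_int c / ?t powi a)" "U (of_int c' / ?t powi a')"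
        "c \<noteq> 0" "c' \<noteq> 0" for c c' i j a a'
    proof -
      have "x ^ i = x ^ j * x ^ (i - j)" using *(2) by (simp flip: power_add)
      then have "x ^ (i - j) / ?t powi (a' - a)
        = (of_int c * x ^ i / (of_int c' * x ^ j)) * (of_int c' / ?t powi a') * inverse (of_int c / ?t powi a)"
        using that t0 \<open>x \<noteq> 0\<close> by (simp add: power_int_diff field_simps)
      then have "R x (i - j) (a' - a)"
        unfolding R_def using that U_mult U_inv by metis
      then show ?thesis using *(2) by (intro exI[of _ "i - j"]) auto
    qed
    show ?thesis
    proof (cases "i < j")
      case True
      then show ?thesis using main[OF j(3)[unfolded T_def c] True a(2,1)] \<open>ci \<noteq> 0\<close> \<open>cj \<noteq> 0\<close> by blast
    next
      case False
      have "U (T i / T j)" using U_inv[OF j(3)] by simp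
      from main[OF this[unfolded T_def c] _ a] False j(2) \<open>ci \<noteq> 0\<close> \<open>cj \<noteq> 0\<close> show ?thesis by simp
    qed
  qed
  have R_mult: "R (x * y) (b * c) (k * int c + m * int b)" if "R x b k" "R y c m" for x y b c k m
  proof -
    have "?t powi (k * int c + m * int b) = (?t powi k) ^ c * (?t powi m) ^ b"
      using t0 by (simp add: power_int_add power_int_mult)
    moreover have "(x * y) ^ (b * c) = (x ^ b) ^ c * (y ^ c) ^ b"
      by (simp add: power_mult_distrib mult.commute[of c b] flip: power_mult)
    ultimately have "(x * y) ^ (b * c) / ?t powi (k * int c + m * int b) = (x ^ b / ?t powi k) ^ c * (y ^ c / ?t powi m) ^ b"
      by (simp add: power_divide)
    then show ?thesis using that U_mult U_pow by (simp add: R_def)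
  qed
  have R_uniq: "k * int c = m * int b" if "R x b k" "R x c m" for x b c k m
  proof -
    have "x ^ (b * c) / ?t powi (k * int c) = (x ^ b / ?t powi k) ^ c"
      by (simp add: power_divide power_int_mult power_mult)
    then have 1: "U (x ^ (b * c) / ?t powi (k * int c))" using that U_pow by (simp add: R_def)
    have "x ^ (b * c) / ?t powi (m * int b) = (x ^ c / ?t powi m) ^ b"
      by (simp add: power_divide power_int_mult mult.commute[of b c] power_mult)
    then have 2: "U (x ^ (b * c) / ?t powi (m * int b))" using that U_pow by (simp add: R_def)
    have "x ^ (b * c) \<noteq> 0" using 1 by (auto simp: U_def)
    then have "?t powi (k * int c - m * int b) = (x ^ (b * c) / ?t powi (m * int b)) * inverse (x ^ (b * c) / ?t powi (k * int c))"
      using t0 by (simp add: power_int_diff field_simps)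
    then show ?thesis using k0[of "k * int c - m * int b"] U_mult[OF 2 U_inv[OF 1]] by simp
  qed
  \<comment> \<open>The choice is arbitrary; by \<open>R_uniq\<close> the quotient k / b does not
    depend on it.\<close>
  define W where "W x = (SOME (b, k). b > 0 \<and> R x b k)" for x
  define N where "N x = (if x = 0 \<or> \<not> algebraic x then 0 else real l powr (case W x of (b, k) \<Rightarrow> - (k / b)))" for x
  have N_R: "N x = real l powr (- (k / b))" if "algebraic x" "x \<noteq> 0" "b > 0" "R x b k" for x b k
  proof -
    obtain b' k' where W: "W x = (b', k')" by force
    have "case W x of (b, k) \<Rightarrow> b > 0 \<and> R x b k"
      unfolding W_def by (rule someI_ex) (use that in auto)
    then have *: "b' > 0" "R x b' k'" using W by auto
    have "k * int b' = k' * int b" using R_uniq[OF that(4) *(2)] .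
    then have "real_of_int k * real b' = real_of_int k' * real b"
      by (metis of_int_mult of_int_of_nat_eq)
    then have "k' / b' = k / b" using * that by (simp add: field_simps)
    then show ?thesis using that W by (simp add: N_def)
  qed
  have N_pos: "N x > 0" if "algebraic x" "x \<noteq> 0" for x using that l0 by (simp add: N_def)
  have N_mult: "N (x * y) = N x * N y" if xy: "algebraic x" "algebraic y" for x y
  proof (cases "x = 0 \<or> y = 0")
    case True
    then show ?thesis by (auto simp: N_def)
  next
    case False
    obtain b k where b: "b > 0" "R x b k" using R_ex xy False by blast
    obtain c m where c: "c > 0" "R y c m" using R_ex xy False by blast
    have "N (x * y) = real l powr (- ((k * int c + m * int b) / (b * c)))"
      using N_R[OF _ _ _ R_mult[OF b(2) c(2)]] algebraic_mult[OF xy] False b c by simp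
    also have "- ((k * int c + m * int b) / (b * c)) = - (k / b) + - (m / c)"
      using b(1) c(1) by (simp add: field_simps)
    also have "real l powr \<dots> = real l powr (- (k / b)) * real l powr (- (m / c))"
      by (rule powr_add)
    finally show ?thesis using N_R[OF xy(1) _ b] N_R[OF xy(2) _ c] False by simp
  qed
  have N_le1: "N x \<le> 1 \<longleftrightarrow> x \<in> V" if x: "algebraic x" for x
  proof (cases "x = 0")
    case False
    obtain b k where b: "b > 0" "R x b k" using R_ex x False by blast
    have u: "U (x ^ b / ?t powi k)" using b by (simp add: R_def)
    have "N x \<le> 1 \<longleftrightarrow> k \<ge> 0"
      using N_R[OF x False b] powr_le_cancel_iff[of "real l" "- (k / b)" 0] l1 b(1)
      by (simp add: zero_le_divide_iff)
    also have "k \<ge> 0 \<longleftrightarrow> x \<in> V"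
    proof
      assume "k \<ge> 0"
      then have "?t powi k \<in> V" using natV by (simp add: power_int_def subrng_pow V)
      moreover have "x ^ b = (x ^ b / ?t powi k) * ?t powi k" using t0 by simp
      ultimately have xb: "x ^ b \<in> V" using u r(4) unfolding U_def by metis
      show "x \<in> V"
      proof (rule ccontr)
        assume "x \<notin> V"
        then have "inverse x ^ (b - 1) \<in> V" using val subrng_pow[OF V] by blast
        moreover have "x = x ^ b * inverse x ^ (b - 1)"
          using False b(1) by (cases b) (auto simp: power_inverse)
        ultimately show False using r(4)[OF xb, of "inverse x ^ (b - 1)"] \<open>x \<notin> V\<close> by simp
      qed
    next
      assume "x \<in> V"
      then have "x ^ b \<in> V" by (rule subrng_pow[OF V])
      moreover have "?t powi k = x ^ b * inverse (x ^ b / ?t powi k)" using False t0 by simp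
      ultimately show "k \<ge> 0" using pos_k u r(4) unfolding U_def by metis
    qed
    finally show ?thesis .
  qed (use r(2) in \<open>auto simp: N_def\<close>)
  have N1: "N 1 = 1"
    using N_mult[of 1 1] N_pos[of 1] algebraic_of_int[of 1] by simp
  \<comment> \<open>Division by the larger element reduces the ultrametric inequality to the closure
    of \<open>V\<close>, the unit ball, under adding 1.\<close>
  have aux: "N (x + y) \<le> N y" if "algebraic x" "algebraic y" "N x \<le> N y" "y \<noteq> 0" for x y
  proof -
    have ai: "algebraic (inverse y)" using that by auto
    have 1: "N y * N (inverse y) = 1" using N_mult[OF that(2) ai] that(4) N1 by simp
    have "N (x * inverse y) = N x * N (inverse y)" using N_mult[OF that(1) ai] .
    also have "\<dots> \<le> N y * N (inverse y)" using that(3,4) N_pos[OF ai] by (intro mult_right_mono) auto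
    finally have "x * inverse y \<in> V" using 1 N_le1[OF algebraic_mult[OF that(1) ai]] by simp
    then have v: "x * inverse y + 1 \<in> V" using r(1,6) by blast
    have a1: "algebraic (x * inverse y + 1)"
      using algebraic_mult[OF that(1) ai] algebraic_of_int[of 1] by (intro algebraic_plus) auto
    have "N (x * inverse y + 1) \<le> 1" using v N_le1[OF a1] by simp
    moreover have "x + y = (x * inverse y + 1) * y" using that(4) by (simp add: field_simps)
    ultimately show ?thesis using N_mult[OF a1 that(2)] N_pos[OF that(2,4)]
      by (simp add: mult_le_cancel_right1)
  qed
  have N_add: "N (x + y) \<le> max (N x) (N y)" if "algebraic x" "algebraic y" for x y
  proof (cases "x = 0 \<or> y = 0")
    case False
    then show ?thesis using aux[of x y] aux[of y x] that by (auto simp: add.commute max_def)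
  qed auto
  have alg_t: "algebraic ?t" using algebraic_of_int[of "int l"] by simp
  have "R ?t 1 1" using r(1) t0 by (auto simp: R_def U_def)
  then have Nt: "N ?t = inverse (real l)"
    using N_R[OF alg_t t0, of 1 1] l0 by (simp add: powr_minus)
  have "\<exists>b>0. \<exists>k. N x ^ b = real l powi k" if x: "algebraic x" "x \<noteq> 0" for x
  proof -
    obtain b k where b: "b > 0" "R x b k" using R_ex x by blast
    have "N x ^ b = real l powr (- k)"
      using N_R[OF x b] b(1) l0 by (simp flip: powr_realpow add: powr_powr)
    then have "N x ^ b = real l powi (- k)" using l0 by (simp add: powr_real_of_int' flip: of_int_minus)
    then show ?thesis using b(1) by blast
  qed
  moreover have "N x \<le> 1" if "algebraic_int x" for x
    using N_le1 algebraic_int_in_valuation_ring[OF V val that] that by blast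
  moreover have "N 0 = 0" by (simp add: N_def)
  ultimately show ?thesis using that[of N] N_pos N_mult N_add Nt by blast
qed

section \<open>Fields of algebraic numbers and their homomorphisms\<close>

text \<open>Closure under inverses is not demanded: a ring of algebraic numbers containing the
  rationals is a field, by \<open>alg_field_inverse\<close>.\<close>

definition alg_field :: "complex set \<Rightarrow> bool"
  where "alg_field E \<longleftrightarrow> subrng E \<and> \<rat> \<subseteq> E \<and> (\<forall>x\<in>E. algebraic x)"

lemma alg_fieldD:
  assumes "alg_field E"
  shows alg_field_subrng: "subrng E"
    and alg_field_Rats: "x \<in> \<rat> \<Longrightarrow> x \<in> E"
    and alg_field_algebraic: "x \<in> E \<Longrightarrow> algebraic x"
    and alg_field_1: "1 \<in> E" and alg_field_0: "0 \<in> E"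
    and alg_field_add: "x \<in> E \<Longrightarrow> y \<in> E \<Longrightarrow> x + y \<in> E"
    and alg_field_diff: "x \<in> E \<Longrightarrow> y \<in> E \<Longrightarrow> x - y \<in> E"
    and alg_field_mult: "x \<in> E \<Longrightarrow> y \<in> E \<Longrightarrow> x * y \<in> E"
    and alg_field_uminus: "x \<in> E \<Longrightarrow> - x \<in> E"
    and alg_field_pow: "x \<in> E \<Longrightarrow> x ^ n \<in> E"
    and alg_field_sum: "(\<And>i. i \<in> A \<Longrightarrow> f i \<in> E) \<Longrightarrow> sum f A \<in> E"
    and alg_field_of_int: "of_int k \<in> E"
    and alg_field_of_nat: "of_nat n \<in> E"
proof -
  show s: "subrng E" using assms by (simp add: alg_field_def)
  show "x \<in> \<rat> \<Longrightarrow> x \<in> E" "x \<in> E \<Longrightarrow> algebraic x" using assms by (auto simp: alg_field_def)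
  show "1 \<in> E" "0 \<in> E" "x \<in> E \<Longrightarrow> y \<in> E \<Longrightarrow> x + y \<in> E"
    "x \<in> E \<Longrightarrow> y \<in> E \<Longrightarrow> x - y \<in> E" "x \<in> E \<Longrightarrow> y \<in> E \<Longrightarrow> x * y \<in> E" "x \<in> E \<Longrightarrow> - x \<in> E"
    by (fact subrngD[OF s])+
  show "x \<in> E \<Longrightarrow> x ^ n \<in> E" by (rule subrng_pow[OF s])
  show "(\<And>i. i \<in> A \<Longrightarrow> f i \<in> E) \<Longrightarrow> sum f A \<in> E" by (rule subrng_sum[OF s])
  show "of_int k \<in> E" "of_nat n \<in> E" using subrng_of_int[OF s, of k] subrng_of_int[OF s, of "int n"] by simp_all
qed

lemma alg_field_prod:
  assumes "alg_field E" shows "(\<And>i. i \<in> A \<Longrightarrow> f i \<in> E) \<Longrightarrow> prod f A \<in> E"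
  by (induction A rule: infinite_finite_induct) (auto intro: alg_field_1 alg_field_mult assms)

text \<open>After cancelling powers of x, an integer equation for x has constant term a distinct
  from 0 and reads a = - x q(x), so that 1/x = - q(x)/a.\<close>

lemma alg_field_inverse:
  assumes E: "alg_field E" and x: "x \<in> E"
  shows "inverse x \<in> E"
proof (cases "x = 0")
  case False
  have main: "inverse x \<in> E" if "q \<noteq> 0" "\<forall>i. coeff q i \<in> \<int>" "poly q x = 0" for q
    using that
  proof (induction q)
    case (pCons a q)
    have c: "\<forall>i. coeff q i \<in> \<int>" "a \<in> \<int>"
      using pCons.prems(2) by (metis coeff_pCons_Suc, metis coeff_pCons_0)
    show ?case
    proof (cases "a = 0")
      case True
      then have "q \<noteq> 0" "poly q x = 0" using pCons.prems False by auto
      then show ?thesis using pCons.IH c by blast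
    next
      case a: False
      have "a = - (x * poly q x)" using pCons.prems(3) by (simp add: add_eq_0_iff2)
      then have "inverse x = - poly q x * inverse a" using False a by (auto simp: field_simps)
      moreover have "inverse a \<in> E" using E c by (intro alg_field_Rats[OF E]) (auto elim!: Ints_cases)
      moreover have "poly q x \<in> E"
        using c(1) x Ints_subset_Rats alg_field_Rats[OF E] by (intro subrng_poly alg_field_subrng[OF E]) auto
      ultimately show ?thesis using alg_field_mult[OF E] alg_field_uminus[OF E] by metis
    qed
  qed simp
  obtain q where "\<forall>i. coeff q i \<in> \<int>" "q \<noteq> 0" "poly q x = 0"
    using alg_field_algebraic[OF E x] by (auto simp: algebraic_def)
  then show ?thesis using main by blast
qed (use alg_field_0[OF E] in simp)

lemma alg_field_divide: "alg_field E \<Longrightarrow> x \<in> E \<Longrightarrow> y \<in> E \<Longrightarrow> x / y \<in> E"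
  by (simp add: divide_inverse alg_field_mult alg_field_inverse)

section \<open>Generated fields and homomorphisms\<close>

text \<open>The generated subring suffices: for a base field of algebraic numbers and algebraic
  generators it is already the generated field (\<open>alg_field_gen\<close>).\<close>

definition gen :: "complex set \<Rightarrow> complex set \<Rightarrow> complex set"
  where "gen F S = \<Inter>{A. subrng A \<and> F \<subseteq> A \<and> S \<subseteq> A}"

lemma gen_base: "F \<subseteq> gen F S" and gen_mem: "S \<subseteq> gen F S"
  and gen_minimal: "subrng A \<Longrightarrow> F \<subseteq> A \<Longrightarrow> S \<subseteq> A \<Longrightarrow> gen F S \<subseteq> A"
  by (auto simp: gen_def)

lemma subrng_gen: "subrng (gen F S)"
  by (auto simp: gen_def subrng_def)

lemma alg_field_gen:
  assumes "alg_field F" "\<And>s. s \<in> S \<Longrightarrow> algebraic s"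
  shows "alg_field (gen F S)"
proof -
  have "subrng {x::complex. algebraic x}"
    using algebraic_of_int[of 1] by (auto simp: subrng_def algebraic_diff algebraic_mult)
  then have "gen F S \<subseteq> {x. algebraic x}"
    using assms alg_field_algebraic by (intro gen_minimal) auto
  then show ?thesis
    using gen_base[of F S] assms(1) subrng_gen by (auto simp: alg_field_def)
qed

lemma alg_field_Rats_self: "alg_field \<rat>"
  by (auto simp: alg_field_def subrng_def algebraic_Rats)

lemma gen_insert: "gen F (insert s S) = gen (gen F S) {s}"
proof
  show "gen F (insert s S) \<subseteq> gen (gen F S) {s}"
    using gen_base[of F S] gen_mem[of S F] gen_base[of "gen F S" "{s}"] gen_mem[of "{s}" "gen F S"]
    by (intro gen_minimal subrng_gen) auto
  show "gen (gen F S) {s} \<subseteq> gen F (insert s S)"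
    using gen_base[of F "insert s S"] gen_mem[of "insert s S" F]
    by (intro gen_minimal subrng_gen) auto
qed

lemma gen_ring_adjoin:
  assumes "subrng F" shows "gen F {x} = ring_adjoin F x"
proof
  show "gen F {x} \<subseteq> ring_adjoin F x"
    using subrng_ring_adjoin[OF assms] by (intro gen_minimal) auto
  show "ring_adjoin F x \<subseteq> gen F {x}"
  proof
    fix y assume "y \<in> ring_adjoin F x"
    then obtain q where q: "y = poly q x" "\<And>i. coeff q i \<in> F" by (auto simp: ring_adjoin_def)
    show "y \<in> gen F {x}"
      unfolding q(1) using q(2) gen_base[of F "{x}"] gen_mem[of "{x}" F]
      by (intro subrng_poly subrng_gen) auto
  qed
qed

text \<open>Values outside \<open>E\<close> are unconstrained, so one function also serves as a
  homomorphism of every subfield; only automorphisms are made extensional.\<close>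

definition fhom :: "complex set \<Rightarrow> (complex \<Rightarrow> complex) \<Rightarrow> bool"
  where "fhom E g \<longleftrightarrow> g 1 = 1 \<and> (\<forall>x\<in>E. \<forall>y\<in>E. g (x - y) = g x - g y \<and> g (x * y) = g x * g y)"

lemma
  assumes E: "alg_field E" and g: "fhom E g"
  shows fhom_1: "g 1 = 1"
    and fhom_diff: "x \<in> E \<Longrightarrow> y \<in> E \<Longrightarrow> g (x - y) = g x - g y"
    and fhom_mult: "x \<in> E \<Longrightarrow> y \<in> E \<Longrightarrow> g (x * y) = g x * g y"
    and fhom_0: "g 0 = 0"
    and fhom_uminus: "x \<in> E \<Longrightarrow> g (- x) = - g x"
    and fhom_add: "x \<in> E \<Longrightarrow> y \<in> E \<Longrightarrow> g (x + y) = g x + g y"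
    and fhom_pow: "x \<in> E \<Longrightarrow> g (x ^ n) = g x ^ n"
    and fhom_inverse: "x \<in> E \<Longrightarrow> g (inverse x) = inverse (g x)"
    and fhom_divide: "x \<in> E \<Longrightarrow> y \<in> E \<Longrightarrow> g (x / y) = g x / g y"
    and fhom_eq_0: "x \<in> E \<Longrightarrow> g x = 0 \<longleftrightarrow> x = 0"
    and fhom_Rats: "x \<in> \<rat> \<Longrightarrow> g x = x"
    and fhom_inj_on: "inj_on g E"
proof -
  note e = alg_field_1[OF E] alg_field_0[OF E] alg_field_uminus[OF E] alg_field_mult[OF E]
  show 1: "g 1 = 1" and d: "\<And>x y. x \<in> E \<Longrightarrow> y \<in> E \<Longrightarrow> g (x - y) = g x - g y"
    and m: "\<And>x y. x \<in> E \<Longrightarrow> y \<in> E \<Longrightarrow> g (x * y) = g x * g y"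
    using g by (auto simp: fhom_def)
  show z: "g 0 = 0" using d[OF e(1,1)] by simp
  show u: "\<And>x. x \<in> E \<Longrightarrow> g (- x) = - g x" using d[OF e(2)] z by simp
  show a: "\<And>x y. x \<in> E \<Longrightarrow> y \<in> E \<Longrightarrow> g (x + y) = g x + g y"
    using d[OF _ e(3)] u by simp
  show "\<And>x n. x \<in> E \<Longrightarrow> g (x ^ n) = g x ^ n"
  proof -
    fix x n assume "x \<in> E" then show "g (x ^ n) = g x ^ n"
      by (induction n) (auto simp: 1 m alg_field_pow[OF E])
  qed
  show i: "\<And>x. x \<in> E \<Longrightarrow> g (inverse x) = inverse (g x)"
  proof -
    fix x assume x: "x \<in> E"
    show "g (inverse x) = inverse (g x)"
    proof (cases "x = 0")
      case False
      then have "g x * g (inverse x) = 1"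
        using m[OF x alg_field_inverse[OF E x]] 1 by simp
      then show ?thesis using inverse_unique by metis
    qed (simp add: z)
  qed
  show "x \<in> E \<Longrightarrow> y \<in> E \<Longrightarrow> g (x / y) = g x / g y"
    by (simp add: divide_inverse m i alg_field_inverse[OF E])
  show z': "\<And>x. x \<in> E \<Longrightarrow> g x = 0 \<longleftrightarrow> x = 0"
  proof
    fix x assume x: "x \<in> E" "g x = 0"
    then show "x = 0" using m[OF x(1) alg_field_inverse[OF E x(1)]] 1 by (cases "x = 0") auto
  qed (simp add: z)
  show "inj_on g E"
  proof (rule inj_onI)
    fix x y assume "x \<in> E" "y \<in> E" "g x = g y"
    then show "x = y" using z'[of "x - y"] d[of x y] alg_field_diff[OF E] by simp
  qed
  have nat: "g (of_nat n) = of_nat n" for n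
    by (induction n) (auto simp: z 1 a e alg_field_of_nat[OF E])
  have int: "g (of_int n) = of_int n" for n
    by (cases n rule: int_cases2) (auto simp: nat u alg_field_of_nat[OF E])
  show "x \<in> \<rat> \<Longrightarrow> g x = x"
  proof -
    assume x: "x \<in> \<rat>"
    then obtain b c :: int where b: "b > 0" "x = of_int c / of_int b" by (elim Rats_cases') auto
    have "of_int c = x * of_int b" using b by simp
    then have "x * of_int b = g x * of_int b"
      using m[OF alg_field_Rats[OF E x] alg_field_of_int[OF E, of b]] int by metis
    then show ?thesis using b(1) by simp
  qed
qed

lemma fhom_sum:
  assumes "alg_field E" "fhom E g" "\<And>i. i \<in> A \<Longrightarrow> f i \<in> E"
  shows "g (sum f A) = (\<Sum>i\<in>A. g (f i))"
  using assms(3)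
  by (induction A rule: infinite_finite_induct)
    (auto simp: fhom_0[OF assms(1,2)] fhom_add[OF assms(1,2)] alg_field_sum[OF assms(1)])

lemma fhom_prod:
  assumes "alg_field E" "fhom E g" "\<And>i. i \<in> A \<Longrightarrow> f i \<in> E"
  shows "g (prod f A) = (\<Prod>i\<in>A. g (f i))"
  using assms(3)
  by (induction A rule: infinite_finite_induct)
    (auto simp: fhom_1[OF assms(1,2)] fhom_mult[OF assms(1,2)] alg_field_prod[OF assms(1)])

lemma fhom_poly:
  assumes "alg_field E" "fhom E g" "\<And>i. coeff q i \<in> E" "x \<in> E"
  shows "g (poly q x) = poly (map_poly g q) (g x)"
proof -
  have 0: "g 0 = 0" by (rule fhom_0[OF assms(1,2)])
  have "g (poly q x) = (\<Sum>i\<le>degree q. g (coeff q i) * g x ^ i)"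
    unfolding poly_altdef using assms
    by (subst fhom_sum[OF assms(1,2)]) (auto intro!: sum.cong simp: alg_field_mult alg_field_pow fhom_mult[OF assms(1,2)] fhom_pow[OF assms(1,2)])
  also have "\<dots> = poly (map_poly g q) (g x)"
  proof -
    have "g (coeff q i) = 0" if "i > degree (map_poly g q)" for i
      using coeff_eq_0[OF that] by (simp add: coeff_map_poly 0)
    then show ?thesis
      unfolding poly_altdef using map_poly_degree_leq[of g q]
      by (intro sum.mono_neutral_cong_right) (auto simp: coeff_map_poly 0)
  qed
  finally show ?thesis .
qed

lemma fhom_poly_Rats:
  assumes "alg_field E" "fhom E g" "\<And>i. coeff q i \<in> \<rat>" "x \<in> E"
  shows "g (poly q x) = poly q (g x)"
proof -
  have "map_poly g q = q"
    by (intro poly_eqI) (simp add: coeff_map_poly fhom_0[OF assms(1,2)] fhom_Rats[OF assms(1,2) assms(3)])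
  then show ?thesis using fhom_poly[OF assms(1,2) _ assms(4), of q] alg_field_Rats[OF assms(1) assms(3)] by simp
qed

lemma fhom_algebraic_int:
  assumes "alg_field E" "fhom E g" "x \<in> E" "algebraic_int x"
  shows "algebraic_int (g x)"
proof -
  obtain q where q: "lead_coeff q = 1" "\<forall>i. coeff q i \<in> \<int>" "poly q x = 0"
    using assms(4) by (auto simp: algebraic_int.simps)
  moreover from q(2) have "coeff q i \<in> \<rat>" for i using Ints_subset_Rats by auto
  ultimately have "poly q (g x) = g 0"
    using fhom_poly_Rats[OF assms(1,2) _ assms(3), of q] by simp
  then show ?thesis using q fhom_0[OF assms(1,2)] by (auto simp: algebraic_int.simps)
qed

lemma fhom_mono: "fhom E g \<Longrightarrow> F \<subseteq> E \<Longrightarrow> fhom F g"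
  by (auto simp: fhom_def)

lemma fhom_cong: "alg_field E \<Longrightarrow> fhom E g \<Longrightarrow> (\<And>x. x \<in> E \<Longrightarrow> h x = g x) \<Longrightarrow> fhom E h"
  by (auto simp: fhom_def alg_field_1 alg_field_diff alg_field_mult)

lemma fhom_comp:
  "alg_field E \<Longrightarrow> fhom E g \<Longrightarrow> fhom F h \<Longrightarrow> g ` E \<subseteq> F \<Longrightarrow> fhom E (\<lambda>x. h (g x))"
  by (auto simp: fhom_def image_subset_iff)

lemma fhom_eq_on_gen:
  assumes E: "alg_field (gen F S)" and "fhom (gen F S) g" "fhom (gen F S) h"
    and "\<And>x. x \<in> F \<Longrightarrow> g x = h x" "\<And>x. x \<in> S \<Longrightarrow> g x = h x" "x \<in> gen F S"
  shows "g x = h x"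
proof -
  have "subrng {x \<in> gen F S. g x = h x}"
    using assms(2,3) alg_field_1[OF E] alg_field_diff[OF E] alg_field_mult[OF E]
    by (auto simp: subrng_def fhom_def)
  then have "gen F S \<subseteq> {x \<in> gen F S. g x = h x}"
    using assms gen_base[of F S] gen_mem[of S F] by (intro gen_minimal) auto
  then show ?thesis using assms by auto
qed

lemma fhom_image_gen:
  assumes E: "alg_field (gen F S)" and "fhom (gen F S) g" "subrng A"
    and "\<And>x. x \<in> F \<Longrightarrow> g x \<in> A" "\<And>x. x \<in> S \<Longrightarrow> g x \<in> A" "x \<in> gen F S"
  shows "g x \<in> A"
proof -
  have "subrng {x \<in> gen F S. g x \<in> A}"
    using assms(2,3) alg_field_1[OF E] alg_field_diff[OF E] alg_field_mult[OF E]
    by (auto simp: subrng_def fhom_def)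
  then have "gen F S \<subseteq> {x \<in> gen F S. g x \<in> A}"
    using assms gen_base[of F S] gen_mem[of S F] by (intro gen_minimal) auto
  then show ?thesis using assms by auto
qed

section \<open>Minimal polynomials and extension of homomorphisms\<close>

definition minpoly_over :: "complex set \<Rightarrow> complex \<Rightarrow> complex poly \<Rightarrow> bool"
  where "minpoly_over F x m \<longleftrightarrow> (\<forall>i. coeff m i \<in> F) \<and> lead_coeff m = 1 \<and> poly m x = 0 \<and>
    (\<forall>q. (\<forall>i. coeff q i \<in> F) \<longrightarrow> q \<noteq> 0 \<longrightarrow> poly q x = 0 \<longrightarrow> degree m \<le> degree q)"

lemma minpoly_over_exists:
  assumes F: "alg_field F" and x: "algebraic x"
  obtains m where "minpoly_over F x m"
proof -
  let ?P = "\<lambda>q. (\<forall>i. coeff q i \<in> F) \<and> q \<noteq> 0 \<and> poly q x = 0"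
  obtain q0 where "\<forall>i. coeff q0 i \<in> \<int>" "q0 \<noteq> 0" "poly q0 x = 0"
    using x by (auto simp: algebraic_def)
  then have "?P q0" using alg_field_Rats[OF F] Ints_subset_Rats by blast
  then obtain q where q: "?P q" "\<And>q'. ?P q' \<Longrightarrow> degree q \<le> degree q'"
    using ex_has_least_nat[of ?P q0 degree] by blast
  define m where "m = smult (inverse (lead_coeff q)) q"
  have "degree m = degree q" using q(1) by (simp add: m_def)
  then have "minpoly_over F x m"
    unfolding minpoly_over_def using q
    by (auto simp: m_def intro!: alg_field_mult[OF F] alg_field_inverse[OF F])
  then show ?thesis using that by blast
qed

lemma minpoly_over_degree_pos:
  assumes "minpoly_over F x m" shows "degree m > 0"
proof (rule ccontr)
  assume "\<not> ?thesis"
  then have "degree m = 0" by simp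
  then obtain a where "m = [:a:]" by (rule degree_eq_zeroE)
  then show False using assms by (auto simp: minpoly_over_def)
qed

lemma complex_poly_root:
  fixes q :: "complex poly"
  assumes "degree q > 0" obtains y where "poly q y = 0"
  using fundamental_theorem_of_algebra[of q] assms constant_degree[of q] by auto

text \<open>Separability in characteristic 0. With m = (X - x) r, the value r(x) equals m'(x), which
  is nonzero because m' has smaller degree than m; so a root of r differs from x.\<close>

lemma minpoly_over_other_root:
  assumes F: "alg_field F" and m: "minpoly_over F x m" and x: "x \<notin> F"
  obtains y where "poly m y = 0" "y \<noteq> x"
proof -
  have "degree m \<noteq> 1"
  proof
    assume d: "degree m = 1"
    then have "poly m x = coeff m 0 + coeff m 1 * x" by (simp add: poly_altdef)
    moreover have "coeff m 1 = 1" "poly m x = 0" using m d by (simp_all add: minpoly_over_def)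
    ultimately have "x = - coeff m 0" by (simp add: add_eq_0_iff)
    then show False using m x alg_field_uminus[OF F] by (auto simp: minpoly_over_def)
  qed
  then have d: "degree m \<ge> 2" using minpoly_over_degree_pos[OF m] by simp
  obtain r where r: "m = [:- x, 1:] * r"
    using m by (auto simp: minpoly_over_def poly_eq_0_iff_dvd)
  have "r \<noteq> 0" using r d by auto
  then have "degree m = Suc (degree r)" unfolding r by (subst degree_mult_eq) auto
  then obtain y where y: "poly r y = 0" using d complex_poly_root[of r] by auto
  have "poly r x = poly (pderiv m) x" unfolding r pderiv_mult by (simp add: pderiv_pCons)
  moreover have "poly (pderiv m) x \<noteq> 0"
  proof
    assume "poly (pderiv m) x = 0"
    moreover have "pderiv m \<noteq> 0" using d by (simp add: pderiv_eq_0_iff)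
    moreover have "coeff (pderiv m) i \<in> F" for i
      using m by (auto simp: coeff_pderiv minpoly_over_def simp del: of_nat_Suc intro!: alg_field_mult[OF F] alg_field_of_nat[OF F])
    ultimately have "degree m \<le> degree (pderiv m)" using m by (auto simp: minpoly_over_def)
    then show False using d by (simp add: degree_pderiv)
  qed
  ultimately have "y \<noteq> x" using y by auto
  then show ?thesis using that y by (simp add: r)
qed

lemma map_poly_fhom:
  assumes "alg_field F" "fhom F g" "\<And>i. coeff q i \<in> F" "\<And>i. coeff r i \<in> F"
  shows "map_poly g (q - r) = map_poly g q - map_poly g r"
    and "map_poly g (q * r) = map_poly g q * map_poly g r"
proof -
  have 0: "g 0 = 0" by (rule fhom_0[OF assms(1,2)])
  show "map_poly g (q - r) = map_poly g q - map_poly g r"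
    by (intro poly_eqI) (simp add: coeff_map_poly 0 fhom_diff[OF assms(1,2)] assms)
  show "map_poly g (q * r) = map_poly g q * map_poly g r"
    by (intro poly_eqI)
      (simp add: coeff_map_poly 0 coeff_mult fhom_sum[OF assms(1,2)] fhom_mult[OF assms(1,2)] assms alg_field_mult)
qed

text \<open>Division by \<open>m\<close>, one leading term at a time, reduces to the zero
  polynomial. This is what makes evaluation at \<open>y\<close> well defined on elements written as
  polynomials in \<open>x\<close>.\<close>

lemma fhom_kernel:
  assumes F: "alg_field F" and g: "fhom F g" and m: "minpoly_over F x m"
    and y: "poly (map_poly g m) y = 0"
    and q: "\<forall>i. coeff q i \<in> F" "poly q x = 0"
  shows "poly (map_poly g q) y = 0"
  using q
proof (induction "degree q" arbitrary: q rule: less_induct)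
  case less
  show ?case
  proof (cases "q = 0")
    case False
    then have le: "degree m \<le> degree q" using m less.prems by (auto simp: minpoly_over_def)
    define a where "a = monom (lead_coeff q) (degree q - degree m)"
    have a: "coeff a i \<in> F" for i
      using less.prems(1) alg_field_0[OF F] by (simp add: a_def coeff_monom)
    have mF: "coeff m i \<in> F" for i using m by (simp add: minpoly_over_def)
    have am: "coeff (a * m) i \<in> F" for i
      unfolding coeff_mult using a mF by (intro alg_field_sum[OF F] alg_field_mult[OF F])
    have da: "degree (a * m) = degree q"
      using False le m by (subst degree_mult_eq) (auto simp: a_def degree_monom_eq minpoly_over_def)
    have la: "lead_coeff (a * m) = lead_coeff q"
      using m by (simp add: lead_coeff_mult a_def degree_monom_eq False minpoly_over_def)
    have "poly (map_poly g (q - a * m)) y = 0"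
    proof (cases "q - a * m = 0")
      case nz: False
      have "degree (q - a * m) < degree q"
      proof -
        have "degree (q - a * m) \<le> degree q" using da by (metis degree_diff_le order_refl)
        moreover have "degree (q - a * m) \<noteq> degree q"
          using la da nz by (metis coeff_diff diff_self leading_coeff_0_iff)
        ultimately show ?thesis by simp
      qed
      moreover have "\<forall>i. coeff (q - a * m) i \<in> F"
        using less.prems am alg_field_diff[OF F] by simp
      moreover have "poly (q - a * m) x = 0"
        using less.prems m by (simp add: minpoly_over_def)
      ultimately show ?thesis using less.hyps by blast
    qed simp
    then show ?thesis
      using map_poly_fhom(1)[OF F g, of q "a * m"] map_poly_fhom(2)[OF F g, of a m] a mF am less.prems(1) y
      by simp
  qed simp
qed

lemma fhom_extend_simple:
  assumes F: "alg_field F" and g: "fhom F g" and m: "minpoly_over F x m"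
    and y: "poly (map_poly g m) y = 0"
  obtains g' where "fhom (gen F {x}) g'" "\<And>z. z \<in> F \<Longrightarrow> g' z = g z" "g' x = y"
proof -
  let ?C = "\<lambda>q. \<forall>i. coeff q i \<in> F"
  define g' where "g' z = poly (map_poly g (SOME q. ?C q \<and> z = poly q x)) y" for z
  have 0: "g 0 = 0" by (rule fhom_0[OF F g])
  have g': "g' (poly q x) = poly (map_poly g q) y" if q: "?C q" for q
  proof -
    define r where "r = (SOME r. ?C r \<and> poly q x = poly r x)"
    have r: "?C r \<and> poly q x = poly r x"
      unfolding r_def by (rule someI[of _ q]) (use q in auto)
    then have "poly (map_poly g (q - r)) y = 0"
      using q alg_field_diff[OF F] by (intro fhom_kernel[OF F g m y]) auto
    moreover have "g' (poly q x) = poly (map_poly g r) y" unfolding g'_def r_def ..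
    ultimately show ?thesis
      using map_poly_fhom(1)[OF F g, of q r] q r by simp
  qed
  have 1: "g' z = g z" if "z \<in> F" for z
    using g'[of "[:z:]"] that alg_field_0[OF F] by (simp add: coeff_pCons map_poly_pCons 0 split: nat.split)
  have 2: "g' x = y"
    using g'[of "[:0, 1:]"] alg_field_0[OF F] alg_field_1[OF F] fhom_1[OF F g]
    by (simp add: coeff_pCons map_poly_pCons 0 split: nat.split)
  have "fhom (gen F {x}) g'"
    unfolding fhom_def gen_ring_adjoin[OF alg_field_subrng[OF F]]
  proof (intro conjI ballI)
    show "g' 1 = 1" using 1[OF alg_field_1[OF F]] fhom_1[OF F g] by simp
    fix a b assume "a \<in> ring_adjoin F x" "b \<in> ring_adjoin F x"
    then obtain q r where q: "a = poly q x" "?C q" and r: "b = poly r x" "?C r"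
      by (auto simp: ring_adjoin_def)
    have "?C (q - r)" "?C (q * r)"
      using q r by (auto simp: coeff_mult intro!: alg_field_diff[OF F] alg_field_sum[OF F] alg_field_mult[OF F])
    from this[THEN g'] show "g' (a - b) = g' a - g' b" "g' (a * b) = g' a * g' b"
      using g' q r map_poly_fhom[OF F g, of q r] by simp_all
  qed
  then show ?thesis using that 1 2 by blast
qed

text \<open>Generators are adjoined one by one; since the complex numbers are algebraically closed,
  the transported minimal polynomial has a root to send the new generator to.\<close>

lemma fhom_extend:
  assumes "finite S" "alg_field F" "fhom F g" "\<And>s. s \<in> S \<Longrightarrow> algebraic s"
  obtains g' where "fhom (gen F S) g'" "\<And>z. z \<in> F \<Longrightarrow> g' z = g z"
proof -
  have "\<exists>g'. fhom (gen F S) g' \<and> (\<forall>z\<in>F. g' z = g z)"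
    using assms(1,4)
  proof (induction S rule: finite_induct)
    case empty
    have "gen F {} = F"
      using gen_base[of F "{}"] gen_minimal[of F F "{}"] alg_field_subrng[OF assms(2)] by auto
    then show ?case using assms(3) by auto
  next
    case (insert s S)
    then obtain g1 where g1: "fhom (gen F S) g1" "\<forall>z\<in>F. g1 z = g z" by auto
    have E: "alg_field (gen F S)" using insert.prems by (intro alg_field_gen[OF assms(2)]) auto
    obtain m where m: "minpoly_over (gen F S) s m"
      using minpoly_over_exists[OF E, of s] insert.prems by auto
    have "degree (map_poly g1 m) = degree m"
      using m fhom_1[OF E g1(1)] by (intro map_poly_degree_eq) (simp add: minpoly_over_def)
    then obtain y where "poly (map_poly g1 m) y = 0"
      using complex_poly_root[of "map_poly g1 m"] minpoly_over_degree_pos[OF m] by auto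
    from fhom_extend_simple[OF E g1(1) m this] obtain g2 where
      g2: "fhom (gen (gen F S) {s}) g2" "\<And>z. z \<in> gen F S \<Longrightarrow> g2 z = g1 z" by blast
    have "\<forall>z\<in>F. g2 z = g z" using g1(2) g2(2) gen_base[of F S] by auto
    then show ?case using g2(1) unfolding gen_insert[of F s S] by blast
  qed
  then show ?thesis using that by blast
qed

section \<open>Automorphism groups\<close>

text \<open>The carrier of \<open>Gal L K\<close> in terms of \<open>fhom\<close>. Surjectivity is
  enough for bijectivity, since homomorphisms of fields are injective.\<close>

definition auts :: "complex set \<Rightarrow> complex set \<Rightarrow> (complex \<Rightarrow> complex) set"
  where "auts L K = {f \<in> extensional L. f ` L = L \<and> fhom L f \<and> (\<forall>x\<in>K. f x = x)}"

lemma Gal_carrier: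
  assumes L: "alg_field L"
  shows "carrier (Gal L K) = auts L K"
proof -
  have "f \<in> Bij L \<and> f \<in> ring_hom (complex_ring\<lparr>carrier := L\<rparr>) (complex_ring\<lparr>carrier := L\<rparr>)
    \<longleftrightarrow> f \<in> extensional L \<and> f ` L = L \<and> fhom L f" for f
  proof
    assume *: "f \<in> Bij L \<and> f \<in> ring_hom (complex_ring\<lparr>carrier := L\<rparr>) (complex_ring\<lparr>carrier := L\<rparr>)"
    then have e: "f \<in> extensional L" "f ` L = L" by (auto simp: Bij_def bij_betw_def)
    have h: "f 1 = 1" "\<And>x y. x \<in> L \<Longrightarrow> y \<in> L \<Longrightarrow> f (x * y) = f x * f y \<and> f (x + y) = f x + f y"
      using * by (auto simp: ring_hom_def ring_of_type_algebra_def)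
    have "f (x - y) = f x - f y" if "x \<in> L" "y \<in> L" for x y
      using h(2)[of "x - y" y] alg_field_diff[OF L] that by simp
    then show "f \<in> extensional L \<and> f ` L = L \<and> fhom L f" using e h by (simp add: fhom_def)
  next
    assume *: "f \<in> extensional L \<and> f ` L = L \<and> fhom L f"
    then have "f \<in> Bij L" using fhom_inj_on[OF L] by (auto simp: Bij_def bij_betw_def)
    then show "f \<in> Bij L \<and> f \<in> ring_hom (complex_ring\<lparr>carrier := L\<rparr>) (complex_ring\<lparr>carrier := L\<rparr>)"
      using * fhom_1[OF L, of f] fhom_add[OF L, of f] fhom_mult[OF L, of f]
      by (auto simp: ring_hom_def ring_of_type_algebra_def)
  qed
  then show ?thesis by (auto simp: Gal_def auts_def)
qed

lemma Gal_one: "\<one>\<^bsub>Gal L K\<^esub> = (\<lambda>x\<in>L. x)"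
  by (simp add: Gal_def BijGroup_def)

lemma auts_Bij: "alg_field L \<Longrightarrow> f \<in> auts L K \<Longrightarrow> f \<in> Bij L"
  using fhom_inj_on by (auto simp: auts_def Bij_def bij_betw_def)

lemma Gal_mult:
  assumes "alg_field L" "f \<in> auts L K" "g \<in> auts L K"
  shows "f \<otimes>\<^bsub>Gal L K\<^esub> g = compose L f g"
  using assms auts_Bij by (simp add: Gal_def BijGroup_def)

lemma
  assumes "f \<in> auts L K"
  shows auts_fhom: "fhom L f" and auts_closed: "x \<in> L \<Longrightarrow> f x \<in> L" and auts_image: "f ` L = L"
    and auts_fix: "x \<in> K \<Longrightarrow> f x = x" and auts_ext: "f \<in> extensional L"
  using assms by (auto simp: auts_def)

lemma auts_compose:
  assumes L: "alg_field L" and f: "f \<in> auts L K" and g: "g \<in> auts L K" and K: "K \<subseteq> L"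
  shows "compose L f g \<in> auts L K"
proof -
  have "fhom L (\<lambda>x. f (g x))"
    by (rule fhom_comp[OF L auts_fhom[OF g] auts_fhom[OF f]]) (simp add: auts_image[OF g])
  then have "fhom L (compose L f g)" by (rule fhom_cong[OF L]) (simp add: compose_eq)
  moreover have "compose L f g ` L = f ` (g ` L)" by (auto simp: compose_def)
  ultimately show ?thesis using f g K by (auto simp: auts_def compose_def)
qed

lemma auts_id: "alg_field L \<Longrightarrow> K \<subseteq> L \<Longrightarrow> (\<lambda>x\<in>L. x) \<in> auts L K"
  by (auto simp: auts_def fhom_def alg_field_1 alg_field_diff alg_field_mult)

lemma auts_inv:
  assumes L: "alg_field L" and f: "f \<in> auts L K" and K: "K \<subseteq> L"
  shows "(\<lambda>x\<in>L. inv_into L f x) \<in> auts L K"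
proof -
  have inj: "inj_on f L" by (rule fhom_inj_on[OF L auts_fhom[OF f]])
  have im: "f ` L = L" by (rule auts_image[OF f])
  let ?h = "inv_into L f"
  have h: "?h x \<in> L" "f (?h x) = x" if "x \<in> L" for x
    using that im by (auto intro: inv_into_into f_inv_into_f)
  have eq: "?h x = y" if "x \<in> L" "y \<in> L" "f y = x" for x y
    using inj that by auto
  have "fhom L ?h"
    unfolding fhom_def
  proof (intro conjI ballI)
    show "?h 1 = 1" using eq alg_field_1[OF L] fhom_1[OF L auts_fhom[OF f]] by blast
    fix x y assume xy: "x \<in> L" "y \<in> L"
    show "?h (x - y) = ?h x - ?h y"
      using xy h fhom_diff[OF L auts_fhom[OF f]] by (intro eq) (auto intro: alg_field_diff[OF L])
    show "?h (x * y) = ?h x * ?h y"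
      using xy h fhom_mult[OF L auts_fhom[OF f]] by (intro eq) (auto intro: alg_field_mult[OF L])
  qed
  then have "fhom L (\<lambda>x\<in>L. ?h x)" by (rule fhom_cong[OF L]) simp
  moreover have "(\<lambda>x\<in>L. ?h x) ` L = L"
    using inj im by (auto simp: image_iff intro!: inv_into_into) (metis auts_closed f inv_into_f_f)
  moreover have "(\<lambda>x\<in>L. ?h x) x = x" if "x \<in> K" for x
    using that K auts_fix[OF f] eq[of x x] by auto
  ultimately show ?thesis by (auto simp: auts_def)
qed

lemma group_Gal:
  assumes L: "alg_field L" and K: "K \<subseteq> L"
  shows "group (Gal L K)"
proof (rule groupI)
  note c = Gal_carrier[OF L]
  show "\<one>\<^bsub>Gal L K\<^esub> \<in> carrier (Gal L K)" using auts_id[OF L K] by (simp add: c Gal_one)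
  fix x y z assume xyz: "x \<in> carrier (Gal L K)" "y \<in> carrier (Gal L K)"
  then show "x \<otimes>\<^bsub>Gal L K\<^esub> y \<in> carrier (Gal L K)"
    using auts_compose[OF L _ _ K] by (simp add: c Gal_mult[OF L])
  assume "z \<in> carrier (Gal L K)"
  then show "x \<otimes>\<^bsub>Gal L K\<^esub> y \<otimes>\<^bsub>Gal L K\<^esub> z = x \<otimes>\<^bsub>Gal L K\<^esub> (y \<otimes>\<^bsub>Gal L K\<^esub> z)"
    using xyz auts_compose[OF L _ _ K] auts_closed
    by (simp add: c Gal_mult[OF L]) (rule compose_assoc[symmetric], auto intro: auts_closed)
next
  fix x assume x: "x \<in> carrier (Gal L K)"
  then have x': "x \<in> auts L K" by (simp add: Gal_carrier[OF L])
  show "\<one>\<^bsub>Gal L K\<^esub> \<otimes>\<^bsub>Gal L K\<^esub> x = x"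
    using x' auts_id[OF L K] auts_ext[OF x'] auts_closed[OF x']
    by (simp add: Gal_mult[OF L] Gal_one Id_compose Pi_I)
  have "compose L (\<lambda>y\<in>L. inv_into L x y) x = (\<lambda>x\<in>L. x)"
    by (rule Bij_compose_restrict_eq[OF auts_Bij[OF L x']])
  then show "\<exists>y\<in>carrier (Gal L K). y \<otimes>\<^bsub>Gal L K\<^esub> x = \<one>\<^bsub>Gal L K\<^esub>"
    using auts_inv[OF L x' K] x' by (intro bexI[of _ "\<lambda>y\<in>L. inv_into L x y"]) (auto simp: Gal_mult[OF L] Gal_one Gal_carrier[OF L])
qed

section \<open>Absolute values on fields of algebraic numbers\<close>

text \<open>A normalised ultrametric absolute value above the prime \<open>l\<close>. The last axiom
  confines the values to rational powers of \<open>l\<close>; it allows \<open>N\<close> to be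
  recovered from its prime ideal in \<open>absval_unique\<close>.\<close>

locale absval =
  fixes E :: "complex set" and N :: "complex \<Rightarrow> real" and l :: nat
  assumes E: "alg_field E" and l: "Factorial_Ring.prime l"
    and N_0: "N 0 = 0"
    and N_pos: "x \<in> E \<Longrightarrow> x \<noteq> 0 \<Longrightarrow> N x > 0"
    and N_mult: "x \<in> E \<Longrightarrow> y \<in> E \<Longrightarrow> N (x * y) = N x * N y"
    and N_add: "x \<in> E \<Longrightarrow> y \<in> E \<Longrightarrow> N (x + y) \<le> max (N x) (N y)"
    and N_int: "x \<in> E \<Longrightarrow> algebraic_int x \<Longrightarrow> N x \<le> 1"
    and N_l: "N (of_nat l) = inverse (real l)"
    and N_value: "x \<in> E \<Longrightarrow> x \<noteq> 0 \<Longrightarrow> \<exists>b>0. \<exists>k. N x ^ b = real l powi k"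
begin

lemma l_gt_1: "real l > 1"
  using prime_gt_1_nat[OF l] by simp

lemma N_nonneg: "x \<in> E \<Longrightarrow> N x \<ge> 0"
  using N_pos[of x] N_0 by (cases "x = 0") auto

lemma N_1: "N 1 = 1"
  using N_mult[of 1 1] N_pos[of 1] alg_field_1[OF E] by simp

lemma N_minus: "x \<in> E \<Longrightarrow> N (- x) = N x"
proof -
  have m: "- 1 \<in> E" using alg_field_1[OF E] alg_field_uminus[OF E] by blast
  have "N (- 1) * N (- 1) = 1" using N_mult[OF m m] N_1 by simp
  then have "N (- 1) = 1" using N_nonneg[OF m] by (simp flip: power2_eq_square add: power2_eq_1_iff)
  then show "x \<in> E \<Longrightarrow> N (- x) = N x" using N_mult[OF m, of x] by simp
qed

lemma N_diff: "x \<in> E \<Longrightarrow> y \<in> E \<Longrightarrow> N (x - y) \<le> max (N x) (N y)"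
  using N_add[of x "- y"] N_minus[of y] alg_field_uminus[OF E] by simp

lemma N_diff_commute: "x \<in> E \<Longrightarrow> y \<in> E \<Longrightarrow> N (x - y) = N (y - x)"
  using N_minus[of "x - y"] alg_field_diff[OF E] by simp

lemma N_pow: "x \<in> E \<Longrightarrow> N (x ^ n) = N x ^ n"
  by (induction n) (auto simp: N_1 N_mult alg_field_pow[OF E])

lemma N_prod: "(\<And>i. i \<in> A \<Longrightarrow> f i \<in> E) \<Longrightarrow> N (prod f A) = (\<Prod>i\<in>A. N (f i))"
  by (induction A rule: infinite_finite_induct) (auto simp: N_1 N_mult alg_field_prod[OF E])

lemma N_inverse: "x \<in> E \<Longrightarrow> N (inverse x) = inverse (N x)"
proof (cases "x = 0")
  case False
  assume x: "x \<in> E"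
  then have "N x * N (inverse x) = 1"
    using N_mult[OF x alg_field_inverse[OF E x]] False N_1 by simp
  then show ?thesis using inverse_unique by metis
qed (simp add: N_0)

lemma N_divide: "x \<in> E \<Longrightarrow> y \<in> E \<Longrightarrow> N (x / y) = N x / N y"
  by (simp add: divide_inverse N_mult N_inverse alg_field_inverse[OF E])

lemma N_sum_le:
  assumes "c \<ge> 0" "\<And>i. i \<in> A \<Longrightarrow> f i \<in> E" "\<And>i. i \<in> A \<Longrightarrow> N (f i) \<le> c"
  shows "N (sum f A) \<le> c"
  using assms(2,3)
proof (induction A rule: infinite_finite_induct)
  case (insert x F)
  then have "N (f x + sum f F) \<le> max (N (f x)) (N (sum f F))"
    by (intro N_add alg_field_sum[OF E]) auto
  also have "\<dots> \<le> c" using insert by auto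
  finally show ?case using insert by simp
qed (use assms(1) N_0 in auto)

lemma N_sum_less:
  assumes "c > 0" "\<And>i. i \<in> A \<Longrightarrow> f i \<in> E" "\<And>i. i \<in> A \<Longrightarrow> N (f i) < c"
  shows "N (sum f A) < c"
  using assms(2,3)
proof (induction A rule: infinite_finite_induct)
  case (insert x F)
  then have "N (f x + sum f F) \<le> max (N (f x)) (N (sum f F))"
    by (intro N_add alg_field_sum[OF E]) auto
  also have "\<dots> < c" using insert by auto
  finally show ?case using insert by simp
qed (use assms(1) N_0 in auto)

lemma N_add_eq:
  assumes "x \<in> E" "y \<in> E" "N y < N x"
  shows "N (x + y) = N x"
proof (rule antisym)
  show "N (x + y) \<le> N x" using N_add[OF assms(1,2)] assms(3) by simp
  have "N ((x + y) - y) \<le> max (N (x + y)) (N y)"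
    using assms by (intro N_diff alg_field_add[OF E])
  then show "N x \<le> N (x + y)" using assms(3) by (simp add: max_def split: if_splits)
qed

lemma N_of_int: "N (of_int n) \<le> 1"
  by (intro N_int alg_field_of_int[OF E] int_imp_algebraic_int) simp

lemma N_of_nat: "N (of_nat n) \<le> 1"
  using N_of_int[of "int n"] by simp

lemma N_of_int_dvd:
  assumes "int l dvd n" shows "N (of_int n) < 1"
proof -
  obtain m where m: "n = int l * m" using assms by blast
  have "N (of_int n) = N (of_nat l) * N (of_int m)"
    using N_mult[OF alg_field_of_nat[OF E, of l] alg_field_of_int[OF E, of m]] by (simp add: m)
  also have "\<dots> \<le> inverse (real l) * 1"
    unfolding N_l using N_of_int[of m] by (intro mult_left_mono) auto
  also have "\<dots> < 1" using l_gt_1 by (simp add: field_simps)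
  finally show ?thesis .
qed

lemma N_of_int_coprime:
  assumes "\<not> int l dvd n" shows "N (of_int n) = 1"
proof -
  have "coprime n (int l)" using assms l by (metis coprime_commute prime_imp_coprime prime_nat_int_transfer)
  then obtain u w where uw: "u * n + w * int l = 1"
    using bezout_int[of n "int l"] by auto
  show ?thesis
  proof (rule ccontr)
    assume "N (of_int n) \<noteq> 1"
    then have lt: "N (of_int n) < 1" using N_of_int[of n] by simp
    have "N (of_int (u * n)) < 1"
    proof -
      have "N (of_int (u * n)) = N (of_int u) * N (of_int n)"
        by (simp add: N_mult alg_field_of_int[OF E])
      also have "\<dots> \<le> 1 * N (of_int n)"
        by (intro mult_right_mono N_of_int N_nonneg alg_field_of_int[OF E])
      finally show ?thesis using lt by simp
    qed
    moreover have "N (of_int (w * int l)) < 1" by (rule N_of_int_dvd) simp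
    moreover have "N (of_int (u * n) + of_int (w * int l)) \<le> max (N (of_int (u * n))) (N (of_int (w * int l)))"
      by (intro N_add alg_field_of_int[OF E])
    moreover have "of_int (u * n) + of_int (w * int l) = (1 :: complex)"
      using uw by (metis of_int_1 of_int_add)
    ultimately show False using N_1 by simp
  qed
qed

lemma N_of_int_less_1_iff: "N (of_int n) < 1 \<longleftrightarrow> int l dvd n"
  using N_of_int_dvd N_of_int_coprime by force

lemma N_l_powi: "N (of_nat l powi k) = real l powi (- k)"
proof (cases "k \<ge> 0")
  case True
  then show ?thesis
    by (simp add: power_int_def N_pow N_l alg_field_of_nat[OF E] power_inverse)
next
  case False
  then show ?thesis
    by (simp add: power_int_def N_pow N_inverse N_l alg_field_of_nat[OF E] alg_field_pow[OF E] power_inverse)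
qed

lemma N_of_int_value: "n \<noteq> 0 \<Longrightarrow> \<exists>k. N (of_int n) = real l powi k"
proof -
  assume n: "n \<noteq> 0"
  obtain y where y: "n = int l ^ multiplicity (int l) n * y" "\<not> int l dvd y"
    using multiplicity_decompose'[of n "int l"] n prime_gt_1_nat[OF l] by (auto simp: zdvd1_eq)
  have "N (of_int (int l ^ multiplicity (int l) n * y)) = N (of_nat l powi int (multiplicity (int l) n)) * N (of_int y)"
    by (simp add: N_mult alg_field_of_int[OF E] alg_field_of_nat[OF E] alg_field_pow[OF E])
  then have "N (of_int n) = N (of_nat l powi int (multiplicity (int l) n)) * N (of_int y)"
    using y(1) by simp
  then show ?thesis
    using N_of_int_coprime[OF y(2)] N_l_powi[of "int (multiplicity (int l) n)"]
    by (intro exI[of _ "- int (multiplicity (int l) n)"]) simp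
qed

lemma N_Rats_value:
  assumes "x \<in> \<rat>" "x \<noteq> 0" shows "\<exists>k. N x = real l powi k"
proof -
  obtain a b where ab: "b > 0" "x = of_int a / of_int b" using assms(1) by (elim Rats_cases') auto
  then have "a \<noteq> 0" using assms(2) by auto
  then obtain i j where "N (of_int a) = real l powi i" "N (of_int b) = real l powi j"
    using N_of_int_value[of a] N_of_int_value[of b] ab by auto
  then have "N x = real l powi (i - j)"
    using ab l_gt_1 by (simp add: N_divide alg_field_of_int[OF E] power_int_diff)
  then show ?thesis by blast
qed

section \<open>Localization, uniqueness and separation of absolute values\<close>

text \<open>If the leading coefficient c has value 1, then x = (c x)/c is the wanted fraction of
  algebraic integers. Otherwise c x is integral of value below 1 and can be absorbed into the next
  coefficient, which lowers the degree.\<close>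

lemma localization_poly:
  assumes "x \<in> E" "N x \<le> 1" "\<And>i. algebraic_int (coeff q i)" "\<And>i. coeff q i \<in> E"
    "poly q x = 0" "N (coeff q j) = 1"
  shows "\<exists>s\<in>E. \<exists>t\<in>E. algebraic_int s \<and> algebraic_int t \<and> N t = 1 \<and> x * t = s"
  using assms(3-)
proof (induction "degree q" arbitrary: q j rule: less_induct)
  case less
  let ?c = "lead_coeff q" and ?n = "degree q"
  have cx: "algebraic_int (?c * x)" by (rule algebraic_int_lead_coeff_mult[OF less.prems(1,3)])
  have cxE: "?c * x \<in> E" using less.prems assms alg_field_mult[OF E] by blast
  show ?case
  proof (cases "N ?c = 1")
    case True
    then show ?thesis using cx cxE less.prems by (intro bexI[of _ "?c * x"] bexI[of _ ?c]) (auto simp: mult.commute)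
  next
    case False
    then have c1: "N ?c < 1" using N_int[OF less.prems(2) less.prems(1), of ?n] by simp
    have q0: "q \<noteq> 0" using less.prems(4) N_0 by auto
    have "?n \<noteq> 0"
    proof
      assume "?n = 0"
      then obtain a where "q = [:a:]" by (rule degree_eq_zeroE)
      then show False using less.prems(3) q0 by simp
    qed
    then obtain m where m: "?n = Suc m" by (metis not0_implies_Suc)
    \<comment> \<open>The top term c X^n is replaced by (c x) X^(n - 1), which agrees with it at x.
      As c x has value below 1, some coefficient still has value 1.\<close>
    define q' where "q' = q - monom ?c ?n + monom (?c * x) m"
    have cf: "coeff q' i = (if i = ?n then 0 else if i = m then coeff q m + ?c * x else coeff q i)" for i
      using m by (auto simp: q'_def coeff_monom)
    have "degree q' \<le> m"
      by (rule degree_le) (auto simp: cf m coeff_eq_0)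
    then have lt: "degree q' < ?n" using m by simp
    have 1: "algebraic_int (coeff q' i)" "coeff q' i \<in> E" for i
      using less.prems(1,2) cx cxE by (auto simp: cf intro: algebraic_int_plus alg_field_add[OF E] alg_field_0[OF E])
    have 2: "poly q' x = 0"
      using less.prems(3) m by (simp add: q'_def poly_monom)
    have cxN: "N (?c * x) < 1"
    proof -
      have "N (?c * x) \<le> N ?c * 1"
        using N_mult[OF less.prems(2) assms(1)] assms(2) N_nonneg[OF less.prems(2)] by (simp add: mult_left_le)
      then show ?thesis using c1 by simp
    qed
    have "j \<noteq> ?n" using less.prems(4) c1 by auto
    have "\<exists>j. N (coeff q' j) = 1"
    proof (cases "j = m")
      case True
      then have "N (coeff q m + ?c * x) = 1"
        using N_add_eq[OF less.prems(2) cxE, of m] cxN less.prems(4) by simp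
      then show ?thesis using m by (intro exI[of _ m]) (simp add: cf)
    next
      case False
      then show ?thesis using \<open>j \<noteq> ?n\<close> less.prems(4) by (intro exI[of _ j]) (simp add: cf)
    qed
    then show ?thesis using less.hyps[OF lt 1 2] by blast
  qed
qed

lemma localization:
  assumes "x \<in> E" "N x \<le> 1"
  obtains s t where "s \<in> E" "t \<in> E" "algebraic_int s" "algebraic_int t" "N t = 1" "x * t = s"
proof -
  obtain r0 :: "int poly" where r0: "poly (map_poly of_int r0) x = 0" "r0 \<noteq> 0"
    using alg_field_algebraic[OF E assms(1)] by (elim algebraicE')
  \<comment> \<open>A primitive polynomial has a coefficient prime to \<open>l\<close>, that is, one
    of value 1.\<close>
  define r where "r = primitive_part r0"
  have e: "r0 = smult (content r0) r" by (simp add: r_def)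
  have c0: "content r0 \<noteq> 0" using r0 by simp
  have "(map_poly of_int r0 :: complex poly) = smult (of_int (content r0)) (map_poly of_int r)"
    by (subst e) (simp add: map_poly_smult)
  then have p0: "poly (map_poly of_int r) x = 0" using r0(1) c0 by simp
  have "\<not> [:int l:] dvd r"
    using r0(2) prime_gt_1_nat[OF l] by (simp add: const_poly_dvd_iff_dvd_content r_def)
  then obtain j where "\<not> int l dvd coeff r j" by (auto simp: const_poly_dvd_iff)
  then have "N (coeff (map_poly of_int r) j) = 1" using N_of_int_coprime by (simp add: coeff_map_poly)
  from localization_poly[OF assms _ _ p0 this] show ?thesis
    using that by (auto simp: coeff_map_poly intro: int_imp_algebraic_int alg_field_of_int[OF E])
qed

end

text \<open>An inclusion of prime ideals forces equality. Writing y = s/t with integral s, t and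
  \<open>N2 t = 1\<close>, the inclusion gives \<open>N1 t = 1\<close>, so the unit ball of
  \<open>N2\<close> lies in that of \<open>N1\<close>, and units for \<open>N2\<close> are units for
  \<open>N1\<close>. Up to a power of \<open>l\<close>, some power of x is such a unit.\<close>

lemma absval_unique:
  assumes "absval E N1 l" "absval E N2 l"
    and le: "\<And>x. x \<in> E \<Longrightarrow> algebraic_int x \<Longrightarrow> N1 x < 1 \<Longrightarrow> N2 x < 1"
    and x: "x \<in> E"
  shows "N1 x = N2 x"
proof (cases "x = 0")
  case False
  interpret N1: absval E N1 l by fact
  interpret N2: absval E N2 l by fact
  note E = N1.E
  have 1: "N1 y \<le> 1" if y: "y \<in> E" "N2 y \<le> 1" for y
  proof -
    obtain s t where st: "s \<in> E" "t \<in> E" "algebraic_int s" "algebraic_int t" "N2 t = 1" "y * t = s"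
      using N2.localization[OF y] by metis
    have "N1 t = 1" using le[of t] N1.N_int[of t] st by fastforce
    then have "N1 y = N1 s" using N1.N_mult[OF y(1) st(2)] st(6) by simp
    then show ?thesis using N1.N_int st by simp
  qed
  have 2: "N1 y = 1" if y: "y \<in> E" "N2 y = 1" for y
  proof -
    have "y \<noteq> 0" using y N2.N_0 by auto
    have "N1 (inverse y) \<le> 1" using y N2.N_inverse by (intro 1 alg_field_inverse[OF E]) simp_all
    then have "N1 y \<ge> 1"
      using N1.N_inverse[OF y(1)] N1.N_pos[OF y(1) \<open>y \<noteq> 0\<close>] by (simp add: inverse_le_1_iff)
    then show ?thesis using 1[of y] y by simp
  qed
  obtain b k where b: "b > 0" "N2 x ^ b = real l powi k" using N2.N_value[OF x False] by blast
  \<comment> \<open>The factor l^k has value l^(-k) and cancels the value of x^b.\<close>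
  define z where "z = x ^ b * of_nat l powi k"
  have lE: "of_nat l powi k \<in> E"
    by (auto simp: power_int_def intro!: alg_field_pow[OF E] alg_field_inverse[OF E] alg_field_of_nat[OF E])
  have xb: "x ^ b \<in> E" by (rule alg_field_pow[OF E x])
  have "N2 z = 1"
    using b N2.l_gt_1 by (simp add: z_def N2.N_mult[OF xb lE] N2.N_pow[OF x] N2.N_l_powi power_int_minus)
  moreover have "z \<in> E" unfolding z_def by (rule alg_field_mult[OF E xb lE])
  ultimately have "N1 z = 1" using 2 by blast
  then have "N1 x ^ b = real l powi k"
    using N2.l_gt_1 by (simp add: z_def N1.N_mult[OF xb lE] N1.N_pow[OF x] N1.N_l_powi power_int_minus field_simps)
  then have "N1 x ^ b = N2 x ^ b" using b by simp
  then show ?thesis using b(1) N1.N_nonneg[OF x] N2.N_nonneg[OF x] by (simp add: power_eq_iff_eq_base)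
qed (use assms in \<open>simp add: absval.N_0\<close>)

lemma absval_comp:
  assumes "absval L N l" "alg_field F" "fhom F g" "g ` F \<subseteq> L"
  shows "absval F (\<lambda>x. N (g x)) l"
proof -
  interpret absval L N l by fact
  have m: "g x \<in> L" if "x \<in> F" for x using assms(4) that by blast
  have g_nat: "g (of_nat n) = of_nat n" for n by (rule fhom_Rats[OF assms(2,3)]) simp
  show ?thesis
  proof (unfold_locales)
    show "alg_field F" by fact
    show "Factorial_Ring.prime l" by (rule l)
    show "N (g 0) = 0" by (simp add: fhom_0[OF assms(2,3)] N_0)
    show "N (g (of_nat l)) = inverse (real l)" by (simp add: g_nat N_l)
    fix x assume x: "x \<in> F"
    show "x \<noteq> 0 \<Longrightarrow> 0 < N (g x)" using N_pos[OF m[OF x]] fhom_eq_0[OF assms(2,3) x] by simp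
    show "algebraic_int x \<Longrightarrow> N (g x) \<le> 1" using N_int[OF m[OF x]] fhom_algebraic_int[OF assms(2,3) x] by simp
    show "x \<noteq> 0 \<Longrightarrow> \<exists>b>0. \<exists>k. N (g x) ^ b = real l powi k"
      using N_value[OF m[OF x]] fhom_eq_0[OF assms(2,3) x] by simp
    fix y assume y: "y \<in> F"
    show "N (g (x * y)) = N (g x) * N (g y)" "N (g (x + y)) \<le> max (N (g x)) (N (g y))"
      using N_mult[OF m[OF x] m[OF y]] N_add[OF m[OF x] m[OF y]]
        fhom_mult[OF assms(2,3) x y] fhom_add[OF assms(2,3) x y] by simp_all
  qed
qed

lemma absval_mono:
  assumes "absval E N l" "alg_field F" "F \<subseteq> E"
  shows "absval F N l"
  using absval_comp[OF assms(1,2), of "\<lambda>x. x"] assms(3) by (simp add: fhom_def)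

lemma absval_restrict:
  assumes "absval E N l" shows "absval E (restrict N E) l"
proof -
  interpret absval E N l by fact
  note e = alg_field_0[OF E] alg_field_of_nat[OF E, of l] alg_field_mult[OF E] alg_field_add[OF E]
  show ?thesis
    by unfold_locales (auto simp: e E l N_0 N_l N_mult N_add N_int N_pos N_value)
qed

text \<open>By \<open>absval_unique\<close>, each other absolute value has an algebraic integer in
  its prime that is a unit for \<open>\<nu>\<close>; the product of these integers works for all at
  once.\<close>

lemma absval_separate:
  assumes fin: "finite A" and av: "\<And>\<nu>. \<nu> \<in> A \<Longrightarrow> absval E \<nu> l"
    and ne: "\<And>\<nu> \<nu>'. \<nu> \<in> A \<Longrightarrow> \<nu>' \<in> A \<Longrightarrow> (\<And>x. x \<in> E \<Longrightarrow> \<nu> x = \<nu>' x) \<Longrightarrow> \<nu> = \<nu>'"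
    and \<nu>: "\<nu> \<in> A"
  shows "\<exists>c\<in>E. algebraic_int c \<and> \<nu> c = 1 \<and> (\<forall>\<nu>'\<in>A - {\<nu>}. \<nu>' c < 1)"
proof -
  interpret v: absval E \<nu> l using av \<nu> by blast
  have "\<exists>x\<in>E. algebraic_int x \<and> \<nu> x = 1 \<and> \<nu>' x < 1" if \<nu>': "\<nu>' \<in> A - {\<nu>}" for \<nu>'
  proof (rule ccontr)
    assume *: "\<not> ?thesis"
    have "\<nu>' x = \<nu> x" if "x \<in> E" for x
    proof (rule absval_unique[OF _ _ _ that])
      show "absval E \<nu>' l" "absval E \<nu> l" using av \<nu>' \<nu> by auto
      fix x assume "x \<in> E" "algebraic_int x" "\<nu>' x < 1"
      then show "\<nu> x < 1" using * v.N_int[of x] by force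
    qed
    then show False using ne[of \<nu>' \<nu>] \<nu> \<nu>' by auto
  qed
  then obtain x where x: "\<And>\<nu>'. \<nu>' \<in> A - {\<nu>} \<Longrightarrow> x \<nu>' \<in> E \<and> algebraic_int (x \<nu>') \<and> \<nu> (x \<nu>') = 1 \<and> \<nu>' (x \<nu>') < 1"
    by metis
  define c where "c = (\<Prod>\<nu>'\<in>A - {\<nu>}. x \<nu>')"
  have "algebraic_int (\<Prod>\<nu>'\<in>B. x \<nu>')" if "B \<subseteq> A - {\<nu>}" for B
    using that x by (induction B rule: infinite_finite_induct) (auto intro: algebraic_int_mult int_imp_algebraic_int)
  then have "algebraic_int c" by (simp add: c_def)
  moreover have "c \<in> E" unfolding c_def using x by (intro alg_field_prod[OF v.E]) auto
  moreover have "\<nu> c = 1" unfolding c_def using x by (subst v.N_prod) auto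
  moreover have "\<nu>' c < 1" if "\<nu>' \<in> A - {\<nu>}" for \<nu>'
  proof -
    interpret v': absval E \<nu>' l using av that by blast
    have "c = x \<nu>' * (\<Prod>\<nu>''\<in>A - {\<nu>} - {\<nu>'}. x \<nu>'')"
      unfolding c_def using that fin by (simp add: prod.remove)
    also have "\<nu>' \<dots> = \<nu>' (x \<nu>') * (\<Prod>\<nu>''\<in>A - {\<nu>} - {\<nu>'}. \<nu>' (x \<nu>''))"
    proof -
      have m: "x \<nu>'' \<in> E" if "\<nu>'' \<in> A - {\<nu>} - {\<nu>'}" for \<nu>'' using x that by blast
      show ?thesis
        using v'.N_mult[of "x \<nu>'" "prod x (A - {\<nu>} - {\<nu>'})"] v'.N_prod[of "A - {\<nu>} - {\<nu>'}" x]
          x[OF that] alg_field_prod[OF v.E, of "A - {\<nu>} - {\<nu>'}" x] m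
        by simp
    qed
    also have "\<dots> \<le> \<nu>' (x \<nu>') * 1"
      using x that by (intro mult_left_mono prod_le_1) (auto intro: v'.N_nonneg v'.N_int)
    finally show ?thesis using x[OF that] by simp
  qed
  ultimately show ?thesis by blast
qed

text \<open>Newton's scheme: a multiple of the product vanishing at the old nodes corrects the new
  value, and all coefficients stay in \<open>E\<close>. The alternative \<open>Y = 0\<close> covers
  the empty set of nodes.\<close>

lemma interpolation:
  assumes E: "alg_field E" and "finite I" "inj_on f I" "\<And>i. i \<in> I \<Longrightarrow> f i \<in> E" "\<And>i. i \<in> I \<Longrightarrow> v i \<in> E"
  shows "\<exists>Y. (\<forall>j. coeff Y j \<in> E) \<and> (Y = 0 \<or> degree Y < card I) \<and> (\<forall>i\<in>I. poly Y (f i) = v i)"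
  using assms(2-)
proof (induction I rule: finite_induct)
  case empty
  then show ?case using alg_field_0[OF E] by (intro exI[of _ 0]) auto
next
  case (insert i I)
  then obtain Y where Y: "\<forall>j. coeff Y j \<in> E" "Y = 0 \<or> degree Y < card I" "\<forall>i\<in>I. poly Y (f i) = v i"
    by auto
  have fI: "f j \<in> E" if "j \<in> I" for j using insert.prems(2) that by blast
  define P where "P = (\<Prod>j\<in>I. [:- f j, 1:])"
  have dP: "degree P = card I" unfolding P_def by (subst degree_prod_eq_sum_degree) auto
  have "\<forall>k. coeff (\<Prod>j\<in>J. [:- f j, 1:]) k \<in> E" if "J \<subseteq> I" for J
    using that
  proof (induction J rule: infinite_finite_induct)
    case (insert x F)
    have "f x \<in> E" using insert.prems fI by auto
    then show ?case using insert
      by (auto simp: coeff_pCons alg_field_0[OF E] intro!: alg_field_add[OF E] alg_field_diff[OF E] alg_field_mult[OF E] alg_field_uminus[OF E] split: nat.split)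
  qed (auto simp: alg_field_0[OF E] alg_field_1[OF E])
  then have cP: "coeff P k \<in> E" for k by (simp add: P_def)
  have fi: "f i \<in> E" "v i \<in> E" using insert.prems by auto
  have Pi: "poly P (f i) \<noteq> 0" using insert by (auto simp: P_def poly_prod)
  define c where "c = (v i - poly Y (f i)) / poly P (f i)"
  have c: "c \<in> E"
    unfolding c_def using Y(1) cP fi
    by (intro alg_field_divide[OF E] alg_field_diff[OF E] subrng_poly alg_field_subrng[OF E]) auto
  show ?case
  proof (intro exI[of _ "Y + smult c P"] conjI allI ballI)
    show "coeff (Y + smult c P) j \<in> E" for j
      using Y(1) cP c by (auto intro!: alg_field_add[OF E] alg_field_mult[OF E])
    have "degree (Y + smult c P) \<le> card I"
      using Y(2) dP by (intro degree_add_le order_trans[OF degree_smult_le]) auto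
    then show "Y + smult c P = 0 \<or> degree (Y + smult c P) < card (insert i I)"
      using insert.hyps by auto
    show "poly (Y + smult c P) (f k) = v k" if "k \<in> insert i I" for k
    proof (cases "k = i")
      case True
      then show ?thesis using Pi by (simp add: c_def)
    next
      case False
      then have "k \<in> I" using that by auto
      moreover from this have "poly P (f k) = 0" using insert.hyps(1) by (auto simp: P_def poly_prod)
      ultimately show ?thesis using Y(3) by simp
    qed
  qed
qed

section \<open>Decomposition groups\<close>

locale splitting =
  fixes q :: "complex poly" and E :: "complex set" and G :: "(complex \<Rightarrow> complex) set"
  assumes q_nz: "q \<noteq> 0" and q_Rats: "coeff q i \<in> \<rat>"
    and E_def: "E = gen \<rat> {s. poly q s = 0}" and G_def: "G = auts E \<rat>"
begin

lemma alg_E: "alg_field E"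
proof -
  have "algebraic s" if "poly q s = 0" for s
    using that q_nz q_Rats by (auto simp: algebraic_altdef)
  then show ?thesis unfolding E_def by (intro alg_field_gen[OF alg_field_Rats_self]) auto
qed

lemma finite_roots: "finite {s. poly q s = 0}"
  using poly_roots_finite[OF q_nz] .

lemma roots_E: "poly q s = 0 \<Longrightarrow> s \<in> E"
  unfolding E_def using gen_mem[of "{s. poly q s = 0}" \<rat>] by auto

lemma Rats_E: "\<rat> \<subseteq> E"
  unfolding E_def by (rule gen_base)

lemma fhom_roots: "fhom E g \<Longrightarrow> poly q s = 0 \<Longrightarrow> poly q (g s) = 0"
  using fhom_poly_Rats[OF alg_E _ q_Rats roots_E, of g s] fhom_0[OF alg_E, of g] by simp

lemma fhom_image: assumes g: "fhom E g" shows "g ` E = E"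
proof
  let ?S = "{s. poly q s = 0}"
  have inj: "inj_on g ?S" using fhom_inj_on[OF alg_E g] roots_E by (auto intro: inj_on_subset)
  have sub: "g ` ?S \<subseteq> ?S" using fhom_roots[OF g] by auto
  have S: "g ` ?S = ?S" by (rule endo_inj_surj[OF finite_roots sub inj])
  have "g x \<in> E" if "x \<in> E" for x
    using that unfolding E_def
  proof (rule fhom_image_gen[rotated -1])
    show "alg_field (gen \<rat> ?S)" "fhom (gen \<rat> ?S) g" using alg_E g by (simp_all add: E_def)
    show "subrng (gen \<rat> ?S)" by (rule subrng_gen)
    show "g x \<in> gen \<rat> ?S" if "x \<in> \<rat>" for x
      using fhom_Rats[OF alg_E g that] that gen_base by auto
    show "g x \<in> gen \<rat> ?S" if "x \<in> ?S" for x
      using sub that gen_mem by blast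
  qed
  then show "g ` E \<subseteq> E" by blast
  have "subrng (g ` E)"
    unfolding subrng_def
  proof (intro conjI ballI)
    show "1 \<in> g ` E" using fhom_1[OF alg_E g] alg_field_1[OF alg_E] by (metis image_eqI)
    fix a b assume "a \<in> g ` E" "b \<in> g ` E"
    then obtain x y where xy: "x \<in> E" "y \<in> E" "a = g x" "b = g y" by blast
    then have "a - b = g (x - y)" "a * b = g (x * y)"
      using fhom_diff[OF alg_E g] fhom_mult[OF alg_E g] by auto
    then show "a - b \<in> g ` E" "a * b \<in> g ` E"
      using alg_field_diff[OF alg_E xy(1,2)] alg_field_mult[OF alg_E xy(1,2)] by auto
  qed
  moreover have "\<rat> \<subseteq> g ` E"
    using fhom_Rats[OF alg_E g] Rats_E by (metis image_iff subsetD subsetI)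
  moreover have "?S \<subseteq> g ` E" using S roots_E by blast
  ultimately show "E \<subseteq> g ` E" unfolding E_def by (intro gen_minimal) (auto simp: E_def)
qed

lemma restrict_G: assumes "fhom E g" shows "restrict g E \<in> G"
proof -
  have "fhom E (restrict g E)" by (rule fhom_cong[OF alg_E assms]) simp
  moreover have "x \<in> E" "g x = x" if "x \<in> \<rat>" for x
    using that Rats_E fhom_Rats[OF alg_E assms] by auto
  ultimately show ?thesis using fhom_image[OF assms] by (auto simp: G_def auts_def)
qed

lemma G_fhom: "g \<in> G \<Longrightarrow> fhom E g" and G_closed: "g \<in> G \<Longrightarrow> x \<in> E \<Longrightarrow> g x \<in> E"
  and G_inj: "g \<in> G \<Longrightarrow> inj_on g E"
  using fhom_inj_on[OF alg_E] by (auto simp: G_def auts_def)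

lemma G_compose: "g \<in> G \<Longrightarrow> h \<in> G \<Longrightarrow> compose E g h \<in> G"
  unfolding G_def by (rule auts_compose[OF alg_E _ _ Rats_E])

lemma G_id: "restrict (\<lambda>x. x) E \<in> G"
  unfolding G_def by (rule auts_id[OF alg_E Rats_E])

lemma G_eqI:
  assumes "g \<in> G" "h \<in> G" "\<And>s. poly q s = 0 \<Longrightarrow> g s = h s"
  shows "g = h"
proof (rule extensionalityI)
  show "g \<in> extensional E" "h \<in> extensional E" using assms by (auto simp: G_def auts_def)
  show "g x = h x" if "x \<in> E" for x
  proof (rule fhom_eq_on_gen[OF alg_E[unfolded E_def] G_fhom[OF assms(1), unfolded E_def] G_fhom[OF assms(2), unfolded E_def]])
    show "x \<in> gen \<rat> {s. poly q s = 0}" using that by (simp add: E_def)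
    show "g x = h x" if "x \<in> \<rat>" for x
      using fhom_Rats[OF alg_E G_fhom[OF assms(1)] that] fhom_Rats[OF alg_E G_fhom[OF assms(2)] that] by simp
  qed (use assms(3) in simp)
qed

lemma finite_G: "finite G"
proof -
  let ?S = "{s. poly q s = 0}"
  have "finite (?S \<rightarrow>\<^sub>E ?S)" by (intro finite_PiE finite_roots)
  moreover have "(\<lambda>g. restrict g ?S) ` G \<subseteq> ?S \<rightarrow>\<^sub>E ?S"
    using fhom_roots[OF G_fhom] by (intro image_subsetI, subst restrict_PiE_iff) auto
  moreover have "inj_on (\<lambda>g. restrict g ?S) G"
  proof (rule inj_onI)
    fix g h assume gh: "g \<in> G" "h \<in> G" "restrict g ?S = restrict h ?S"
    show "g = h"
      by (rule G_eqI[OF gh(1,2)]) (use fun_cong[OF gh(3)] in \<open>auto simp: restrict_def split: if_splits\<close>, metis)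
  qed
  ultimately show ?thesis using finite_imageD finite_subset by metis
qed

text \<open>A non-rational x has a second conjugate; the isomorphism sending x to it extends to the
  splitting field and moves x.\<close>

lemma fixed_Rats:
  assumes x: "x \<in> E" and fixed: "\<And>g. g \<in> G \<Longrightarrow> g x = x"
  shows "x \<in> \<rat>"
proof (rule ccontr)
  assume nx: "x \<notin> \<rat>"
  let ?S = "{s. poly q s = 0}"
  obtain m where m: "minpoly_over \<rat> x m"
    using minpoly_over_exists[OF alg_field_Rats_self alg_field_algebraic[OF alg_E x]] .
  obtain y where y: "poly m y = 0" "y \<noteq> x"
    using minpoly_over_other_root[OF alg_field_Rats_self m nx] .
  have id: "fhom \<rat> (\<lambda>x. x)" by (simp add: fhom_def)
  obtain g1 where g1: "fhom (gen \<rat> {x}) g1" "g1 x = y"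
    using fhom_extend_simple[OF alg_field_Rats_self id m, of y] y(1) by auto
  have F: "alg_field (gen \<rat> {x})"
    using alg_field_algebraic[OF alg_E x] by (intro alg_field_gen[OF alg_field_Rats_self]) auto
  obtain g where g: "fhom (gen (gen \<rat> {x}) ?S) g" "\<And>z. z \<in> gen \<rat> {x} \<Longrightarrow> g z = g1 z"
    using fhom_extend[OF finite_roots F g1(1)] alg_field_algebraic[OF alg_E] roots_E by auto
  have "E \<subseteq> gen (gen \<rat> {x}) ?S"
    unfolding E_def using gen_base[of \<rat> "{x}"] gen_base[of "gen \<rat> {x}" ?S] gen_mem[of ?S "gen \<rat> {x}"]
    by (intro gen_minimal subrng_gen) auto
  then have "restrict g E \<in> G" by (intro restrict_G fhom_mono[OF g(1)])
  then have "g x = x" using fixed x by fastforce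
  moreover have "g x = y" using g(2)[of x] g1(2) gen_mem[of "{x}" \<rat>] by auto
  ultimately show False using y by simp
qed

lemma prod_invariant:
  assumes A: "finite A" "A \<subseteq> E" and g: "g \<in> G" "g ` A \<subseteq> A"
  shows "g (\<Prod>A) = \<Prod>A"
proof -
  have inj: "inj_on g A" using G_inj[OF g(1)] A(2) by (rule inj_on_subset)
  have "g (\<Prod>A) = (\<Prod>x\<in>A. g x)" using A by (intro fhom_prod[OF alg_E G_fhom[OF g(1)]]) auto
  also have "\<dots> = \<Prod>(g ` A)" by (simp add: prod.reindex[OF inj])
  also have "g ` A = A" by (rule endo_inj_surj[OF A(1) g(2) inj])
  finally show ?thesis .
qed

lemma translate_bij:
  assumes D: "D \<subseteq> G" "\<And>g h. g \<in> D \<Longrightarrow> h \<in> D \<Longrightarrow> compose E g h \<in> D" and g: "g \<in> D"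
  shows "bij_betw (compose E g) D D"
proof -
  have "inj_on (compose E g) D"
  proof (rule inj_onI)
    fix h h' assume h: "h \<in> D" "h' \<in> D" "compose E g h = compose E g h'"
    show "h = h'"
    proof (rule G_eqI)
      show "h \<in> G" "h' \<in> G" using h D by auto
      fix s assume "poly q s = 0"
      then have s: "s \<in> E" by (rule roots_E)
      have "g (h s) = g (h' s)" using fun_cong[OF h(3), of s] s by (simp add: compose_def)
      then show "h s = h' s"
        using inj_onD[OF G_inj[of g]] G_closed[OF _ s] h D g by blast
    qed
  qed
  moreover have "compose E g ` D \<subseteq> D" using D g by auto
  moreover have "finite D" using D(1) finite_G by (rule finite_subset)
  ultimately show ?thesis using endo_inj_surj by (metis bij_betw_def)
qed

text \<open>Left translation permutes the finite set \<open>D\<close>, hence the factors of the norm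
  of \<open>x\<close> along \<open>D\<close>.\<close>

lemma prod_translate:
  assumes D: "D \<subseteq> G" "\<And>g h. g \<in> D \<Longrightarrow> h \<in> D \<Longrightarrow> compose E g h \<in> D" and g: "g \<in> D" and x: "x \<in> E"
  shows "g (\<Prod>h\<in>D. h x) = (\<Prod>h\<in>D. h x)"
proof -
  have "g (\<Prod>h\<in>D. h x) = (\<Prod>h\<in>D. g (h x))"
    using D g x by (intro fhom_prod[OF alg_E G_fhom]) (auto intro: G_closed)
  also have "\<dots> = (\<Prod>h\<in>D. compose E g h x)" using x by (simp add: compose_def)
  also have "\<dots> = (\<Prod>h\<in>D. h x)"
    by (rule prod.reindex_bij_betw[OF translate_bij[OF D g], of "\<lambda>h. h x"])
  finally show ?thesis .
qed

end

section \<open>The decomposition group as stabiliser of an absolute value\<close>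

locale decomposition = splitting + absval
begin

definition \<Delta> where "\<Delta> = {g \<in> G. \<forall>x\<in>E. N (g x) = N x}"

lemma \<Delta>_G: "\<Delta> \<subseteq> G" and \<Delta>_N: "\<delta> \<in> \<Delta> \<Longrightarrow> x \<in> E \<Longrightarrow> N (\<delta> x) = N x"
  by (auto simp: \<Delta>_def)

lemma \<Delta>_closed: "\<delta> \<in> \<Delta> \<Longrightarrow> x \<in> E \<Longrightarrow> \<delta> x \<in> E"
  using \<Delta>_G G_closed by blast

lemma finite_\<Delta>: "finite \<Delta>" using \<Delta>_G finite_G by (rule finite_subset)

lemma \<Delta>_compose: "g \<in> \<Delta> \<Longrightarrow> h \<in> \<Delta> \<Longrightarrow> compose E g h \<in> \<Delta>"
  using G_compose G_closed by (auto simp: \<Delta>_def compose_def)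

lemma \<Delta>_id: "restrict (\<lambda>x. x) E \<in> \<Delta>"
  using G_id by (auto simp: \<Delta>_def)

lemma card_\<Delta>_pos: "card \<Delta> > 0"
  using \<Delta>_id finite_\<Delta> card_gt_0_iff by blast

lemma G_algebraic_int: "g \<in> G \<Longrightarrow> x \<in> E \<Longrightarrow> algebraic_int x \<Longrightarrow> algebraic_int (g x)"
  using fhom_algebraic_int[OF E G_fhom] .

lemma absval_G: "g \<in> G \<Longrightarrow> absval E (\<lambda>x. N (g x)) l"
  by (rule absval_comp[OF absval_axioms E G_fhom]) (auto intro: G_closed)

text \<open>\<open>absval_separate\<close> is applied to the distinct conjugates of
  \<open>N\<close>. The separating element of \<open>N\<close> is \<open>b\<close>; the sum of those
  of the other conjugates is \<open>a\<close>, since each other conjugate sees exactly one unit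
  among the summands and \<open>N\<close> sees none.\<close>

lemma separate:
  obtains a b where "a \<in> E" "algebraic_int a" "N a < 1" "\<And>g. g \<in> G - \<Delta> \<Longrightarrow> N (g a) = 1"
    "b \<in> E" "algebraic_int b" "N b = 1" "\<And>g. g \<in> G - \<Delta> \<Longrightarrow> N (g b) < 1"
proof -
  \<comment> \<open>Restriction makes absolute values that agree on \<open>E\<close> equal as
    functions, so that \<open>A\<close> lists each conjugate once.\<close>
  define r where "r g = restrict (\<lambda>x. N (g x)) E" for g
  define A where "A = r ` G"
  define \<nu>0 where "\<nu>0 = r (restrict (\<lambda>x. x) E)"
  have \<nu>0: "\<nu>0 \<in> A" "\<And>x. x \<in> E \<Longrightarrow> \<nu>0 x = N x"
    using imageI[OF G_id, of r] by (simp_all add: A_def \<nu>0_def) (simp add: r_def)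
  have fin: "finite A" by (simp add: A_def finite_G)
  have av: "absval E \<nu> l" if "\<nu> \<in> A" for \<nu>
    using that absval_restrict[OF absval_G] by (auto simp: A_def r_def)
  have ne: "\<nu> = \<nu>'" if "\<nu> \<in> A" "\<nu>' \<in> A" "\<And>x. x \<in> E \<Longrightarrow> \<nu> x = \<nu>' x" for \<nu> \<nu>'
    using that by (intro extensionalityI[of _ E]) (auto simp: A_def r_def)
  have "\<forall>\<nu>\<in>A. \<exists>c. c \<in> E \<and> algebraic_int c \<and> \<nu> c = 1 \<and> (\<forall>\<nu>'\<in>A - {\<nu>}. \<nu>' c < 1)"
    using absval_separate[OF fin av ne] by blast
  then obtain c where c: "\<And>\<nu>. \<nu> \<in> A \<Longrightarrow> c \<nu> \<in> E" "\<And>\<nu>. \<nu> \<in> A \<Longrightarrow> algebraic_int (c \<nu>)"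
    "\<And>\<nu>. \<nu> \<in> A \<Longrightarrow> \<nu> (c \<nu>) = 1" "\<And>\<nu> \<nu>'. \<nu> \<in> A \<Longrightarrow> \<nu>' \<in> A - {\<nu>} \<Longrightarrow> \<nu>' (c \<nu>) < 1"
    by metis
  define a where "a = (\<Sum>\<nu>\<in>A - {\<nu>0}. c \<nu>)"
  have rne: "r g \<in> A - {\<nu>0}" if g: "g \<in> G - \<Delta>" for g
  proof -
    obtain x where "x \<in> E" "N (g x) \<noteq> N x" using g by (auto simp: \<Delta>_def)
    then have "r g \<noteq> \<nu>0" using \<nu>0(2)[of x] by (auto simp: r_def)
    then show ?thesis using g by (auto simp: A_def)
  qed
  show ?thesis
  proof (rule that[of a "c \<nu>0"])
    show aE: "a \<in> E" unfolding a_def using c by (intro alg_field_sum[OF E]) auto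
    have "algebraic_int (\<Sum>\<nu>\<in>B. c \<nu>)" if "B \<subseteq> A" for B
      using that c by (induction B rule: infinite_finite_induct) (auto intro: algebraic_int_plus)
    then show "algebraic_int a" by (auto simp: a_def)
    show "N a < 1"
      unfolding a_def using c \<nu>0 by (intro N_sum_less) (auto simp flip: \<nu>0(2))
    show "N (g a) = 1" if g: "g \<in> G - \<Delta>" for g
    proof -
      interpret v: absval E "r g" l using av rne[OF g] by blast
      have "a = c (r g) + (\<Sum>\<nu>\<in>A - {\<nu>0} - {r g}. c \<nu>)"
        unfolding a_def using rne[OF g] fin by (simp add: sum.remove)
      moreover have "r g (\<Sum>\<nu>\<in>A - {\<nu>0} - {r g}. c \<nu>) < 1"
        using c rne[OF g] by (intro v.N_sum_less) auto
      moreover have "(\<Sum>\<nu>\<in>A - {\<nu>0} - {r g}. c \<nu>) \<in> E" using c by (intro alg_field_sum[OF E]) auto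
      ultimately have "r g a = 1"
        using v.N_add_eq[of "c (r g)" "\<Sum>\<nu>\<in>A - {\<nu>0} - {r g}. c \<nu>"] c(1,3)[of "r g"] rne[OF g] by simp
      then show ?thesis using aE by (simp add: r_def)
    qed
    show "c \<nu>0 \<in> E" "algebraic_int (c \<nu>0)" using c \<nu>0 by auto
    show "N (c \<nu>0) = 1" using c \<nu>0 by (auto simp flip: \<nu>0(2))
    show "N (g (c \<nu>0)) < 1" if g: "g \<in> G - \<Delta>" for g
      using c(4)[of \<nu>0 "r g"] \<nu>0(1) rne[OF g] c(1)[OF \<nu>0(1)] by (auto simp: r_def)
  qed
qed

lemma algebraic_int_prod_\<Delta>:
  assumes "x \<in> E" "algebraic_int x" shows "algebraic_int (\<Prod>\<delta>\<in>\<Delta>. \<delta> x)"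
proof -
  have "algebraic_int (\<Prod>\<delta>\<in>D. \<delta> x)" if "D \<subseteq> \<Delta>" for D
    using that assms G_algebraic_int \<Delta>_G
    by (induction D rule: infinite_finite_induct) (auto intro: algebraic_int_mult simp: int_imp_algebraic_int)
  then show ?thesis by simp
qed

lemma prod_\<Delta>_E: "x \<in> E \<Longrightarrow> (\<Prod>\<delta>\<in>\<Delta>. \<delta> x) \<in> E"
  by (rule alg_field_prod[OF E], rule \<Delta>_closed)

text \<open>Taking norms along \<open>\<Delta>\<close> makes the separating elements invariant. The
  values outside \<open>\<Delta>\<close> survive because a left coset of an element outside
  \<open>\<Delta>\<close> avoids \<open>\<Delta>\<close>.\<close>

lemma separate_fixed:
  obtains a b where "a \<in> E" "algebraic_int a" "N a < 1" "\<And>g. g \<in> G - \<Delta> \<Longrightarrow> N (g a) = 1"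
    "b \<in> E" "algebraic_int b" "N b = 1" "\<And>g. g \<in> G - \<Delta> \<Longrightarrow> N (g b) < 1"
    "\<And>\<delta>. \<delta> \<in> \<Delta> \<Longrightarrow> \<delta> a = a" "\<And>\<delta>. \<delta> \<in> \<Delta> \<Longrightarrow> \<delta> b = b"
proof -
  obtain a b where a: "a \<in> E" "algebraic_int a" "N a < 1" "\<And>g. g \<in> G - \<Delta> \<Longrightarrow> N (g a) = 1"
    and b: "b \<in> E" "algebraic_int b" "N b = 1" "\<And>g. g \<in> G - \<Delta> \<Longrightarrow> N (g b) < 1"
    by (rule separate, rule that)
  have g\<delta>: "compose E g \<delta> \<in> G - \<Delta>" if g: "g \<in> G - \<Delta>" and \<delta>: "\<delta> \<in> \<Delta>" for g \<delta>
  proof -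
    have "compose E g \<delta> \<notin> \<Delta>"
    proof
      assume *: "compose E g \<delta> \<in> \<Delta>"
      have "N (g y) = N y" if "y \<in> E" for y
      proof -
        have "y \<in> \<delta> ` E" using fhom_image[OF G_fhom] \<delta> \<Delta>_G that by blast
        then obtain x where "x \<in> E" "y = \<delta> x" by blast
        then show ?thesis using \<Delta>_N[OF *, of x] \<Delta>_N[OF \<delta>, of x] by (simp add: compose_def)
      qed
      then show False using g by (auto simp: \<Delta>_def)
    qed
    then show ?thesis using G_compose g \<delta> \<Delta>_G by blast
  qed
  have gprod: "N (g (\<Prod>\<delta>\<in>\<Delta>. \<delta> x)) = (\<Prod>\<delta>\<in>\<Delta>. N (compose E g \<delta> x))" if "x \<in> E" "g \<in> G" for x g
  proof -
    have "g (\<Prod>\<delta>\<in>\<Delta>. \<delta> x) = (\<Prod>\<delta>\<in>\<Delta>. g (\<delta> x))"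
      by (rule fhom_prod[OF E G_fhom[OF that(2)] \<Delta>_closed[OF _ that(1)]])
    also have "N \<dots> = (\<Prod>\<delta>\<in>\<Delta>. N (g (\<delta> x)))"
      by (rule N_prod[OF G_closed[OF that(2) \<Delta>_closed[OF _ that(1)]]])
    finally show ?thesis using that by (simp add: compose_def)
  qed
  have N\<Delta>: "N (\<Prod>\<delta>\<in>\<Delta>. \<delta> x) = N x ^ card \<Delta>" if "x \<in> E" for x
    using N_prod[of \<Delta> "\<lambda>\<delta>. \<delta> x"] \<Delta>_closed \<Delta>_N that by simp
  show ?thesis
  proof (rule that[of "\<Prod>\<delta>\<in>\<Delta>. \<delta> a" "\<Prod>\<delta>\<in>\<Delta>. \<delta> b"])
    show "N (\<Prod>\<delta>\<in>\<Delta>. \<delta> a) < 1" using N\<Delta>[OF a(1)] a(3) card_\<Delta>_pos N_nonneg[OF a(1)] by (simp add: power_less_one_iff)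
    show "N (\<Prod>\<delta>\<in>\<Delta>. \<delta> b) = 1" using N\<Delta>[OF b(1)] b(3) by simp
    show "N (g (\<Prod>\<delta>\<in>\<Delta>. \<delta> a)) = 1" if g: "g \<in> G - \<Delta>" for g
      using gprod[OF a(1)] g a(4)[OF g\<delta>[OF g]] by simp
    show "N (g (\<Prod>\<delta>\<in>\<Delta>. \<delta> b)) < 1" if g: "g \<in> G - \<Delta>" for g
    proof -
      have "N (g (\<Prod>\<delta>\<in>\<Delta>. \<delta> b)) = N (compose E g (restrict (\<lambda>x. x) E) b) * (\<Prod>\<delta>\<in>\<Delta> - {restrict (\<lambda>x. x) E}. N (compose E g \<delta> b))"
        using gprod[OF b(1)] g finite_\<Delta> \<Delta>_id by (simp add: prod.remove)
      also have "\<dots> \<le> N (compose E g (restrict (\<lambda>x. x) E) b) * 1"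
      proof (intro mult_left_mono prod_le_1)
        fix \<delta> assume "\<delta> \<in> \<Delta> - {restrict (\<lambda>x. x) E}"
        then have "compose E g \<delta> \<in> G - \<Delta>" using g\<delta>[OF g] by blast
        then show "0 \<le> N (compose E g \<delta> b) \<and> N (compose E g \<delta> b) \<le> 1"
          using b(4)[of "compose E g \<delta>"] N_nonneg[OF G_closed[OF _ b(1)]] by force
      next
        show "0 \<le> N (compose E g (restrict (\<lambda>x. x) E) b)"
          using g\<delta>[OF g \<Delta>_id] N_nonneg[OF G_closed[OF _ b(1)]] by blast
      qed
      also have "\<dots> < 1" using b(4)[OF g\<delta>[OF g \<Delta>_id]] by simp
      finally show ?thesis .
    qed
    show "\<delta> (\<Prod>\<delta>\<in>\<Delta>. \<delta> a) = (\<Prod>\<delta>\<in>\<Delta>. \<delta> a)" "\<delta> (\<Prod>\<delta>\<in>\<Delta>. \<delta> b) = (\<Prod>\<delta>\<in>\<Delta>. \<delta> b)" if "\<delta> \<in> \<Delta>" for \<delta>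
      using prod_translate[OF \<Delta>_G \<Delta>_compose that] a(1) b(1) by auto
  qed (use a b algebraic_int_prod_\<Delta> prod_\<Delta>_E in auto)
qed

text \<open>The decomposition field has value group \<open>l\<^sup>\<int>\<close>: multiply an element that is a unit at all other conjugates over its orbit.\<close>

lemma decomposition_field_value_int:
  assumes z: "z \<in> E" "z \<noteq> 0" "\<And>\<delta>. \<delta> \<in> \<Delta> \<Longrightarrow> \<delta> z = z" "algebraic_int z" "N z < 1"
  shows "\<exists>k. N z = real l powi k"
proof -
  obtain a b where a: "a \<in> E" "algebraic_int a" "N a < 1" "\<And>g. g \<in> G - \<Delta> \<Longrightarrow> N (g a) = 1"
    and b: "b \<in> E" "algebraic_int b" "N b = 1" "\<And>g. g \<in> G - \<Delta> \<Longrightarrow> N (g b) < 1"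
    and fixed: "\<And>\<delta>. \<delta> \<in> \<Delta> \<Longrightarrow> \<delta> a = a" "\<And>\<delta>. \<delta> \<in> \<Delta> \<Longrightarrow> \<delta> b = b"
    by (rule separate_fixed, rule that)
  obtain k where k: "N a ^ k < N z"
    using real_arch_pow_inv[OF N_pos[OF z(1,2)] a(3)] by blast
  \<comment> \<open>At \<open>N\<close> the power of \<open>a\<close> is smaller than z, so y has
    the value of z; at the conjugates outside \<open>\<Delta>\<close> the power is a unit and
    \<open>b\<close> makes the other term small.\<close>
  define y where "y = a ^ k + b * z"
  have ak: "a ^ k \<in> E" and bz: "b * z \<in> E"
    using a b z by (auto intro: alg_field_pow[OF E] alg_field_mult[OF E])
  have y: "y \<in> E" unfolding y_def by (intro alg_field_add[OF E] ak bz)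
  have "N (b * z) = N z" using N_mult[OF b(1) z(1)] b(3) by simp
  then have Ny: "N y = N z"
    using N_add_eq[OF bz ak] k N_pow[OF a(1)] by (simp add: y_def add.commute)
  have gy: "N (g y) = 1" if g: "g \<in> G - \<Delta>" for g
  proof -
    have gG: "g \<in> G" using g by blast
    note h = fhom_add[OF E G_fhom[OF gG]] fhom_mult[OF E G_fhom[OF gG]] fhom_pow[OF E G_fhom[OF gG]]
    have "g y = g a ^ k + g b * g z" unfolding y_def using h ak bz a b z by simp
    moreover have "N (g a ^ k) = 1" using N_pow[OF G_closed[OF gG a(1)]] a(4)[OF g] by simp
    moreover have "N (g b * g z) < 1"
    proof -
      have "N (g b * g z) = N (g b) * N (g z)" using N_mult G_closed[OF gG] b z by simp
      also have "\<dots> \<le> N (g b) * 1"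
        using N_nonneg N_int G_algebraic_int[OF gG z(1,4)] G_closed[OF gG] b z by (intro mult_left_mono) auto
      finally show ?thesis using b(4)[OF g] by simp
    qed
    moreover have "g a ^ k \<in> E" "g b * g z \<in> E"
      using G_closed[OF gG] a b z by (auto intro: alg_field_pow[OF E] alg_field_mult[OF E])
    ultimately show ?thesis using N_add_eq[of "g a ^ k" "g b * g z"] by simp
  qed
  have \<delta>y: "\<delta> y = y" if "\<delta> \<in> \<Delta>" for \<delta>
  proof -
    have dG: "fhom E \<delta>" using that \<Delta>_G G_fhom by blast
    show ?thesis unfolding y_def
      using fhom_add[OF E dG ak bz] fhom_mult[OF E dG b(1) z(1)] fhom_pow[OF E dG a(1)] fixed[OF that] z(3)[OF that]
      by simp
  qed
  \<comment> \<open>The orbit is taken as a set: y, being fixed by \<open>\<Delta>\<close>, occurs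
    once, and all other members have value 1. So the rational number \<open>\<Prod>Y\<close> has the
    value of z.\<close>
  define Y where "Y = (\<lambda>g. g y) ` G"
  have Y: "finite Y" "Y \<subseteq> E" using finite_G y G_closed by (auto simp: Y_def)
  have "\<Prod>Y \<in> \<rat>"
  proof (rule fixed_Rats)
    show "\<Prod>Y \<in> E" using Y by (intro alg_field_prod[OF E]) auto
    show "g (\<Prod>Y) = \<Prod>Y" if g: "g \<in> G" for g
    proof (rule prod_invariant[OF Y g])
      show "g ` Y \<subseteq> Y"
      proof
        fix x assume "x \<in> g ` Y"
        then obtain h where "h \<in> G" "x = g (h y)" by (auto simp: Y_def)
        then have "x = compose E g h y" "compose E g h \<in> G" using y G_compose[OF g] by (auto simp: compose_def)
        then show "x \<in> Y" by (auto simp: Y_def)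
      qed
    qed
  qed
  have yY: "y \<in> Y" using G_id y by (auto simp: Y_def image_iff intro!: bexI[of _ "restrict (\<lambda>x. x) E"])
  have "N x = 1" if x: "x \<in> Y - {y}" for x
  proof -
    obtain g where g: "g \<in> G" "x = g y" using x by (auto simp: Y_def)
    then have "g \<notin> \<Delta>" using \<delta>y x by auto
    then show ?thesis using gy g by auto
  qed
  then have "(\<Prod>x\<in>Y. N x) = N y" using Y(1) yY by (simp add: prod.remove)
  then have NY: "N (\<Prod>Y) = N z" using N_prod[of Y "\<lambda>x. x"] Y(2) Ny by auto
  then have "\<Prod>Y \<noteq> 0" using N_pos[OF z(1,2)] N_0 by auto
  then show ?thesis using N_Rats_value[OF \<open>\<Prod>Y \<in> \<rat>\<close>] NY by simp
qed

lemma decomposition_field_value: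
  assumes z: "z \<in> E" "z \<noteq> 0" "\<And>\<delta>. \<delta> \<in> \<Delta> \<Longrightarrow> \<delta> z = z"
  shows "\<exists>k. N z = real l powi k"
proof -
  obtain n where n: "n \<noteq> 0" "algebraic_int (of_int n * z)"
    using alg_field_algebraic[OF E z(1)] by (auto simp: algebraic_iff_int_multiple)
  \<comment> \<open>The factor n clears denominators and the factor l brings the value below
    1.\<close>
  define m where "m = int l * n"
  have l0: "l > 0" using l_gt_1 by simp
  have m: "m \<noteq> 0" "of_int m \<in> E" using n l0 by (auto simp: m_def alg_field_of_int[OF E] simp del: of_int_mult)
  have nz: "of_int n * z \<in> E" using z by (intro alg_field_mult[OF E] alg_field_of_int[OF E])
  have mz: "of_int m * z = of_nat l * (of_int n * z)" by (simp add: m_def)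
  have "N (of_int m * z) = inverse (real l) * N (of_int n * z)"
    unfolding mz using N_mult[OF alg_field_of_nat[OF E] nz] N_l by simp
  also have "\<dots> \<le> inverse (real l) * 1" using N_int[OF nz n(2)] by (intro mult_left_mono) auto
  also have "\<dots> < 1" using l_gt_1 by (simp add: field_simps)
  finally have lt: "N (of_int m * z) < 1" .
  have "algebraic_int (of_int m * z)"
    unfolding mz by (intro algebraic_int_mult n int_imp_algebraic_int) simp
  moreover have "\<delta> (of_int m * z) = of_int m * z" if "\<delta> \<in> \<Delta>" for \<delta>
  proof -
    have dG: "fhom E \<delta>" using that \<Delta>_G G_fhom by blast
    show ?thesis using fhom_mult[OF E dG m(2) z(1)] fhom_Rats[OF E dG, of "of_int m"] z(3)[OF that] by simp
  qed
  ultimately obtain k where "N (of_int m * z) = real l powi k"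
    using decomposition_field_value_int[of "of_int m * z"] m z lt alg_field_mult[OF E] by auto
  moreover obtain j where j: "N (of_int m) = real l powi j" using N_of_int_value[OF m(1)] by blast
  ultimately have "N z = real l powi (k - j)"
    using N_mult[OF m(2) z(1)] l_gt_1 by (simp add: power_int_diff field_simps)
  then show ?thesis by blast
qed

text \<open>The norm of \<open>x\<close> along \<open>\<Delta>\<close> lies in the decomposition
  field, whose values are powers of \<open>l\<close>. Thus an element of fractional value forces
  divisibility of the order of \<open>\<Delta>\<close>.\<close>

lemma value_power_card_\<Delta>:
  assumes x: "x \<in> E" "x \<noteq> 0"
  shows "\<exists>k. N x ^ card \<Delta> = real l powi k"
proof -
  have "N (\<Prod>\<delta>\<in>\<Delta>. \<delta> x) = N x ^ card \<Delta>"
    using N_prod[of \<Delta> "\<lambda>\<delta>. \<delta> x"] \<Delta>_closed \<Delta>_N x by simp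
  moreover have "(\<Prod>\<delta>\<in>\<Delta>. \<delta> x) \<noteq> 0"
    using x finite_\<Delta> fhom_eq_0[OF E G_fhom] \<Delta>_G by auto
  ultimately show ?thesis
    using decomposition_field_value[OF prod_\<Delta>_E[OF x(1)]] prod_translate[OF \<Delta>_G \<Delta>_compose _ x(1)] by metis
qed

end

lemma power_int_inj_real:
  fixes a :: real assumes "a > 1" "a powi i = a powi j" shows "i = j"
  using power_int_strict_increasing[of i j a] power_int_strict_increasing[of j i a] assms
  by (cases i j rule: linorder_cases) auto

context decomposition
begin

text \<open>
  If the decomposition group is as small as the ramification index, then it acts trivially on the
  residue field: Lagrange interpolation through the conjugates of a uniformizer expresses every
  element as a polynomial in it with coefficients in the decomposition field, and the terms
  of this polynomial have pairwise different absolute values.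
\<close>

lemma totally_ramified_residue:
  assumes \<rho>: "\<rho> \<in> E" "N \<rho> ^ card \<Delta> = inverse (real l)"
    and y: "y \<in> E" "N y \<le> 1" and \<delta>: "\<delta> \<in> \<Delta>"
  shows "N (\<delta> y - y) < 1"
proof -
  define e where "e = card \<Delta>"
  have e: "e > 0" using card_\<Delta>_pos by (simp add: e_def)
  have l0: "real l > 1" by (rule l_gt_1)
  have \<rho>0: "\<rho> \<noteq> 0" using \<rho> l0 e N_0 by (auto simp: e_def power_0_left split: if_splits)
  have Ne: "N \<rho> ^ e = real l powi (- 1)" using \<rho>(2) by (simp add: e_def power_int_minus)
  \<comment> \<open>The product of the orbit lies in the decomposition field and has the value of
    \<open>\<rho>\<close> to the power of the orbit length. Integrality of its exponent makes that
    length a multiple of \<open>e\<close>, so all conjugates of \<open>\<rho>\<close> are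
    distinct.\<close>
  define Ob where "Ob = (\<lambda>\<delta>. \<delta> \<rho>) ` \<Delta>"
  have Ob: "finite Ob" "Ob \<subseteq> E" using finite_\<Delta> \<rho>(1) \<Delta>_closed by (auto simp: Ob_def)
  have NOb: "N x = N \<rho>" if "x \<in> Ob" for x using that \<Delta>_N \<rho>(1) by (auto simp: Ob_def)
  have "\<eta> (\<Prod>Ob) = \<Prod>Ob" if \<eta>: "\<eta> \<in> \<Delta>" for \<eta>
  proof (rule prod_invariant[OF Ob])
    show "\<eta> \<in> G" using \<eta> \<Delta>_G by blast
    show "\<eta> ` Ob \<subseteq> Ob"
    proof
      fix x assume "x \<in> \<eta> ` Ob"
      then obtain h where "h \<in> \<Delta>" "x = \<eta> (h \<rho>)" by (auto simp: Ob_def)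
      then have "x = compose E \<eta> h \<rho>" "compose E \<eta> h \<in> \<Delta>" using \<rho>(1) \<Delta>_compose[OF \<eta>] by (auto simp: compose_def)
      then show "x \<in> Ob" by (auto simp: Ob_def)
    qed
  qed
  moreover have "\<Prod>Ob \<noteq> 0"
  proof
    assume "\<Prod>Ob = 0"
    then obtain x where "x \<in> Ob" "x = 0" using Ob by (auto simp: prod_zero_iff)
    then show False using NOb[of x] N_0 N_pos[OF \<rho>(1) \<rho>0] by simp
  qed
  moreover have "\<Prod>Ob \<in> E" using Ob by (intro alg_field_prod[OF E]) auto
  ultimately obtain k where "N (\<Prod>Ob) = real l powi k" using decomposition_field_value by blast
  moreover have "N (\<Prod>Ob) = N \<rho> ^ card Ob"
    using N_prod[of Ob "\<lambda>x. x"] Ob NOb by auto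
  ultimately have "(real l powi k) ^ e = (N \<rho> ^ card Ob) ^ e" by simp
  also have "\<dots> = (N \<rho> ^ e) ^ card Ob" by (simp add: mult.commute flip: power_mult)
  finally have "(real l powi k) ^ e = (N \<rho> ^ e) ^ card Ob" .
  then have "real l powi (k * int e) = real l powi (- int (card Ob))"
    unfolding Ne by (simp add: power_int_mult power_int_minus power_inverse)
  then have "k * int e = - int (card Ob)" by (rule power_int_inj_real[OF l0])
  then have "int e dvd int (card Ob)" by (metis dvd_minus_iff dvd_triv_right)
  then have "e dvd card Ob" by simp
  moreover have "card Ob > 0" using Ob \<Delta>_id by (auto simp: card_gt_0_iff Ob_def)
  moreover have "card Ob \<le> e" unfolding Ob_def e_def by (rule card_image_le[OF finite_\<Delta>])
  ultimately have cO: "card Ob = e" by (meson dvd_imp_le le_antisym)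
  then have inj: "inj_on (\<lambda>\<delta>. \<delta> \<rho>) \<Delta>"
    using eq_card_imp_inj_on[OF finite_\<Delta>, of "\<lambda>\<delta>. \<delta> \<rho>"] by (simp add: Ob_def e_def)
  obtain Y where Y: "\<And>j. coeff Y j \<in> E" "Y = 0 \<or> degree Y < e" "\<And>\<delta>. \<delta> \<in> \<Delta> \<Longrightarrow> poly Y (\<delta> \<rho>) = \<delta> y"
    using interpolation[OF E finite_\<Delta> inj, of "\<lambda>\<delta>. \<delta> y"] \<Delta>_closed \<rho>(1) y(1) unfolding e_def by blast
  have dY: "degree Y < e" using Y(2) e by auto
  \<comment> \<open>The transported polynomial interpolates the same values at the same nodes, hence
    is the same polynomial.\<close>
  have fixY: "\<eta> (coeff Y j) = coeff Y j" if \<eta>: "\<eta> \<in> \<Delta>" for \<eta> j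
  proof -
    have \<eta>h: "fhom E \<eta>" using \<eta> \<Delta>_G G_fhom by blast
    have "map_poly \<eta> Y = Y"
    proof (rule poly_eqI_degree[of Ob])
      show "card Ob > degree (map_poly \<eta> Y)" "card Ob > degree Y"
        using dY cO map_poly_degree_leq[of \<eta> Y] by auto
      fix x assume "x \<in> Ob"
      then obtain h where h: "h \<in> \<Delta>" "x = h \<rho>" by (auto simp: Ob_def)
      obtain h' where h': "h' \<in> \<Delta>" "h = compose E \<eta> h'"
        using translate_bij[OF \<Delta>_G \<Delta>_compose \<eta>] h(1) by (auto simp: bij_betw_def)
      have x: "x = \<eta> (h' \<rho>)" using h h' \<rho>(1) by (simp add: compose_def)
      have "poly (map_poly \<eta> Y) x = \<eta> (poly Y (h' \<rho>))"
        unfolding x using fhom_poly[OF E \<eta>h Y(1) \<Delta>_closed[OF h'(1) \<rho>(1)]] by simp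
      also have "\<dots> = h y" using Y(3)[OF h'(1)] h' y(1) by (simp add: compose_def)
      also have "\<dots> = poly Y x" using Y(3)[OF h(1)] h(2) by simp
      finally show "poly (map_poly \<eta> Y) x = poly Y x" .
    qed
    then show ?thesis using coeff_map_poly[of \<eta> Y j] fhom_0[OF E \<eta>h] by simp
  qed
  define T where "T j = coeff Y j * \<rho> ^ j" for j
  have TE: "T j \<in> E" for j unfolding T_def by (intro alg_field_mult[OF E] alg_field_pow[OF E] Y \<rho>)
  have "y = poly Y \<rho>" using Y(3)[OF \<Delta>_id] \<rho>(1) y(1) by simp
  then have yT: "y = (\<Sum>j\<le>degree Y. T j)" by (simp add: poly_altdef T_def)
  \<comment> \<open>The exponent is - j modulo \<open>e\<close>. Hence nonzero terms with different
    j < e have different values, and among them only the term j = 0 can have value 1.\<close>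
  have val: "\<exists>k. N (T j) ^ e = real l powi (int e * k - int j)" if "T j \<noteq> 0" for j
  proof -
    have nz: "coeff Y j \<noteq> 0" using that by (auto simp: T_def)
    have "\<exists>k. N (coeff Y j) = real l powi k"
      by (rule decomposition_field_value) (use Y(1) nz fixY in auto)
    then obtain k where k: "N (coeff Y j) = real l powi k" by blast
    have "N (T j) ^ e = (real l powi k) ^ e * (N \<rho> ^ e) ^ j"
      unfolding T_def using Y(1) \<rho>(1) k
      by (simp add: N_mult N_pow alg_field_pow[OF E] power_mult_distrib mult.commute flip: power_mult)
    also have "\<dots> = real l powi (int e * k - int j)"
      unfolding Ne using l0 by (simp add: power_int_mult power_int_diff power_int_minus power_inverse field_simps mult.commute[of "int e"])
    finally show ?thesis by blast
  qed
  have mod_eq: "i = j" if *: "N (T i) = N (T j)" "T i \<noteq> 0" "T j \<noteq> 0" "i < e" "j < e" for i j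
  proof -
    obtain k k' where "real l powi (int e * k - int i) = real l powi (int e * k' - int j)"
      using val[OF *(2)] val[OF *(3)] *(1) by metis
    then have "int e * k - int i = int e * k' - int j" by (rule power_int_inj_real[OF l0])
    then have "int i - int j = int e * (k - k')" by (simp add: algebra_simps)
    then have "int i mod int e = int j mod int e" by (metis mod_eq_dvd_iff dvd_triv_left)
    then show "i = j" using *(4,5) by simp
  qed
  have ne1: "N (T j) \<noteq> 1" if *: "T j \<noteq> 0" "0 < j" "j < e" for j
  proof
    assume "N (T j) = 1"
    then obtain k where "real l powi (int e * k - int j) = real l powi 0" using val[OF *(1)] by auto
    then have "int e * k - int j = 0" by (rule power_int_inj_real[OF l0])
    then have "int e dvd int j" by (metis dvd_triv_left eq_iff_diff_eq_0)
    then show False using *(2,3) by (auto dest: dvd_imp_le)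
  qed
  define J where "J = {j. j \<le> degree Y \<and> T j \<noteq> 0}"
  have J: "finite J" "\<And>j. j \<in> J \<Longrightarrow> j < e" using dY by (auto simp: J_def)
  have yJ: "y = sum T J"
    unfolding yT by (intro sum.mono_neutral_right) (auto simp: J_def)
  have le: "N (T j) \<le> N y" if "j \<in> J" for j
  proof -
    have "Max ((\<lambda>j. N (T j)) ` J) \<in> (\<lambda>j. N (T j)) ` J" using J(1) that by (intro Max_in) auto
    then obtain i where i: "i \<in> J" "Max ((\<lambda>j. N (T j)) ` J) = N (T i)" by auto
    have max: "N (T j) \<le> N (T i)" if "j \<in> J" for j
      unfolding i(2)[symmetric] using J(1) that by (intro Max_ge) auto
    have "N (T i) > 0" using i(1) by (auto simp: J_def intro!: N_pos TE)
    moreover have "N (T j) < N (T i)" if "j \<in> J - {i}" for j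
      using max[of j] mod_eq[of j i] that i(1) J(2) by (force simp: J_def)
    ultimately have "N (sum T (J - {i})) < N (T i)" using TE by (intro N_sum_less) auto
    then have "N (T i + sum T (J - {i})) = N (T i)"
      using TE by (intro N_add_eq alg_field_sum[OF E]) auto
    then have "N y = N (T i)" using yJ i(1) J(1) by (simp add: sum.remove)
    then show ?thesis using max[OF that] by simp
  qed
  have "N (T j) < 1" if "j \<in> J - {0}" for j
    using le[of j] y(2) ne1[of j] J(2)[of j] that by (force simp: J_def)
  then have lt: "N (sum T (J - {0})) < 1" using TE by (intro N_sum_less) auto
  \<comment> \<open>The constant term lies in the decomposition field, so the automorphism moves
    only this remainder, which has value below 1.\<close>
  define w where "w = y - T 0"
  have "T 0 + sum T (J - {0}) = y"
  proof (cases "0 \<in> J")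
    case True
    then show ?thesis using yJ J(1) by (simp add: sum.remove)
  next
    case False
    then show ?thesis using yJ by (simp add: J_def)
  qed
  then have "w = sum T (J - {0})" by (simp add: w_def algebra_simps)
  then have w: "N w < 1" "w \<in> E" using lt TE by (auto intro: alg_field_sum[OF E])
  have \<delta>h: "fhom E \<delta>" using \<delta> \<Delta>_G G_fhom by blast
  have "\<delta> w = \<delta> y - T 0"
    using fhom_diff[OF E \<delta>h y(1) TE[of 0]] fixY[OF \<delta>, of 0] by (simp add: w_def T_def)
  then have "\<delta> y - y = \<delta> w - w" by (simp add: w_def)
  moreover have "N (\<delta> w - w) \<le> max (N (\<delta> w)) (N w)" using w \<Delta>_closed[OF \<delta>] by (intro N_diff) auto
  ultimately show ?thesis using \<Delta>_N[OF \<delta> w(2)] w(1) by simp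
qed

end

section \<open>Approximation by real-rooted polynomials\<close>

text \<open>
  The integer polynomial with the widely spaced roots \<open>0, M, \<dots>, (n - 1) M\<close> keeps its sign changes
  when a fixed polynomial of smaller degree is added.
\<close>

lemma sign_alternation_bound:
  fixes r :: "real poly" and n :: nat
  assumes n: "n > 0" and r: "\<And>i. i \<ge> n \<Longrightarrow> coeff r i = 0"
    and M: "M \<ge> 1" "M > (\<Sum>i<n. \<bar>coeff r i\<bar>) * 2 ^ n * real n ^ (n - 1)"
  shows "\<exists>A. card A = n \<and> finite A \<and> (\<forall>x\<in>A. poly ((\<Prod>j<n. [:- (M * real j), 1:]) + r) x = 0)"
proof -
  define P where "P = (\<Prod>j<n. [:- (M * real j), 1:])"
  \<comment> \<open>The midpoints between consecutive roots. There every factor has absolute value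
    at least M/2, so the product is at least (M/2)^n, while the perturbation grows only like
    M^(n-1).\<close>
  define t where "t k = M * (real k - 1 / 2)" for k
  \<comment> \<open>The sign of the product at the midpoint \<open>t k\<close>.\<close>
  define sg where "sg k = (\<Prod>j<n. if j < k then 1 else - 1 :: real)" for k
  have sg1: "\<bar>sg k\<bar> = 1" for k
    unfolding sg_def abs_prod by (intro prod.neutral) auto
  have sg_Suc: "sg k * sg (Suc k) = - 1" if "k < n" for k
  proof -
    have "sg k * sg (Suc k) = (\<Prod>j<n. if j = k then - 1 else 1)"
      unfolding sg_def prod.distrib[symmetric] by (intro prod.cong) auto
    then show ?thesis using that by (simp add: prod.delta)
  qed
  have Pt: "sg k * poly P (t k) \<ge> M ^ n * (1 / 2) ^ n" for k
  proof -
    have "sg k * poly P (t k) = (\<Prod>j<n. (if j < k then 1 else - 1) * (M * (real k - real j - 1 / 2)))"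
      unfolding sg_def P_def poly_prod prod.distrib[symmetric]
      by (intro prod.cong) (auto simp: t_def algebra_simps)
    also have "\<dots> \<ge> (\<Prod>j<n. M * (1 / 2))"
    proof (intro prod_mono conjI)
      fix j
      show "M * (1 / 2) \<le> (if j < k then 1 else - 1) * (M * (real k - real j - 1 / 2))"
      proof (cases "j < k")
        case True
        then have "real k - real j \<ge> 1" by linarith
        then have "M * (1 / 2) \<le> M * (real k - real j - 1 / 2)" using M(1) by (intro mult_left_mono) auto
        then show ?thesis using True by simp
      next
        case False
        then have "M * (1 / 2) \<le> M * (1 / 2 - (real k - real j))" using M(1) by (intro mult_left_mono) auto
        then show ?thesis using False by (simp add: algebra_simps)
      qed
    qed (use M in auto)
    finally show ?thesis by (simp add: power_mult_distrib power_divide)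
  qed
  have rt: "\<bar>poly r (t k)\<bar> < M ^ n * (1 / 2) ^ n" if k: "k \<le> n" for k
  proof -
    have Mn: "M * real n \<ge> 1" using M(1) n by (simp add: mult_ge1_I)
    have tk: "\<bar>t k\<bar> \<le> M * real n"
    proof -
      have "\<bar>real k - 1 / 2\<bar> \<le> real n" using k n by (auto simp: abs_if)
      then show ?thesis using M(1) by (simp add: t_def abs_mult mult_left_mono)
    qed
    have "poly r (t k) = (\<Sum>i<n. coeff r i * t k ^ i)"
    proof -
      have "poly r (t k) = (\<Sum>i\<le>max n (degree r). coeff r i * t k ^ i)"
        unfolding poly_altdef by (intro sum.mono_neutral_left) (auto simp: coeff_eq_0)
      also have "\<dots> = (\<Sum>i<n. coeff r i * t k ^ i)"
        using r by (intro sum.mono_neutral_right) auto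
      finally show ?thesis .
    qed
    also have "\<bar>\<dots>\<bar> \<le> (\<Sum>i<n. \<bar>coeff r i\<bar> * (M * real n) ^ (n - 1))"
    proof (rule order_trans[OF sum_abs], rule sum_mono)
      fix i assume "i \<in> {..<n}"
      have "\<bar>t k\<bar> ^ i \<le> (M * real n) ^ i" using tk by (intro power_mono) auto
      also have "\<dots> \<le> (M * real n) ^ (n - 1)" using Mn \<open>i \<in> _\<close> by (intro power_increasing) auto
      finally show "\<bar>coeff r i * t k ^ i\<bar> \<le> \<bar>coeff r i\<bar> * (M * real n) ^ (n - 1)"
        by (simp add: abs_mult power_abs mult_left_mono)
    qed
    also have "\<dots> = (\<Sum>i<n. \<bar>coeff r i\<bar>) * real n ^ (n - 1) * M ^ (n - 1)"
      by (simp add: power_mult_distrib flip: sum_distrib_right)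
    also have "\<dots> < M * (1 / 2) ^ n * M ^ (n - 1)"
    proof (rule mult_strict_right_mono)
      have "(\<Sum>i<n. \<bar>coeff r i\<bar>) * real n ^ (n - 1) * 2 ^ n * (1 / 2) ^ n < M * (1 / 2) ^ n"
        using M(2) by (intro mult_strict_right_mono) (auto simp: algebra_simps)
      then show "(\<Sum>i<n. \<bar>coeff r i\<bar>) * real n ^ (n - 1) < M * (1 / 2) ^ n"
        by (simp add: power_divide mult.assoc)
    qed (use M in auto)
    also have "\<dots> = M ^ n * (1 / 2) ^ n" using n by (cases n) auto
    finally show ?thesis .
  qed
  have pos: "sg k * poly (P + r) (t k) > 0" if "k \<le> n" for k
  proof -
    have "\<bar>sg k * poly r (t k)\<bar> < M ^ n * (1 / 2) ^ n" using rt[OF that] sg1[of k] by (simp add: abs_mult)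
    then show ?thesis using Pt[of k] by (simp add: distrib_left)
  qed
  have "\<exists>x. t k < x \<and> x < t (Suc k) \<and> poly (P + r) x = 0" if k: "k < n" for k
  proof -
    have "t k < t (Suc k)" using M(1) by (simp add: t_def)
    moreover have "poly (P + r) (t k) * poly (P + r) (t (Suc k)) < 0"
    proof -
      have "0 < (sg k * poly (P + r) (t k)) * (sg (Suc k) * poly (P + r) (t (Suc k)))"
        using pos[of k] pos[of "Suc k"] k by simp
      also have "\<dots> = (sg k * sg (Suc k)) * (poly (P + r) (t k) * poly (P + r) (t (Suc k)))" by (simp only: mult_ac)
      finally show ?thesis using sg_Suc[OF k] by simp
    qed
    ultimately show ?thesis using poly_IVT[of "t k" "t (Suc k)" "P + r"] by blast
  qed
  then obtain x where x: "\<And>k. k < n \<Longrightarrow> t k < x k \<and> x k < t (Suc k) \<and> poly (P + r) (x k) = 0" by metis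
  have tm: "t i \<le> t j" if "i \<le> j" for i j using that M(1) by (simp add: t_def)
  have lt: "x i < x j" if "i < j" "j < n" for i j
    using x[of i] x[of j] tm[of "Suc i" j] that by fastforce
  have "inj_on x {..<n}"
  proof (rule inj_onI)
    fix i j assume "i \<in> {..<n}" "j \<in> {..<n}" "x i = x j"
    then show "i = j" using lt[of i j] lt[of j i] by (cases i j rule: linorder_cases) auto
  qed
  then show ?thesis
    using x by (intro exI[of _ "x ` {..<n}"]) (auto simp: card_image P_def)
qed

lemma map_poly_of_int:
  shows map_poly_of_int_add: "map_poly of_int (a + b) = (map_poly of_int a + map_poly of_int b :: 'a::comm_ring_1 poly)"
    and map_poly_of_int_diff: "map_poly of_int (a - b) = (map_poly of_int a - map_poly of_int b :: 'a::comm_ring_1 poly)"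
    and map_poly_of_int_mult: "map_poly of_int (a * b) = (map_poly of_int a * map_poly of_int b :: 'a::comm_ring_1 poly)"
  by (rule poly_eqI, simp add: coeff_map_poly coeff_mult)+

lemma map_poly_of_int_prod:
  "map_poly of_int (\<Prod>i\<in>A. f i) = (\<Prod>i\<in>A. map_poly of_int (f i) :: 'a::comm_ring_1 poly)"
  by (induction A rule: infinite_finite_induct) (simp_all add: map_poly_of_int_mult)

text \<open>The product with roots 0, M, ..., (n - 1) M is congruent to X^n modulo M; adding h0 -
  X^n gives a polynomial congruent to h0 modulo m if m divides M, and real-rooted if M is
  large.\<close>

lemma exists_real_rooted_congruent:
  fixes h0 :: "int poly" and m :: int
  assumes h0: "lead_coeff h0 = 1" and n: "degree h0 = n" "n > 0" and m: "m > 0"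
  obtains h :: "int poly" and A :: "real set" where
    "lead_coeff h = 1" "degree h = n" "[:m:] dvd h - h0"
    "finite A" "card A = n" "\<And>x. x \<in> A \<Longrightarrow> poly (map_poly of_int h) x = 0"
proof -
  define r where "r = h0 - monom 1 n"
  have r0: "coeff r i = 0" if "i \<ge> n" for i
    using that h0 n by (cases "i = n") (auto simp: r_def coeff_monom coeff_eq_0)
  define B where "B = (\<Sum>i<n. \<bar>coeff r i\<bar>) * 2 ^ n * int n ^ (n - 1)"
  define M where "M = m * (B + 1)"
  have B: "B \<ge> 0" unfolding B_def by (intro mult_nonneg_nonneg sum_nonneg) auto
  have "1 * (B + 1) \<le> m * (B + 1)" using B m by (intro mult_right_mono) auto
  then have "B + 1 \<le> M" unfolding M_def mult_1 .
  then have M: "M \<ge> 1" "M > B" using B by auto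
  define P where "P = (\<Prod>j<n. [:- (M * int j), 1:])"
  define h where "h = P + r"
  have dP: "degree P = n" unfolding P_def by (subst degree_prod_eq_sum_degree) auto
  have lP: "lead_coeff P = 1" unfolding P_def by (simp add: lead_coeff_prod)
  have dh: "degree h = n"
  proof (rule antisym)
    show "degree h \<le> n" using dP r0 by (intro degree_le) (auto simp: h_def coeff_eq_0)
    show "n \<le> degree h" using dP lP r0[of n] by (intro le_degree) (simp add: h_def)
  qed
  have lh: "lead_coeff h = 1" using dh dP lP r0[of n] by (simp add: h_def)
  have "[:M:] dvd (\<Prod>j<k. [:- (M * int j), 1:]) - monom 1 k" for k
  proof (induction k)
    case (Suc k)
    have eq: "(\<Prod>j<Suc k. [:- (M * int j), 1:]) - monom 1 (Suc k)
      = ((\<Prod>j<k. [:- (M * int j), 1:]) - monom 1 k) * [:0, 1:] - (\<Prod>j<k. [:- (M * int j), 1:]) * [:M:] * [:int k:]"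
      by (simp add: monom_Suc algebra_simps)
    show ?case unfolding eq by (intro dvd_diff dvd_mult2[OF Suc] dvd_mult2[OF dvd_triv_right])
  qed simp
  then have "[:M:] dvd P - monom 1 n" by (simp add: P_def)
  then have "[:m:] dvd P - monom 1 n" using dvd_trans[of "[:m:]" "[:M:]"] by (simp add: M_def const_poly_dvd_const_poly_iff)
  then have dvd: "[:m:] dvd h - h0" by (simp add: h_def r_def algebra_simps)
  have "\<exists>A. card A = n \<and> finite A \<and>
    (\<forall>x\<in>A. poly ((\<Prod>j<n. [:- (real_of_int M * real j), 1:]) + map_poly of_int r) x = 0)"
  proof (rule sign_alternation_bound)
    show "real_of_int M \<ge> 1" using M by simp
    have "real_of_int B < real_of_int M" using M by simp
    then show "(\<Sum>i<n. \<bar>coeff (map_poly real_of_int r) i\<bar>) * 2 ^ n * real n ^ (n - 1) < real_of_int M"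
      by (simp add: B_def coeff_map_poly)
  qed (use n r0 in \<open>auto simp: coeff_map_poly\<close>)
  moreover have "(\<Prod>j<n. [:- (real_of_int M * real j), 1:]) + map_poly of_int r = map_poly real_of_int h"
  proof -
    have "map_poly real_of_int [:- (M * int j), 1:] = [:- (real_of_int M * real j), 1:]" for j
      by (simp add: map_poly_pCons)
    then show ?thesis by (simp add: h_def P_def map_poly_of_int_add map_poly_of_int_prod)
  qed
  ultimately show ?thesis using that[OF lh dh dvd] by auto
qed

lemma monic_eq_prod_roots:
  fixes f :: "complex poly"
  assumes "lead_coeff f = 1" "finite R" "card R = degree f" "\<And>s. s \<in> R \<Longrightarrow> poly f s = 0"
  shows "f = (\<Prod>s\<in>R. [:- s, 1:])"
proof (rule poly_eqI_degree_lead_coeff[of _ "degree f" _ R])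
  have d: "degree (\<Prod>s\<in>R. [:- s, 1:]) = degree f"
    using assms(3) by (subst degree_prod_eq_sum_degree) auto
  then show "degree (\<Prod>s\<in>R. [:- s, 1:]) \<le> degree f" by simp
  have "lead_coeff (\<Prod>s\<in>R. [:- s, 1:]) = 1" by (simp add: lead_coeff_prod)
  then show "coeff f (degree f) = coeff (\<Prod>s\<in>R. [:- s, 1:]) (degree f)" using d assms(1) by simp
  fix z assume z: "z \<in> R"
  then have "poly (\<Prod>s\<in>R. [:- s, 1:]) z = 0" using assms(2) by (auto simp: poly_prod prod_zero_iff)
  then show "poly f z = poly (\<Prod>s\<in>R. [:- s, 1:]) z" using assms(4)[OF z] by simp
qed (use assms in auto)

lemma monic_roots_eq:
  fixes f :: "complex poly"
  assumes "lead_coeff f = 1" "finite R" "card R = degree f" "\<And>s. s \<in> R \<Longrightarrow> poly f s = 0"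
  shows "{s. poly f s = 0} = R"
  by (subst monic_eq_prod_roots[OF assms]) (use assms(2) in \<open>auto simp: poly_prod prod_zero_iff\<close>)

lemma algebraic_int_poly:
  fixes z :: complex
  assumes "algebraic_int z" shows "algebraic_int (poly (map_poly of_int w) z)"
proof -
  have "poly (map_poly of_int w) z \<in> {x. algebraic_int x}"
    by (rule subrng_poly[OF subrng_algebraic_int]) (auto simp: coeff_map_poly int_imp_algebraic_int assms)
  then show ?thesis by simp
qed

section \<open>Krasner's argument: matching nearby roots\<close>

context absval
begin

text \<open>The value of f(z) is the product of the distances from z to the roots, hence at least
  the power of the smallest one.\<close>

lemma root_near:
  assumes R: "finite R" "R \<noteq> {}" "R \<subseteq> E" and z: "z \<in> E" and f: "f = (\<Prod>s\<in>R. [:- s, 1:])"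
  shows "\<exists>s\<in>R. N (z - s) ^ card R \<le> N (poly f z)"
proof -
  have "Min ((\<lambda>s. N (z - s)) ` R) \<in> (\<lambda>s. N (z - s)) ` R" using R by (intro Min_in) auto
  then obtain s where s: "s \<in> R" "Min ((\<lambda>s. N (z - s)) ` R) = N (z - s)" by auto
  have le: "N (z - s) \<le> N (z - s')" if "s' \<in> R" for s'
    unfolding s(2)[symmetric] using R that by (intro Min_le) auto
  have dE: "z - s' \<in> E" if "s' \<in> R" for s' using R z that by (auto intro: alg_field_diff[OF E])
  have "N (z - s) ^ card R = (\<Prod>s'\<in>R. N (z - s))" by simp
  also have "\<dots> \<le> (\<Prod>s'\<in>R. N (z - s'))" using le N_nonneg[OF dE] s(1) by (intro prod_mono) auto
  also have "\<dots> = N (\<Prod>s'\<in>R. z - s')" using N_prod[OF dE, of R "\<lambda>x. x"] by simp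
  also have "(\<Prod>s'\<in>R. z - s') = poly f z" unfolding f by (simp add: poly_prod)
  finally show ?thesis using s(1) by blast
qed

text \<open>By the ultrametric inequality two points of \<open>Z\<close> cannot share a near root,
  and counting makes the matching bijective. The last conclusion, that nearness characterises the
  partner, later makes the matching compatible with automorphisms preserving
  \<open>N\<close>.\<close>

lemma root_matching:
  assumes fin: "finite Z" "finite R" "card R \<le> card Z" and sub: "Z \<subseteq> E" "R \<subseteq> E"
    and sep: "\<And>z z'. z \<in> Z \<Longrightarrow> z' \<in> Z \<Longrightarrow> z \<noteq> z' \<Longrightarrow> N (z - z') \<ge> c"
    and near: "\<And>z. z \<in> Z \<Longrightarrow> \<exists>r\<in>R. N (z - r) < c"
  obtains m where "bij_betw m Z R" "\<And>z. z \<in> Z \<Longrightarrow> N (z - m z) < c"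
    "\<And>z r. z \<in> Z \<Longrightarrow> r \<in> R \<Longrightarrow> N (z - r) < c \<Longrightarrow> r = m z"
proof -
  obtain m where m: "\<And>z. z \<in> Z \<Longrightarrow> m z \<in> R \<and> N (z - m z) < c" using near by metis
  have eq: "z = z'" if "z \<in> Z" "z' \<in> Z" "r \<in> R" "N (z - r) < c" "N (z' - r) < c" for z z' r
  proof (rule ccontr)
    assume "z \<noteq> z'"
    have "N (z - z') = N ((z - r) - (z' - r))" by simp
    also have "\<dots> \<le> max (N (z - r)) (N (z' - r))" using that sub by (intro N_diff alg_field_diff[OF E]) auto
    finally show False using sep[OF that(1,2) \<open>z \<noteq> z'\<close>] that(4,5) by simp
  qed
  have inj: "inj_on m Z"
  proof (rule inj_onI)
    fix z z' assume "z \<in> Z" "z' \<in> Z" "m z = m z'"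
    then show "z = z'" using eq[of z z' "m z"] m[of z] m[of z'] by simp
  qed
  have "m ` Z = R"
  proof (rule card_subset_eq[OF fin(2)])
    show "m ` Z \<subseteq> R" using m by auto
    then show "card (m ` Z) = card R" using fin card_image[OF inj] card_mono[OF fin(2), of "m ` Z"] by simp
  qed
  then have bij: "bij_betw m Z R" using inj by (simp add: bij_betw_def)
  have "r = m z" if "z \<in> Z" "r \<in> R" "N (z - r) < c" for z r
  proof -
    obtain z' where z': "z' \<in> Z" "r = m z'" using \<open>m ` Z = R\<close> \<open>r \<in> R\<close> by blast
    then have "z = z'" using eq[OF that(1) z'(1) that(2,3)] m[OF z'(1)] by simp
    then show ?thesis using z' by simp
  qed
  then show ?thesis using that[OF bij] m by blast
qed

lemma N_poly_congruent:
  assumes "[:int l ^ k:] dvd h - h0" "z \<in> E" "algebraic_int z"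
  shows "N (poly (map_poly of_int h) z - poly (map_poly of_int h0) z) \<le> inverse (real l) ^ k"
proof -
  obtain w where w: "h - h0 = [:int l ^ k:] * w" using assms(1) by blast
  let ?w = "poly (map_poly of_int w) z :: complex"
  have "poly (map_poly of_int h) z - poly (map_poly of_int h0) z = poly (map_poly of_int (h - h0)) z"
    by (simp add: map_poly_of_int_diff)
  also have "\<dots> = of_nat l ^ k * ?w" unfolding w map_poly_of_int_mult by (simp add: map_poly_pCons)
  finally have "N (poly (map_poly of_int h) z - poly (map_poly of_int h0) z) = N (of_nat l ^ k * ?w)" by simp
  moreover have wE: "?w \<in> E"
    by (intro subrng_poly alg_field_subrng[OF E] assms) (simp add: coeff_map_poly alg_field_of_int[OF E])
  moreover have "N (of_nat l ^ k * ?w) = inverse (real l) ^ k * N ?w"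
    using wE by (simp add: N_mult N_pow N_l alg_field_pow[OF E] alg_field_of_nat[OF E])
  moreover have "N ?w \<le> 1" using wE algebraic_int_poly[OF assms(3)] by (rule N_int)
  ultimately show ?thesis by (simp add: mult_left_le)
qed

end

section \<open>Equality up to principal units\<close>

context absval
begin

text \<open>Both are nonzero and their quotient is a principal unit, i.e. they have the same leading
  term. The relation is compatible with products and quotients, so it permits calculation with
  leading terms.\<close>

definition sim :: "complex \<Rightarrow> complex \<Rightarrow> bool"
  where "sim x y \<longleftrightarrow> x \<in> E \<and> y \<in> E \<and> N (x - y) < N y"

lemma sim_E: "sim x y \<Longrightarrow> x \<in> E" "sim x y \<Longrightarrow> y \<in> E"
  by (auto simp: sim_def)

lemma sim_N: "sim x y \<Longrightarrow> N x = N y"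
  using N_add_eq[of y "x - y"] alg_field_diff[OF E] by (auto simp: sim_def)

lemma sim_pos: "sim x y \<Longrightarrow> N y > 0"
  using N_nonneg[of "x - y"] alg_field_diff[OF E, of x y] by (auto simp: sim_def)

lemma sim_nonzero: "sim x y \<Longrightarrow> x \<noteq> 0" "sim x y \<Longrightarrow> y \<noteq> 0"
  using sim_pos sim_N N_0 by force+

lemma sim_refl: "x \<in> E \<Longrightarrow> x \<noteq> 0 \<Longrightarrow> sim x x"
  using N_pos N_0 by (auto simp: sim_def)

lemma sim_sym: "sim x y \<Longrightarrow> sim y x"
  using sim_N[of x y] N_diff_commute[of x y] by (auto simp: sim_def)

lemma sim_trans: "sim x y \<Longrightarrow> sim y z \<Longrightarrow> sim x z"
proof -
  assume *: "sim x y" "sim y z"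
  then have "N (x - z) \<le> max (N (x - y)) (N (y - z))"
    using N_add[of "x - y" "y - z"] alg_field_diff[OF E] by (simp add: sim_def)
  then show ?thesis using * sim_N[OF *(2)] by (auto simp: sim_def)
qed

lemma sim_mult: assumes "sim x y" "sim x' y'" shows "sim (x * x') (y * y')"
proof -
  note m = sim_E[OF assms(1)] sim_E[OF assms(2)]
  have d: "x - y \<in> E" "x' - y' \<in> E" using m alg_field_diff[OF E] by blast+
  have "x * x' - y * y' = (x - y) * x' + y * (x' - y')" by (simp add: algebra_simps)
  then have "N (x * x' - y * y') \<le> max (N (x - y) * N x') (N y * N (x' - y'))"
    using N_add[of "(x - y) * x'" "y * (x' - y')"] m d by (simp add: N_mult alg_field_mult[OF E])
  also have "\<dots> < N y * N y'"
    using assms sim_N[OF assms(2)] sim_pos[OF assms(1)] sim_pos[OF assms(2)] by (auto simp: sim_def)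
  finally show ?thesis using m by (simp add: sim_def N_mult alg_field_mult[OF E])
qed

lemma sim_inverse: assumes "sim x y" shows "sim (inverse x) (inverse y)"
proof -
  note m = sim_E[OF assms] sim_nonzero[OF assms] sim_pos[OF assms]
  have "inverse x - inverse y = (y - x) * (inverse x * inverse y)" using m by (simp add: field_simps)
  then have "N (inverse x - inverse y) = N (y - x) * (inverse (N y) * inverse (N y))"
    using m sim_N[OF assms] by (simp add: N_mult N_inverse alg_field_mult[OF E] alg_field_inverse[OF E] alg_field_diff[OF E])
  also have "\<dots> < N y * (inverse (N y) * inverse (N y))"
    using sim_sym[OF assms] sim_N[OF assms] m by (intro mult_strict_right_mono) (auto simp: sim_def)
  also have "\<dots> = inverse (N y)" using m by simp
  finally show ?thesis using m by (simp add: sim_def N_inverse alg_field_inverse[OF E])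
qed

lemma sim_divide: "sim x y \<Longrightarrow> sim x' y' \<Longrightarrow> sim (x / x') (y / y')"
  by (simp add: divide_inverse sim_mult sim_inverse)

lemma sim_pow: "sim x y \<Longrightarrow> sim (x ^ n) (y ^ n)"
  by (induction n) (auto intro: sim_mult sim_refl alg_field_1[OF E])

end

lemma algebraic_int_power_root: "algebraic_int (x ^ n) \<Longrightarrow> n > 0 \<Longrightarrow> algebraic_int (x::complex)"
  by (rule algebraic_int_root[of "x ^ n" "monom 1 n"]) (auto simp: poly_monom coeff_monom degree_monom_eq)

definition qbar :: "complex set" where "qbar = {x. algebraic x}"

lemma alg_field_qbar: "alg_field qbar"
  using algebraic_of_int[of 1] by (auto simp: alg_field_def subrng_def qbar_def algebraic_diff algebraic_mult algebraic_Rats)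

lemma qbar_algebraic_int: "algebraic_int x \<Longrightarrow> x \<in> qbar"
  by (auto simp: qbar_def)

lemma exists_absval_qbar:
  assumes "Factorial_Ring.prime l" obtains N where "absval qbar N l"
proof -
  obtain N :: "complex \<Rightarrow> real" where N: "N 0 = 0"
    "\<And>x. algebraic x \<Longrightarrow> x \<noteq> 0 \<Longrightarrow> N x > 0"
    "\<And>x y. algebraic x \<Longrightarrow> algebraic y \<Longrightarrow> N (x * y) = N x * N y"
    "\<And>x y. algebraic x \<Longrightarrow> algebraic y \<Longrightarrow> N (x + y) \<le> max (N x) (N y)"
    "\<And>x. algebraic_int x \<Longrightarrow> N x \<le> 1"
    "N (of_nat l) = inverse (real l)"
    "\<And>x. algebraic x \<Longrightarrow> x \<noteq> 0 \<Longrightarrow> \<exists>b>0. \<exists>k. N x ^ b = real l powi k"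
    by (rule exists_absolute_value[OF assms], rule that)
  have "absval qbar N l"
    by unfold_locales (use N alg_field_qbar assms in \<open>auto simp: qbar_def\<close>)
  then show ?thesis by (rule that)
qed

section \<open>The \<open>p\<close>-adic polynomials\<close>

locale padic = absval qbar N p for N and p :: nat +
  assumes p_odd: "odd p"
begin

lemma p_gt_2: "p > 2"
  using p_odd prime_gt_1_nat[OF l] by (cases "p = 2") auto

lemma p_pos: "p > 0" using p_gt_2 by simp

definition zeta :: complex where "zeta = cis (2 * pi / real p)"

lemma zeta_power_p: "zeta ^ p = 1"
  using p_pos by (simp add: zeta_def DeMoivre)

lemma bij_zeta: "bij_betw (\<lambda>k. zeta ^ k) {..<p} {z. z ^ p = 1}"
  using bij_betw_roots_unity[OF p_pos] by (simp add: zeta_def DeMoivre mult.commute mult.left_commute)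

lemma root_of_unity_obtain:
  assumes "\<xi> ^ p = 1" obtains u where "u < p" "\<xi> = zeta ^ u"
  using assms bij_zeta by (auto simp: bij_betw_def image_iff set_eq_iff)

lemma zeta_mod: "zeta ^ (k mod p) = zeta ^ k"
proof -
  have "zeta ^ k = zeta ^ (p * (k div p) + k mod p)" by simp
  also have "\<dots> = (zeta ^ p) ^ (k div p) * zeta ^ (k mod p)" by (simp only: power_add power_mult)
  finally show ?thesis by (simp add: zeta_power_p)
qed

lemma zeta_eq_iff: "zeta ^ j = zeta ^ k \<longleftrightarrow> j mod p = k mod p"
proof
  assume "zeta ^ j = zeta ^ k"
  then have "zeta ^ (j mod p) = zeta ^ (k mod p)" by (simp add: zeta_mod)
  then show "j mod p = k mod p"
    using bij_zeta p_pos by (auto simp: bij_betw_def dest: inj_onD)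
qed (metis zeta_mod)

lemma zeta_eq_1_iff: "zeta ^ k = 1 \<longleftrightarrow> p dvd k"
  using zeta_eq_iff[of k 0] by (simp add: dvd_eq_mod_eq_0)

lemma zeta_int: "algebraic_int zeta"
  using algebraic_int_power_root[of zeta p] zeta_power_p p_pos by (simp add: int_imp_algebraic_int)

lemma algebraic_int_pow: "algebraic_int (x::complex) \<Longrightarrow> algebraic_int (x ^ n)"
  by (induction n) (auto intro: algebraic_int_mult simp: int_imp_algebraic_int)

lemma zeta_E: "zeta ^ k \<in> qbar"
  by (intro qbar_algebraic_int algebraic_int_pow zeta_int)

lemma N_root_of_unity: assumes "\<xi> ^ p = 1" shows "N \<xi> = 1"
proof -
  have i: "algebraic_int \<xi>" using algebraic_int_power_root[of \<xi> p] assms p_pos by (simp add: int_imp_algebraic_int)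
  then have "N \<xi> ^ p = 1" using N_pow[OF qbar_algebraic_int[OF i], of p] assms N_1 by simp
  then show ?thesis
    using power_eq_imp_eq_base[of "N \<xi>" p 1] N_nonneg[OF qbar_algebraic_int[OF i]] p_pos by simp
qed

lemma N_zeta: "N (zeta ^ k) = 1"
  by (rule N_root_of_unity) (metis mult.commute power_mult power_one zeta_power_p)

text \<open>\<open>\<xi> - 1\<close> is a root of an Eisenstein polynomial with lower terms divisible by \<open>p\<close>.\<close>

lemma N_one_minus_root_of_unity:
  assumes \<xi>: "\<xi> ^ p = 1" "\<xi> \<noteq> 1"
  shows "N (\<xi> - 1) ^ (p - 1) = inverse (real p)"
    and "N ((\<xi> - 1) ^ (p - 1) + of_nat p) \<le> inverse (real p) * N (\<xi> - 1)"
    and "N (\<xi> - 1) < 1" and "\<xi> - 1 \<in> qbar"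
proof -
  define w where "w = \<xi> - 1"
  have i: "algebraic_int w"
    using algebraic_int_power_root[of \<xi> p] \<xi> p_pos unfolding w_def
    by (intro algebraic_int_diff) (auto simp: int_imp_algebraic_int)
  have wE: "w \<in> qbar" by (rule qbar_algebraic_int[OF i])
  obtain m where m: "p = Suc (Suc m)" using p_gt_2 by (metis Suc_lessE numeral_2_eq_2)
  \<comment> \<open>Expanding (w + 1)^p = 1 and dividing by w gives w^(p-1) + p + S = 0. Every term
    of S is divisible by both p and w.\<close>
  define S where "S = (\<Sum>k<m. of_nat (p choose (k + 2)) * w ^ (k + 1))"
  have "1 = (w + 1) ^ p" using \<xi> by (simp add: w_def)
  also have "\<dots> = (\<Sum>k\<le>p. of_nat (p choose k) * w ^ k)" by (subst binomial_ring) simp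
  also have "\<dots> = 1 + of_nat p * w + (\<Sum>k<m. of_nat (p choose (k + 2)) * w ^ (k + 2)) + w ^ p"
    unfolding m lessThan_Suc_atMost[symmetric]
    by (subst sum.lessThan_Suc, subst sum.lessThan_Suc_shift, subst sum.lessThan_Suc_shift) simp
  also have "(\<Sum>k<m. of_nat (p choose (k + 2)) * w ^ (k + 2)) = S * w"
    unfolding S_def sum_distrib_right by (intro sum.cong) (auto simp: mult_ac)
  finally have "w * (w ^ (p - 1) + (of_nat p + S)) = 0"
    by (simp add: m algebra_simps)
  moreover have "w \<noteq> 0" using \<xi>(2) by (simp add: w_def)
  ultimately have w: "w ^ (p - 1) = - (of_nat p + S)" by (simp add: add_eq_0_iff2)
  have pE: "of_nat k \<in> qbar" for k by (rule alg_field_of_nat[OF E])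
  have term_E: "of_nat (p choose (k + 2)) * w ^ (k + 1) \<in> qbar" for k
    by (intro alg_field_mult[OF E] alg_field_pow[OF E] wE pE)
  have SE: "S \<in> qbar" unfolding S_def by (rule alg_field_sum[OF E], rule term_E)
  have Nw0: "N w \<ge> 0" by (rule N_nonneg[OF wE])
  have Nw: "N w \<le> 1" by (rule N_int[OF wE i])
  have NS: "N S \<le> inverse (real p) * N w"
    unfolding S_def
  proof (rule N_sum_le)
    show "0 \<le> inverse (real p) * N w" using Nw0 by simp
    fix k assume k: "k \<in> {..<m}"
    show "of_nat (p choose (k + 2)) * w ^ (k + 1) \<in> qbar" by (rule term_E)
    have "p dvd (p choose (k + 2))" using k m by (intro dvd_choose_prime l) auto
    then obtain c where c: "p choose (k + 2) = p * c" by blast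
    have "N (of_nat (p choose (k + 2)) * w ^ (k + 1)) = (inverse (real p) * N (of_nat c)) * (N w * N w ^ k)"
      unfolding c using wE pE by (simp add: N_mult N_pow N_l alg_field_mult[OF E] alg_field_pow[OF E])
    also have "\<dots> \<le> (inverse (real p) * 1) * (N w * 1)"
      using Nw0 Nw N_of_nat[of c] N_nonneg[OF pE] by (intro mult_mono power_le_one) auto
    finally show "N (of_nat (p choose (k + 2)) * w ^ (k + 1)) \<le> inverse (real p) * N w" by simp
  qed
  have ip: "inverse (real p) > 0" "inverse (real p) < 1" using l_gt_1 p_pos by (auto simp: field_simps)
  have psE: "of_nat p + S \<in> qbar" by (intro alg_field_add[OF E] SE pE)
  have e: "N w ^ (p - 1) = N (of_nat p + S)"
    using N_pow[OF wE, of "p - 1"] w N_minus[OF psE] by simp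
  have "N (of_nat p + S) \<le> max (inverse (real p)) (inverse (real p) * N w)"
    using N_add[OF pE SE, of p] NS N_l by simp
  also have "\<dots> < 1" using ip Nw Nw0 mult_left_le[of "N w" "inverse (real p)"] by auto
  finally have "N w ^ (p - 1) < 1" using e by simp
  then have lt: "N w < 1" using Nw0 by (metis not_le one_le_power)
  show "N (\<xi> - 1) < 1" "\<xi> - 1 \<in> qbar" using lt wE by (auto simp: w_def)
  have "inverse (real p) * N w < inverse (real p) * 1"
    using lt ip by (intro mult_strict_left_mono) auto
  then have "N S < inverse (real p)" using NS by linarith
  then have "N (of_nat p + S) = inverse (real p)"
    using N_add_eq[OF pE SE, of p] N_l by simp
  then show "N (\<xi> - 1) ^ (p - 1) = inverse (real p)" using e by (simp add: w_def)
  have "w ^ (p - 1) + of_nat p = - S" using w by simp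
  then show "N ((\<xi> - 1) ^ (p - 1) + of_nat p) \<le> inverse (real p) * N (\<xi> - 1)"
    using NS N_minus[OF SE] by (simp add: w_def)
qed

text \<open>This is p^(-1/(p-1)), the common distance of any two distinct p-th roots of unity, and
  so the scale of all root matchings for \<open>lam\<close> and \<open>alpha\<close>.\<close>

definition pp :: real where "pp = N (zeta - 1)"

lemma zeta_neq_1: "0 < a \<Longrightarrow> a < p \<Longrightarrow> zeta ^ a \<noteq> 1"
  by (auto simp: zeta_eq_1_iff dest: dvd_imp_le)

lemma zeta_pow_pow: "(zeta ^ a) ^ p = 1"
  by (metis mult.commute power_mult power_one zeta_power_p)

lemma pp_power: "pp ^ (p - 1) = inverse (real p)" and pp_less_1: "pp < 1"
  using N_one_minus_root_of_unity(1,3)[of zeta] zeta_power_p zeta_neq_1[of 1] p_gt_2 by (auto simp: pp_def)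

lemma pp_pos: "pp > 0"
  using pp_power p_gt_2 N_nonneg[of "zeta - 1"] zeta_E[of 1] alg_field_diff[OF E] alg_field_1[OF E]
  by (auto simp: pp_def less_le power_0_left)

lemma N_root_of_unity_minus_1:
  assumes "\<xi> ^ p = 1" "\<xi> \<noteq> 1" shows "N (\<xi> - 1) = pp"
proof (rule power_eq_imp_eq_base)
  show "N (\<xi> - 1) ^ (p - 1) = pp ^ (p - 1)" using N_one_minus_root_of_unity(1)[OF assms] pp_power by simp
  show "0 \<le> N (\<xi> - 1)" by (rule N_nonneg[OF N_one_minus_root_of_unity(4)[OF assms]])
qed (use pp_pos p_gt_2 in auto)

lemma N_zeta_diff: assumes "j mod p \<noteq> k mod p" shows "N (zeta ^ j - zeta ^ k) = pp"
proof -
  have main: "N (zeta ^ j - zeta ^ k) = pp" if "k < j" "j mod p \<noteq> k mod p" for j k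
  proof -
    have e: "zeta ^ j = zeta ^ k * zeta ^ (j - k)" using that(1) by (simp flip: power_add)
    have ne: "zeta ^ (j - k) \<noteq> 1"
    proof
      assume "zeta ^ (j - k) = 1"
      then have "zeta ^ j = zeta ^ k" using e by simp
      then show False using that(2) by (simp add: zeta_eq_iff)
    qed
    have "zeta ^ j - zeta ^ k = zeta ^ k * (zeta ^ (j - k) - 1)" using e by (simp add: algebra_simps)
    then show ?thesis
      using N_mult[OF zeta_E[of k] N_one_minus_root_of_unity(4)[OF zeta_pow_pow ne]] N_zeta N_root_of_unity_minus_1[OF zeta_pow_pow ne]
      by simp
  qed
  show ?thesis
  proof (cases j k rule: linorder_cases)
    case less
    then show ?thesis using main[of j k] assms N_diff_commute[OF zeta_E zeta_E, of j k] by simp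
  qed (use main assms in auto)
qed

text \<open>The quotient of \<open>zeta ^ a - 1\<close> by \<open>zeta - 1\<close> is a sum of a
  roots of unity, each congruent to 1. In this way an exponent modulo p becomes visible in leading
  terms.\<close>

lemma sim_zeta: assumes "0 < a" "a < p" shows "sim (zeta ^ a - 1) (of_nat a * (zeta - 1))"
proof -
  have g: "zeta ^ k - 1 = (zeta - 1) * (\<Sum>i<k. zeta ^ i)" for k by (rule power_diff_1_eq)
  have z1: "zeta - 1 \<in> qbar" using zeta_E[of 1] alg_field_diff[OF E] alg_field_1[OF E] by simp
  have d: "zeta ^ i - 1 \<in> qbar" for i using zeta_E[of i] alg_field_diff[OF E] alg_field_1[OF E] by simp
  have "zeta ^ a - 1 - of_nat a * (zeta - 1) = (zeta - 1) * ((\<Sum>i<a. zeta ^ i) - of_nat a)"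
    by (simp add: g algebra_simps)
  also have "(\<Sum>i<a. zeta ^ i) - of_nat a = (\<Sum>i<a. zeta ^ i - 1)" by (simp add: sum_subtractf)
  finally have e: "zeta ^ a - 1 - of_nat a * (zeta - 1) = (zeta - 1) * (\<Sum>i<a. zeta ^ i - 1)" .
  have "N (zeta ^ i - 1) \<le> pp" for i
    using N_root_of_unity_minus_1[OF zeta_pow_pow, of i] N_0 pp_pos by (cases "zeta ^ i = 1") auto
  then have "N (\<Sum>i<a. zeta ^ i - 1) \<le> pp" using pp_pos d by (intro N_sum_le) auto
  then have "N (zeta ^ a - 1 - of_nat a * (zeta - 1)) \<le> pp * pp"
    unfolding e using N_mult[OF z1 alg_field_sum[OF E, of "{..<a}" "\<lambda>i. zeta ^ i - 1"]] d pp_pos by (simp add: pp_def)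
  also have "\<dots> < pp" using pp_pos pp_less_1 by simp
  also have "pp = N (of_nat a * (zeta - 1))"
  proof -
    have "\<not> p dvd a" using assms by (auto dest: dvd_imp_le)
    then have "N (of_nat a) = 1" using N_of_int_coprime[of "int a"] by simp
    then show ?thesis using N_mult[OF alg_field_of_nat[OF E, of a] z1] by (simp add: pp_def)
  qed
  finally show ?thesis
    using d z1 by (auto simp: sim_def intro: alg_field_mult[OF E] alg_field_of_nat[OF E])
qed

text \<open>At \<open>zeta ^ a - 1\<close> the polynomial X^(p-1) + p has value at most pp/p, below
  pp^(p-1) = 1/p, so a root is nearer than \<open>pp\<close>; the points themselves are exactly
  \<open>pp\<close> apart. The roots thus behave like \<open>zeta ^ a - 1\<close>, while their
  powers satisfy binomial equations.\<close>

lemma exists_lambda: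
  obtains lam where "bij_betw lam {1..<p} {s. s ^ (p - 1) = - of_nat p}"
    "\<And>a. a \<in> {1..<p} \<Longrightarrow> N (zeta ^ a - 1 - lam a) < pp"
    "\<And>a r. a \<in> {1..<p} \<Longrightarrow> r ^ (p - 1) = - of_nat p \<Longrightarrow> N (zeta ^ a - 1 - r) < pp \<Longrightarrow> r = lam a"
proof -
  define Z where "Z = (\<lambda>a. zeta ^ a - 1) ` {1..<p}"
  define R where "R = {s :: complex. s ^ (p - 1) = - of_nat p}"
  have inj: "inj_on (\<lambda>a. zeta ^ a - 1) {1..<p}"
    by (rule inj_onI) (auto simp: zeta_eq_iff)
  have cR: "card R = p - 1" unfolding R_def using p_gt_2 by (intro card_nth_roots) auto
  then have fR: "finite R" using p_gt_2 by (auto intro: card_ge_0_finite)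
  have cZ: "card Z = p - 1" unfolding Z_def using card_image[OF inj] by simp
  have Rint: "algebraic_int s" if "s \<in> R" for s
    using that p_gt_2 by (intro algebraic_int_power_root[of s "p - 1"]) (auto simp: R_def int_imp_algebraic_int)
  have ZE: "Z \<subseteq> qbar" unfolding Z_def using zeta_E alg_field_diff[OF E _ alg_field_1[OF E]] by auto
  have RE: "R \<subseteq> qbar" using Rint qbar_algebraic_int by auto
  define f :: "complex poly" where "f = monom 1 (p - 1) + [:of_nat p:]"
  have df: "degree f = p - 1" unfolding f_def using p_gt_2 by (subst degree_add_eq_left) (auto simp: degree_monom_eq)
  have lf: "lead_coeff f = 1" unfolding df using p_gt_2 by (simp add: f_def coeff_pCons split: nat.split)
  have pf: "poly f z = z ^ (p - 1) + of_nat p" for z by (simp add: f_def poly_monom)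
  have fprod: "f = (\<Prod>s\<in>R. [:- s, 1:])"
  proof (rule monic_eq_prod_roots[OF lf fR])
    show "card R = degree f" by (simp add: cR df)
    show "poly f s = 0" if "s \<in> R" for s using that by (simp add: pf R_def)
  qed
  have near: "\<exists>r\<in>R. N (z - r) < pp" if z: "z \<in> Z" for z
  proof -
    obtain a where a: "a \<in> {1..<p}" "z = zeta ^ a - 1" using z by (auto simp: Z_def)
    have ne: "zeta ^ a \<noteq> 1" using a by (intro zeta_neq_1) auto
    have "R \<noteq> {}" using cR p_gt_2 by auto
    then obtain r where r: "r \<in> R" "N (z - r) ^ (p - 1) \<le> N (poly f z)"
      using root_near[OF fR _ RE _ fprod, of z] ZE z cR by auto
    from r(2) have "N (z - r) ^ (p - 1) \<le> N (poly f z)" .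
    also have "N (poly f z) \<le> inverse (real p) * pp"
      using N_one_minus_root_of_unity(2)[OF zeta_pow_pow ne] N_root_of_unity_minus_1[OF zeta_pow_pow ne]
      by (simp add: pf a)
    also have "\<dots> < inverse (real p) * 1" using pp_less_1 p_pos by (intro mult_strict_left_mono) auto
    also have "\<dots> = pp ^ (p - 1)" using pp_power by simp
    finally have "N (z - r) < pp" using pp_pos by (auto intro: power_less_imp_less_base)
    then show ?thesis using r by blast
  qed
  have sep: "pp \<le> N (z - z')" if z: "z \<in> Z" "z' \<in> Z" "z \<noteq> z'" for z z'
  proof -
    obtain a b where "a \<in> {1..<p}" "z = zeta ^ a - 1" "b \<in> {1..<p}" "z' = zeta ^ b - 1"
      using z(1,2) unfolding Z_def by blast
    then show ?thesis using z(3) N_zeta_diff[of a b] by (auto simp: zeta_eq_iff)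
  qed
  obtain m where m: "bij_betw m Z R" "\<And>z. z \<in> Z \<Longrightarrow> N (z - m z) < pp"
    "\<And>z r. z \<in> Z \<Longrightarrow> r \<in> R \<Longrightarrow> N (z - r) < pp \<Longrightarrow> r = m z"
    using root_matching[OF _ fR _ ZE RE sep near] cR cZ by (auto simp: Z_def)
  show ?thesis
  proof (rule that[of "\<lambda>a. m (zeta ^ a - 1)"])
    have "bij_betw (\<lambda>a. zeta ^ a - 1) {1..<p} Z" unfolding Z_def using inj by (rule inj_on_imp_bij_betw)
    from bij_betw_trans[OF this m(1)] show "bij_betw (\<lambda>a. m (zeta ^ a - 1)) {1..<p} {s. s ^ (p - 1) = - of_nat p}"
      by (simp add: comp_def R_def)
    show "N (zeta ^ a - 1 - m (zeta ^ a - 1)) < pp" if "a \<in> {1..<p}" for a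
      using m(2) that by (auto simp: Z_def)
    show "r = m (zeta ^ a - 1)" if "a \<in> {1..<p}" "r ^ (p - 1) = - of_nat p" "N (zeta ^ a - 1 - r) < pp" for a r
      using m(3) that by (auto simp: Z_def R_def)
  qed
qed

end

section \<open>Integer polynomials with prescribed nearby roots\<close>

definition croots :: "int poly \<Rightarrow> complex set"
  where "croots h = {s. poly (map_poly of_int h) s = 0}"

lemma algebraic_int_croots: "lead_coeff h = 1 \<Longrightarrow> s \<in> croots h \<Longrightarrow> algebraic_int s"
  by (auto simp: croots_def algebraic_int.simps coeff_map_poly degree_map_poly intro!: exI[of _ "map_poly of_int h"])

lemma real_roots_croots:
  assumes "lead_coeff h = 1" "finite A" "card A = degree h" "\<And>x::real. x \<in> A \<Longrightarrow> poly (map_poly of_int h) x = 0"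
  shows "croots h = of_real ` A"
  unfolding croots_def
proof (rule monic_roots_eq)
  show "lead_coeff (map_poly of_int h :: complex poly) = 1"
    using assms(1) by (simp add: coeff_map_poly degree_map_poly)
  show "card (complex_of_real ` A) = degree (map_poly of_int h :: complex poly)"
    using assms(3) by (simp add: card_image inj_on_def degree_map_poly)
  fix s assume "s \<in> complex_of_real ` A"
  then obtain x where x: "x \<in> A" "s = of_real x" by blast
  have "poly (map_poly of_int h) (complex_of_real x) = of_real (poly (map_poly of_int h) x)"
    by (simp add: poly_altdef degree_map_poly coeff_map_poly)
  then show "poly (map_poly of_int h) s = 0" using assms(4)[OF x(1)] x by simp
qed (use assms(2) in auto)

context absval
begin

text \<open>Congruence modulo l^k makes h of value at most l^(-k) at the roots of h0, and
  \<open>root_near\<close> turns this into nearness of roots. The exponent k precedes h, so h may be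
  constructed afterwards from the required congruence.\<close>

lemma exists_deformation_bound:
  assumes h0: "lead_coeff h0 = 1" "degree h0 = n" "n > 0"
    and Z: "finite Z" "card Z = n" "Z \<subseteq> croots h0" "Z \<subseteq> E"
    and c: "c > 0" and sep: "\<And>z z'. z \<in> Z \<Longrightarrow> z' \<in> Z \<Longrightarrow> z \<noteq> z' \<Longrightarrow> N (z - z') \<ge> c"
  shows "\<exists>k. \<forall>h. lead_coeff h = 1 \<longrightarrow> degree h = n \<longrightarrow> [:int l ^ k:] dvd h - h0 \<longrightarrow> finite (croots h) \<longrightarrow>
    card (croots h) = n \<longrightarrow> croots h \<subseteq> E \<longrightarrow>
    (\<exists>m. bij_betw m Z (croots h) \<and> (\<forall>z\<in>Z. N (z - m z) < c) \<and>
      (\<forall>z\<in>Z. \<forall>r\<in>croots h. N (z - r) < c \<longrightarrow> r = m z))"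
proof -
  have "inverse (real l) < 1" using l_gt_1 by (simp add: field_simps)
  then obtain k where k: "inverse (real l) ^ k < c ^ n"
    using real_arch_pow_inv[of "c ^ n" "inverse (real l)"] c by auto
  show ?thesis
  proof (intro exI[of _ k] allI impI)
    fix h :: "int poly"
    assume h: "lead_coeff h = 1" "degree h = n" "[:int l ^ k:] dvd h - h0" "finite (croots h)"
      "card (croots h) = n" "croots h \<subseteq> E"
    let ?f = "map_poly of_int h :: complex poly"
    have fprod: "?f = (\<Prod>s\<in>croots h. [:- s, 1:])"
      using h by (intro monic_eq_prod_roots) (auto simp: coeff_map_poly degree_map_poly croots_def)
    have near: "\<exists>r\<in>croots h. N (z - r) < c" if z: "z \<in> Z" for z
    proof -
      have "croots h \<noteq> {}" using h(5) h0(3) by auto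
      then obtain r where r: "r \<in> croots h" "N (z - r) ^ n \<le> N (poly ?f z)"
        using root_near[OF h(4) _ h(6) _ fprod, of z] z Z(4) h(5) by auto
      have "poly (map_poly of_int h0) z = 0" using z Z(3) by (auto simp: croots_def)
      then have "N (poly ?f z) \<le> inverse (real l) ^ k"
        using N_poly_congruent[OF h(3), of z] algebraic_int_croots[OF h0(1)] z Z by auto
      then have "N (z - r) ^ n < c ^ n" using r(2) k by linarith
      then have "N (z - r) < c" using c by (auto intro: power_less_imp_less_base)
      then show ?thesis using r(1) by blast
    qed
    obtain m where "bij_betw m Z (croots h)" "\<And>z. z \<in> Z \<Longrightarrow> N (z - m z) < c"
      "\<And>z r. z \<in> Z \<Longrightarrow> r \<in> croots h \<Longrightarrow> N (z - r) < c \<Longrightarrow> r = m z"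
      using root_matching[OF Z(1) h(4) _ Z(4) h(6) sep near] h(5) Z(2) by auto
    then show "\<exists>m. bij_betw m Z (croots h) \<and> (\<forall>z\<in>Z. N (z - m z) < c) \<and>
      (\<forall>z\<in>Z. \<forall>r\<in>croots h. N (z - r) < c \<longrightarrow> r = m z)" by blast
  qed
qed

end

lemma finite_positive_bound:
  assumes "finite A" "\<And>a. a \<in> A \<Longrightarrow> (a::real) > 0"
  obtains c where "c > 0" "\<And>a. a \<in> A \<Longrightarrow> c \<le> a"
proof -
  have "Min (insert 1 A) \<in> insert 1 A" using assms(1) by (intro Min_in) auto
  then have "Min (insert 1 A) > 0" using assms(2) by auto
  moreover have "Min (insert 1 A) \<le> a" if "a \<in> A" for a using assms(1) that by (intro Min_le) auto
  ultimately show ?thesis by (rule that)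
qed

context padic
begin

definition proot :: complex where "proot = of_real (root p (real p))"

lemma proot_power: "proot ^ p = of_nat p"
proof -
  have "root p (real p) ^ p = real p" using p_pos by simp
  then show ?thesis unfolding proot_def by (metis of_real_of_nat_eq of_real_power)
qed

lemma proot_int: "algebraic_int proot"
  using algebraic_int_power_root[of proot p] proot_power p_pos by (simp add: int_imp_algebraic_int)

lemma proot_E: "proot \<in> qbar" by (rule qbar_algebraic_int[OF proot_int])

lemma proot_nonzero: "proot \<noteq> 0" using proot_power p_pos by (auto simp: power_0_left)

lemma N_proot: "N proot ^ p = inverse (real p)" "N proot > 0"
  using N_pow[OF proot_E, of p] proot_power N_l N_pos[OF proot_E proot_nonzero] by auto

lemma Xp_roots: "croots (monom 1 p - [:int p:]) = (\<lambda>j. zeta ^ j * proot) ` {..<p}"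
proof -
  have pf: "poly (map_poly of_int (monom 1 p - [:int p:])) z = z ^ p - of_nat p" for z :: complex
    by (simp add: map_poly_of_int_diff map_poly_monom map_poly_pCons poly_monom)
  have "z ^ p = of_nat p \<longleftrightarrow> z \<in> (\<lambda>j. zeta ^ j * proot) ` {..<p}" for z
  proof
    assume "z ^ p = of_nat p"
    then have "(z / proot) ^ p = 1" using proot_power p_pos by (simp add: power_divide)
    then obtain u where "u < p" "z / proot = zeta ^ u" by (rule root_of_unity_obtain)
    then show "z \<in> (\<lambda>j. zeta ^ j * proot) ` {..<p}" using proot_nonzero by (auto simp: field_simps)
  qed (auto simp: power_mult_distrib zeta_pow_pow proot_power)
  then show ?thesis by (auto simp: croots_def pf)
qed

text \<open>The radius \<open>N proot * pp\<close> is exactly the distance between two roots of X^p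
  - p, the largest for which the matching is unambiguous.\<close>

lemma exists_alpha:
  obtains f alpha where "lead_coeff f = 1" "degree f = p" "croots f \<subseteq> \<real>"
    "bij_betw alpha {..<p} (croots f)"
    "\<And>j. j < p \<Longrightarrow> N (zeta ^ j * proot - alpha j) < N proot * pp"
    "\<And>j r. j < p \<Longrightarrow> r \<in> croots f \<Longrightarrow> N (zeta ^ j * proot - r) < N proot * pp \<Longrightarrow> r = alpha j"
proof -
  define f0 where "f0 = monom 1 p - [:int p:]"
  have df0: "degree f0 = p"
  proof (rule antisym)
    show "degree f0 \<le> p" unfolding f0_def by (intro degree_le) (auto simp: coeff_pCons split: nat.split)
    show "p \<le> degree f0" unfolding f0_def using p_pos by (intro le_degree) (auto simp: coeff_pCons split: nat.split)
  qed
  have lf0: "lead_coeff f0 = 1" unfolding df0 using p_pos by (simp add: f0_def coeff_pCons split: nat.split)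
  define Z where "Z = (\<lambda>j. zeta ^ j * proot) ` {..<p}"
  have inj: "inj_on (\<lambda>j. zeta ^ j * proot) {..<p}"
    using proot_nonzero by (auto simp: inj_on_def zeta_eq_iff)
  have ZE: "Z \<subseteq> qbar" unfolding Z_def using alg_field_mult[OF E zeta_E proot_E] by auto
  have cpos: "N proot * pp > 0" using N_proot pp_pos by simp
  have sep: "N proot * pp \<le> N (z - z')" if z: "z \<in> Z" "z' \<in> Z" "z \<noteq> z'" for z z'
  proof -
    obtain a b where ab: "a < p" "z = zeta ^ a * proot" "b < p" "z' = zeta ^ b * proot"
      using z(1,2) unfolding Z_def by blast
    then have "a mod p \<noteq> b mod p" using z(3) by auto
    moreover have "z - z' = (zeta ^ a - zeta ^ b) * proot" using ab by (simp add: algebra_simps)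
    ultimately show ?thesis
      using N_mult[OF alg_field_diff[OF E zeta_E[of a] zeta_E[of b]] proot_E] N_zeta_diff by simp
  qed
  have "\<exists>k. \<forall>h. lead_coeff h = 1 \<longrightarrow> degree h = p \<longrightarrow> [:int p ^ k:] dvd h - f0 \<longrightarrow> finite (croots h) \<longrightarrow>
    card (croots h) = p \<longrightarrow> croots h \<subseteq> qbar \<longrightarrow>
    (\<exists>m. bij_betw m Z (croots h) \<and> (\<forall>z\<in>Z. N (z - m z) < N proot * pp) \<and>
      (\<forall>z\<in>Z. \<forall>r\<in>croots h. N (z - r) < N proot * pp \<longrightarrow> r = m z))"
    by (rule exists_deformation_bound[OF lf0 df0 p_pos _ _ _ ZE cpos sep])
      (use card_image[OF inj] Xp_roots in \<open>auto simp: Z_def f0_def\<close>)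
  then obtain k where k: "\<And>h. lead_coeff h = 1 \<Longrightarrow> degree h = p \<Longrightarrow> [:int p ^ k:] dvd h - f0 \<Longrightarrow> finite (croots h) \<Longrightarrow>
    card (croots h) = p \<Longrightarrow> croots h \<subseteq> qbar \<Longrightarrow>
    (\<exists>m. bij_betw m Z (croots h) \<and> (\<forall>z\<in>Z. N (z - m z) < N proot * pp) \<and>
      (\<forall>z\<in>Z. \<forall>r\<in>croots h. N (z - r) < N proot * pp \<longrightarrow> r = m z))" by metis
  have "int p ^ k > 0" using p_pos by simp
  then obtain f A where f: "lead_coeff f = 1" "degree f = p" "[:int p ^ k:] dvd f - f0"
    "finite A" "card A = p" "\<And>x::real. x \<in> A \<Longrightarrow> poly (map_poly of_int f) x = 0"
    using exists_real_rooted_congruent[OF lf0 df0 p_pos] by metis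
  have R: "croots f = of_real ` A" using f by (intro real_roots_croots) auto
  have RE: "croots f \<subseteq> qbar" using algebraic_int_croots[OF f(1)] qbar_algebraic_int by auto
  have "card (croots f) = p" unfolding R using f(5) by (simp add: card_image inj_on_def)
  then obtain m where m: "bij_betw m Z (croots f)" "\<forall>z\<in>Z. N (z - m z) < N proot * pp"
    "\<forall>z\<in>Z. \<forall>r\<in>croots f. N (z - r) < N proot * pp \<longrightarrow> r = m z"
    using k[OF f(1,2,3) _ _ RE] f(4) R by auto
  show ?thesis
  proof (rule that[OF f(1,2)])
    show "croots f \<subseteq> \<real>" unfolding R by auto
    have "bij_betw (\<lambda>j. zeta ^ j * proot) {..<p} Z" unfolding Z_def using inj by (rule inj_on_imp_bij_betw)
    from bij_betw_trans[OF this m(1)] show "bij_betw (\<lambda>j. m (zeta ^ j * proot)) {..<p} (croots f)"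
      by (simp add: comp_def)
  qed (use m in \<open>auto simp: Z_def\<close>)
qed

text \<open>
  The spacing \<open>3p\<close> separates the complex circles \<open>\<bar>z - 3pi\<bar>\<^bsup>e\<^sub>i\<^esup> = p\<close>, so the factors have no common
  roots.
\<close>

definition Zset :: "nat \<Rightarrow> (nat \<Rightarrow> nat) \<Rightarrow> complex set"
  where "Zset m e = {z. \<exists>i<m. (z - of_nat (3 * p * i)) ^ e i = - of_nat p}"

text \<open>The p-adic and 2-adic conditions are combined by Chinese remaindering of coefficients;
  \<open>exists_real_rooted_congruent\<close> then makes all roots real without disturbing either
  congruence.\<close>

lemma exists_theta:
  assumes e: "\<And>i. i < m \<Longrightarrow> e i > 0" and q: "(\<Sum>i<m. e i) = q" "q > 0"
  obtains h theta c where "lead_coeff h = 1" "degree h = q" "croots h \<subseteq> \<real>" "card (croots h) = q"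
    "[:4:] dvd h - (monom 1 q + [:2:])"
    "finite (Zset m e)" "\<And>z. z \<in> Zset m e \<Longrightarrow> algebraic_int z"
    "bij_betw theta (Zset m e) (croots h)"
    "\<And>z. z \<in> Zset m e \<Longrightarrow> N (z - theta z) < c"
    "\<And>z r. z \<in> Zset m e \<Longrightarrow> r \<in> croots h \<Longrightarrow> N (z - r) < c \<Longrightarrow> r = theta z"
    "\<And>(z::complex) i j. i < m \<Longrightarrow> j < m \<Longrightarrow> (z - of_nat (3 * p * i)) ^ e i = - of_nat p \<Longrightarrow>
      (z - of_nat (3 * p * j)) ^ e j = - of_nat p \<Longrightarrow> i = j"
    "c \<le> inverse (real p)"
    "\<And>z i. z \<in> Zset m e \<Longrightarrow> i < m \<Longrightarrow> (z - of_nat (3 * p * i)) ^ e i + of_nat p \<noteq> 0 \<Longrightarrow>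
      c \<le> N ((z - of_nat (3 * p * i)) ^ e i + of_nat p)"
proof -
  define Zi where "Zi i = {z::complex. (z - of_nat (3 * p * i)) ^ e i = - of_nat p}" for i
  define Z where "Z = Zset m e"
  have ZU: "Z = (\<Union>i<m. Zi i)" by (auto simp: Z_def Zset_def Zi_def)
  have cZi: "card (Zi i) = e i" "finite (Zi i)" if "i < m" for i
  proof -
    have "Zi i = (\<lambda>z. z + of_nat (3 * p * i)) ` {z. z ^ e i = - of_nat p}"
      by (auto simp: Zi_def image_iff intro!: exI[of _ "_ - _"])
    then have "card (Zi i) = card {z :: complex. z ^ e i = - of_nat p}" by (simp add: card_image inj_on_def)
    then show "card (Zi i) = e i" using card_nth_roots[of "- of_nat p" "e i"] e[OF that] p_pos by simp
    then show "finite (Zi i)" using e[OF that] by (auto intro: card_ge_0_finite)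
  qed
  \<comment> \<open>The complex radius is p^(1/e i), at most p; centres at distance at least 3p
    therefore give disjoint circles.\<close>
  have norm_Zi: "norm (z - of_nat (3 * p * i)) \<le> real p" if z: "z \<in> Zi i" "i < m" for z i
  proof (rule ccontr)
    assume "\<not> ?thesis"
    then have lt: "norm (z - of_nat (3 * p * i)) > real p" by simp
    have "norm (z - of_nat (3 * p * i)) ^ e i = norm ((z - of_nat (3 * p * i)) ^ e i)" by (simp only: norm_power)
    also have "\<dots> = real p" using z by (simp add: Zi_def)
    finally have e1: "norm (z - of_nat (3 * p * i)) ^ e i = real p" .
    have "real p ^ 1 \<le> real p ^ e i" using e[OF z(2)] p_pos by (intro power_increasing) auto
    also have "\<dots> < norm (z - of_nat (3 * p * i)) ^ e i" using lt e[OF z(2)] by (intro power_strict_mono) auto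
    finally show False using e1 by simp
  qed
  have disj: "Zi i \<inter> Zi j = {}" if ij: "i < m" "j < m" "i \<noteq> j" for i j
  proof (rule ccontr)
    assume "Zi i \<inter> Zi j \<noteq> {}"
    then obtain z where z: "z \<in> Zi i" "z \<in> Zi j" by blast
    have "norm (of_nat (3 * p * i) - of_nat (3 * p * j) :: complex)
      \<le> norm (z - of_nat (3 * p * j)) + norm (z - of_nat (3 * p * i))"
      using norm_triangle_ineq4[of "z - of_nat (3 * p * j)" "z - of_nat (3 * p * i)"] by simp
    also have "\<dots> \<le> 2 * real p" using norm_Zi[OF z(1) ij(1)] norm_Zi[OF z(2) ij(2)] by simp
    finally have "norm (complex_of_real (3 * real p * (real i - real j))) \<le> 2 * real p" by (simp add: algebra_simps)
    then have le: "3 * real p * \<bar>real i - real j\<bar> \<le> 2 * real p"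
      unfolding norm_of_real by (simp add: abs_mult)
    have "\<bar>real i - real j\<bar> \<ge> 1" using ij(3) by linarith
    then have "3 * real p * 1 \<le> 3 * real p * \<bar>real i - real j\<bar>" by (intro mult_left_mono) auto
    then show False using le p_pos by simp
  qed
  have finZ: "finite Z" unfolding ZU using cZi by auto
  have cardZ: "card Z = q"
    unfolding ZU using cZi disj by (subst card_UN_disjoint) (auto simp: q)
  have Zint: "algebraic_int z" if "z \<in> Z" for z
  proof -
    obtain i where i: "i < m" "(z - of_nat (3 * p * i)) ^ e i = - of_nat p" using \<open>z \<in> Z\<close> by (auto simp: ZU Zi_def)
    have "algebraic_int ((z - of_nat (3 * p * i)) ^ e i)" unfolding i(2) by (simp add: int_imp_algebraic_int)
    then have "algebraic_int (z - of_nat (3 * p * i))" using algebraic_int_power_root e[OF i(1)] by blast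
    then have "algebraic_int (z - of_nat (3 * p * i) + of_nat (3 * p * i))"
      by (rule algebraic_int_plus[OF _ int_imp_algebraic_int[OF Ints_of_nat]])
    then show ?thesis by simp
  qed
  have ZE: "Z \<subseteq> qbar" using Zint qbar_algebraic_int by auto
  define Pi where "Pi i = [:- int (3 * p * i), 1:] ^ e i + [:int p:]" for i
  have poly_Pi: "poly (map_poly of_int (Pi i)) z = (z - of_nat (3 * p * i)) ^ e i + of_nat p" for i and z :: complex
  proof -
    have "map_poly of_int (a ^ k) = (map_poly of_int a :: complex poly) ^ k" for a k
      by (induction k) (simp_all add: map_poly_of_int_mult)
    then show ?thesis by (simp add: Pi_def map_poly_of_int_add map_poly_pCons)
  qed
  have dPi: "degree (Pi i) = e i" "lead_coeff (Pi i) = 1" if "i < m" for i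
  proof -
    have d: "degree ([:- int (3 * p * i), 1:] ^ e i) = e i" by (simp add: degree_power_eq)
    then show "degree (Pi i) = e i" unfolding Pi_def using e[OF that] by (subst degree_add_eq_left) auto
    then show "lead_coeff (Pi i) = 1"
      using e[OF that] d lead_coeff_power[of "[:- int (3 * p * i), 1:]" "e i"]
      by (simp add: Pi_def coeff_pCons split: nat.split)
  qed
  define hp where "hp = (\<Prod>i<m. Pi i)"
  have Pi0: "Pi i \<noteq> 0" if "i < m" for i using dPi(2)[OF that] by auto
  have dhp: "degree hp = q" unfolding hp_def using Pi0 dPi(1) q by (subst degree_prod_eq_sum_degree) auto
  have lhp: "lead_coeff hp = 1" unfolding hp_def lead_coeff_prod using dPi(2) by (intro prod.neutral) auto
  have Zhp: "Z \<subseteq> croots hp"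
    unfolding ZU croots_def hp_def map_poly_of_int_prod by (force simp: poly_prod poly_Pi Zi_def prod_zero_iff add_eq_0_iff2)
  \<comment> \<open>Three bounds for c: 1/p keeps the leading term of z - 3pi, the distances make
    the matching unique, and the values of each factor at roots of the others later distinguish the
    primes of K.\<close>
  define W where "W = insert (inverse (real p)) ((\<lambda>(z, z'). N (z - z')) ` {(z, z'). z \<in> Z \<and> z' \<in> Z \<and> z \<noteq> z'}
    \<union> (\<lambda>(z, i). N (poly (map_poly of_int (Pi i)) z)) ` {(z, i). z \<in> Z \<and> i < m \<and> poly (map_poly of_int (Pi i)) z \<noteq> 0})"
  have finW: "finite W"
  proof -
    have "finite {(z, z'). z \<in> Z \<and> z' \<in> Z \<and> z \<noteq> z'}" by (rule finite_subset[of _ "Z \<times> Z"]) (use finZ in auto)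
    moreover have "finite {(z, i). z \<in> Z \<and> i < m \<and> poly (map_poly of_int (Pi i)) z \<noteq> 0}"
      by (rule finite_subset[of _ "Z \<times> {..<m}"]) (use finZ in auto)
    ultimately show ?thesis by (simp add: W_def)
  qed
  have posW: "a > 0" if "a \<in> W" for a
  proof -
    have "poly (map_poly of_int (Pi i)) z \<in> qbar" if "z \<in> Z" for z i
      using that Zint by (intro qbar_algebraic_int algebraic_int_poly)
    then show ?thesis using that ZE p_pos by (auto simp: W_def intro!: N_pos alg_field_diff[OF E])
  qed
  obtain c where c: "c > 0" "\<And>a. a \<in> W \<Longrightarrow> c \<le> a" by (rule finite_positive_bound[OF finW posW], simp, rule that)
  have sep: "c \<le> N (z - z')" if "z \<in> Z" "z' \<in> Z" "z \<noteq> z'" for z z'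
    using that by (intro c(2)) (auto simp: W_def)
  obtain k where k: "\<And>h. lead_coeff h = 1 \<Longrightarrow> degree h = q \<Longrightarrow> [:int p ^ k:] dvd h - hp \<Longrightarrow> finite (croots h) \<Longrightarrow>
    card (croots h) = q \<Longrightarrow> croots h \<subseteq> qbar \<Longrightarrow>
    (\<exists>m. bij_betw m Z (croots h) \<and> (\<forall>z\<in>Z. N (z - m z) < c) \<and>
      (\<forall>z\<in>Z. \<forall>r\<in>croots h. N (z - r) < c \<longrightarrow> r = m z))"
    using exists_deformation_bound[OF lhp dhp q(2) finZ cardZ Zhp ZE c(1) sep] by metis
  \<comment> \<open>Divisible by p^k and congruent to 1 modulo 4, since the square of an odd number
    is.\<close>
  define B where "B = int p ^ (2 * k)"
  define X2 where "X2 = monom 1 q + [:2::int:]"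
  have dX2: "degree X2 = q" unfolding X2_def using q(2) by (subst degree_add_eq_left) (auto simp: degree_monom_eq)
  have lX2: "coeff X2 q = 1" using q(2) by (simp add: X2_def coeff_pCons split: nat.split)
  \<comment> \<open>Congruent to \<open>hp\<close> modulo p^k and to X^q + 2 modulo 4, and still
    monic because the weights add up to 1.\<close>
  define h0 where "h0 = smult (1 - B) hp + smult B X2"
  have h0q: "coeff h0 q = 1" using lhp lX2 by (simp add: h0_def dhp)
  have dh0: "degree h0 = q"
  proof (rule antisym)
    show "degree h0 \<le> q" unfolding h0_def using dhp dX2 by (intro degree_add_le order_trans[OF degree_smult_le]) auto
  qed (use h0q in \<open>auto intro: le_degree\<close>)
  have "4 * int p ^ k > 0" using p_pos by simp
  then obtain h A where h: "lead_coeff h = 1" "degree h = q" "[:4 * int p ^ k:] dvd h - h0"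
    "finite A" "card A = q" "\<And>x::real. x \<in> A \<Longrightarrow> poly (map_poly of_int h) x = 0"
    using exists_real_rooted_congruent[of h0 q "4 * int p ^ k"] dh0 h0q q(2) by metis
  have "4 dvd 1 - B"
  proof -
    have "[int p ^ 2 = 1] (mod 4)"
    proof -
      obtain t where "p = 2 * t + 1" using p_odd by (elim oddE)
      then have "int p ^ 2 - 1 = 4 * (int t * int t + int t)" by (simp add: power2_eq_square algebra_simps)
      then show ?thesis by (simp add: cong_iff_dvd_diff)
    qed
    then have "[(int p ^ 2) ^ k = 1 ^ k] (mod 4)" by (rule cong_pow)
    then have "[1 = B] (mod 4)" by (simp add: B_def power_mult cong_sym)
    then show ?thesis by (simp add: cong_iff_dvd_diff)
  qed
  then have "[:4:] dvd smult (1 - B) (hp - X2)" by (simp add: const_poly_dvd_iff)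
  moreover have "[:4:] dvd h - h0" using h(3) by (rule dvd_trans[rotated]) (simp add: const_poly_dvd_const_poly_iff)
  ultimately have "[:4:] dvd (h - h0) + smult (1 - B) (hp - X2)" by (intro dvd_add)
  moreover have "(h - h0) + smult (1 - B) (hp - X2) = h - X2"
    by (simp add: h0_def smult_diff_right smult_diff_left algebra_simps)
  ultimately have h4: "[:4:] dvd h - X2" by simp
  have "[:int p ^ k:] dvd smult B (X2 - hp)" by (simp add: const_poly_dvd_iff B_def mult_2 power_add)
  moreover have "[:int p ^ k:] dvd h - h0" using h(3) by (rule dvd_trans[rotated]) (simp add: const_poly_dvd_const_poly_iff)
  ultimately have "[:int p ^ k:] dvd (h - h0) + smult B (X2 - hp)" by (intro dvd_add)
  moreover have "(h - h0) + smult B (X2 - hp) = h - hp"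
    by (simp add: h0_def smult_diff_right smult_diff_left algebra_simps)
  ultimately have hk: "[:int p ^ k:] dvd h - hp" by simp
  have R: "croots h = of_real ` A" using h by (intro real_roots_croots) auto
  have RE: "croots h \<subseteq> qbar" using algebraic_int_croots[OF h(1)] qbar_algebraic_int by auto
  have cR: "card (croots h) = q" unfolding R using h(5) by (simp add: card_image inj_on_def)
  obtain theta where th: "bij_betw theta Z (croots h)" "\<forall>z\<in>Z. N (z - theta z) < c"
    "\<forall>z\<in>Z. \<forall>r\<in>croots h. N (z - r) < c \<longrightarrow> r = theta z"
    using k[OF h(1,2) hk _ cR RE] h(4) R by auto
  show ?thesis
  proof (rule that[OF h(1,2) _ cR h4[unfolded X2_def]])
    show "croots h \<subseteq> \<real>" unfolding R by auto
    show "c \<le> inverse (real p)" by (rule c(2)) (simp add: W_def)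
    show "c \<le> N ((z - of_nat (3 * p * i)) ^ e i + of_nat p)"
      if "z \<in> Zset m e" "i < m" "(z - of_nat (3 * p * i)) ^ e i + of_nat p \<noteq> 0" for z i
    proof (rule c(2))
      show "N ((z - of_nat (3 * p * i)) ^ e i + of_nat p) \<in> W"
        unfolding W_def poly_Pi using that by (auto simp: Z_def image_iff intro!: bexI[of _ "(z, i)"] exI[of _ z] exI[of _ i])
    qed
    show "i = j" if "i < m" "j < m" "(z - of_nat (3 * p * i)) ^ e i = - of_nat p"
      "(z - of_nat (3 * p * j)) ^ e j = - of_nat p" for z :: complex and i j
    proof (rule ccontr)
      assume "i \<noteq> j"
      moreover have "z \<in> Zi i" "z \<in> Zi j" unfolding Zi_def mem_Collect_eq by (fact that)+
      ultimately show False using disj[OF that(1,2)] by blast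
    qed
  qed (use th finZ Zint in \<open>auto simp: Z_def\<close>)
qed

end

text \<open>An element of value l^(-1/b) has its n-th power of integral exponent only if b divides
  n. Combined with norms, this bounds orders of Galois groups from below.\<close>

lemma (in absval) exponent_dvd:
  assumes "N x ^ b = inverse (real l)" "N x ^ n = real l powi k"
  shows "b dvd n"
proof -
  have "real l powi (k * int b) = (N x ^ n) ^ b" by (simp add: assms(2) power_int_mult)
  also have "\<dots> = (N x ^ b) ^ n" by (simp add: mult.commute flip: power_mult)
  also have "\<dots> = real l powi (- int n)" by (simp add: assms(1) power_int_minus power_inverse)
  finally have "k * int b = - int n" by (rule power_int_inj_real[OF l_gt_1])
  then have "int b dvd int n" by (metis dvd_minus_iff dvd_triv_right)
  then show ?thesis by simp
qed

lemma funpow_fixed_mult: "(\<tau> ^^ d) x = x \<Longrightarrow> (\<tau> ^^ (a * d)) x = x"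
  by (induction a) (simp_all add: funpow_add)

text \<open>A repetition within the first q iterates would make x fixed by two iterates of coprime
  order, hence by \<open>\<tau>\<close> itself (Bezout).\<close>

lemma prime_order_orbit:
  assumes q: "Factorial_Ring.prime (q::nat)" and Y: "finite Y" "\<tau> ` Y \<subseteq> Y" "inj_on \<tau> Y"
    and x: "x \<in> Y" "(\<tau> ^^ q) x = x" "\<tau> x \<noteq> x"
  shows "card ((\<lambda>i. (\<tau> ^^ i) x) ` {..<q}) = q" "(\<lambda>i. (\<tau> ^^ i) x) ` {..<q} \<subseteq> Y"
proof -
  have cl: "(\<tau> ^^ i) y \<in> Y" if "y \<in> Y" for i y
    by (induction i) (use that Y(2) in auto)
  have inji: "inj_on (\<tau> ^^ i) Y" for i
  proof (induction i)
    case (Suc i)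
    show ?case
    proof (rule inj_onI)
      fix a b assume ab: "a \<in> Y" "b \<in> Y" "(\<tau> ^^ Suc i) a = (\<tau> ^^ Suc i) b"
      then have "(\<tau> ^^ i) a = (\<tau> ^^ i) b" using inj_onD[OF Y(3) _ cl[OF ab(1)] cl[OF ab(2)]] by simp
      then show "a = b" using inj_onD[OF Suc] ab by blast
    qed
  qed simp
  have ne: "(\<tau> ^^ i) x \<noteq> (\<tau> ^^ j) x" if "i < j" "j < q" for i j
  proof
    assume eq: "(\<tau> ^^ i) x = (\<tau> ^^ j) x"
    define d where "d = j - i"
    have "(\<tau> ^^ j) x = (\<tau> ^^ i) ((\<tau> ^^ d) x)"
      using that(1) by (metis comp_apply funpow_add le_add_diff_inverse less_imp_le d_def)
    then have dx: "(\<tau> ^^ d) x = x" using eq inj_onD[OF inji[of i]] cl x(1) by metis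
    have "d > 0" "d < q" using that by (auto simp: d_def)
    then have "coprime d q" using q by (metis coprime_commute nat_dvd_not_less prime_imp_coprime)
    then obtain a b where ab: "a * d = b * q + 1"
      using bezout_nat[of d q] \<open>d > 0\<close> by (auto simp: mult.commute)
    have "(\<tau> ^^ (b * q)) x = x" by (rule funpow_fixed_mult[OF x(2)])
    moreover have "(\<tau> ^^ (b * q + 1)) x = x" using funpow_fixed_mult[OF dx, of a] ab by simp
    ultimately show False using x(3) by simp
  qed
  have "inj_on (\<lambda>i. (\<tau> ^^ i) x) {..<q}"
  proof (rule inj_onI)
    fix i j assume "i \<in> {..<q}" "j \<in> {..<q}" "(\<tau> ^^ i) x = (\<tau> ^^ j) x"
    then show "i = j" using ne[of i j] ne[of j i] by (cases i j rule: linorder_cases) auto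
  qed
  then show "card ((\<lambda>i. (\<tau> ^^ i) x) ` {..<q}) = q" by (simp add: card_image)
  show "(\<lambda>i. (\<tau> ^^ i) x) ` {..<q} \<subseteq> Y" using cl x(1) by auto
qed

section \<open>The extension \<open>L / K\<close>\<close>

text \<open>
  The maps \<open>lam\<close>, \<open>alpha\<close> and \<open>theta\<close> pair the roots of \<open>X\<^bsup>p - 1\<^esup> + p\<close>, \<open>f\<close> and \<open>h\<close> with the
  unique \<open>p\<close>-adically close numbers \<open>\<zeta>\<^sup>a - 1\<close>, \<open>\<zeta>\<^sup>j p\<^bsup>1/p\<^esup>\<close> and elements of \<open>Zset\<close>.
\<close>

locale tower = padic +
  fixes m :: nat and e :: "nat \<Rightarrow> nat" and q :: nat and f h :: "int poly"
    and alpha :: "nat \<Rightarrow> complex" and theta :: "complex \<Rightarrow> complex" and c :: real and lam :: "nat \<Rightarrow> complex"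
  assumes lam_bij: "bij_betw lam {1..<p} {s. s ^ (p - 1) = - of_nat p}"
    and lam_near: "a \<in> {1..<p} \<Longrightarrow> N (zeta ^ a - 1 - lam a) < pp"
    and lam_unique: "a \<in> {1..<p} \<Longrightarrow> s ^ (p - 1) = - of_nat p \<Longrightarrow> N (zeta ^ a - 1 - s) < pp \<Longrightarrow> s = lam a"
    and f: "lead_coeff f = 1" "degree f = p" "croots f \<subseteq> \<real>"
    and alpha_bij: "bij_betw alpha {..<p} (croots f)"
    and alpha_near: "j < p \<Longrightarrow> N (zeta ^ j * proot - alpha j) < N proot * pp"
    and alpha_unique: "j < p \<Longrightarrow> s \<in> croots f \<Longrightarrow> N (zeta ^ j * proot - s) < N proot * pp \<Longrightarrow> s = alpha j"
    and h: "lead_coeff h = 1" "degree h = q" "croots h \<subseteq> \<real>" "card (croots h) = q"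
    and h_mod4: "[:4:] dvd h - (monom 1 q + [:2:])"
    and Z_finite: "finite (Zset m e)" and Z_int: "z \<in> Zset m e \<Longrightarrow> algebraic_int z"
    and theta_bij: "bij_betw theta (Zset m e) (croots h)"
    and theta_near: "z \<in> Zset m e \<Longrightarrow> N (z - theta z) < c"
    and theta_unique: "z \<in> Zset m e \<Longrightarrow> s \<in> croots h \<Longrightarrow> N (z - s) < c \<Longrightarrow> s = theta z"
    and Z_disjoint: "i < m \<Longrightarrow> j < m \<Longrightarrow> ((z::complex) - of_nat (3 * p * i)) ^ e i = - of_nat p \<Longrightarrow>
      (z - of_nat (3 * p * j)) ^ e j = - of_nat p \<Longrightarrow> i = j"
    and c_le: "c \<le> inverse (real p)"
    and c_sep: "z \<in> Zset m e \<Longrightarrow> i < m \<Longrightarrow> (z - of_nat (3 * p * i)) ^ e i + of_nat p \<noteq> 0 \<Longrightarrow>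
      c \<le> N ((z - of_nat (3 * p * i)) ^ e i + of_nat p)"
    and e_dvd: "i < m \<Longrightarrow> e i dvd p - 1"
    and q: "Factorial_Ring.prime q" "q > p"
begin

text \<open>Besides f and h it contains the model polynomials X^p - p and X^(p-1) + p, so that both
  members of each near pair lie in \<open>F\<close> and automorphisms can be applied to their
  difference.\<close>

definition Q :: "complex poly" where
  "Q = map_poly of_int ((monom 1 p - [:int p:]) * (monom 1 (p - 1) + [:int p:]) * f * h)"
definition F where "F = gen \<rat> {s. poly Q s = 0}"
definition G where "G = auts F \<rat>"

lemma lam_root: "a \<in> {1..<p} \<Longrightarrow> lam a ^ (p - 1) = - of_nat p"
  using lam_bij by (auto simp: bij_betw_def)

lemma Q_roots: "poly Q s = 0 \<longleftrightarrow> (\<exists>j<p. s = zeta ^ j * proot) \<or> (\<exists>a\<in>{1..<p}. s = lam a) \<or> s \<in> croots f \<or> s \<in> croots h"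
proof -
  have "poly (map_poly of_int (monom 1 (p - 1) + [:int p:])) s = s ^ (p - 1) + of_nat p"
    by (simp add: map_poly_of_int_add map_poly_monom map_poly_pCons poly_monom)
  moreover have "s ^ (p - 1) + of_nat p = 0 \<longleftrightarrow> s \<in> lam ` {1..<p}"
    using lam_bij by (simp add: bij_betw_def add_eq_0_iff2)
  moreover have "poly (map_poly of_int (monom 1 p - [:int p:])) s = 0 \<longleftrightarrow> s \<in> (\<lambda>j. zeta ^ j * proot) ` {..<p}"
    using Xp_roots by (auto simp: croots_def)
  ultimately show ?thesis
    by (auto simp: Q_def map_poly_of_int_mult croots_def)
qed

lemma Q_nz: "Q \<noteq> 0"
proof
  assume Q0: "Q = 0"
  let ?R = "(\<lambda>j. zeta ^ j * proot) ` {..<p} \<union> lam ` {1..<p} \<union> croots f \<union> croots h"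
  have "finite (croots f)" "finite (croots h)"
    using h(4) q(2) bij_betw_finite[OF alpha_bij] by (auto intro: card_ge_0_finite)
  then have "finite ?R" by auto
  moreover have "s \<in> ?R" for s using Q_roots[of s] Q0 by auto
  ultimately have "finite (UNIV :: complex set)" by (metis finite_subset subsetI)
  then show False using infinite_UNIV_char_0 by blast
qed

sublocale S: splitting Q F G
  by unfold_locales (auto simp: Q_nz F_def G_def, simp add: Q_def coeff_map_poly)

lemma F_qbar: "F \<subseteq> qbar"
  using alg_field_algebraic[OF S.alg_E] by (auto simp: qbar_def)

sublocale D: decomposition Q F G N p
  by (intro decomposition.intro S.splitting_axioms absval_mono[OF absval_axioms S.alg_E F_qbar])

lemma root_F: "j < p \<Longrightarrow> zeta ^ j * proot \<in> F" "a \<in> {1..<p} \<Longrightarrow> lam a \<in> F"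
    "s \<in> croots f \<Longrightarrow> s \<in> F" "s \<in> croots h \<Longrightarrow> s \<in> F"
  by (rule S.roots_E, auto simp: Q_roots)+

lemma proot_F: "proot \<in> F" using root_F(1)[of 0] p_pos by simp

lemma zeta_F: "zeta ^ k \<in> F"
proof -
  have "zeta * proot \<in> F" using root_F(1)[of 1] p_gt_2 by simp
  then have "zeta * proot / proot \<in> F" using alg_field_divide[OF S.alg_E _ proot_F] by blast
  then have "zeta \<in> F" using proot_nonzero by simp
  then show ?thesis by (rule alg_field_pow[OF S.alg_E])
qed

lemma zp_F: "zeta ^ k * proot \<in> F" by (rule alg_field_mult[OF S.alg_E zeta_F proot_F])

lemma alpha_F: "j < p \<Longrightarrow> alpha j \<in> F" and alpha_root: "j < p \<Longrightarrow> alpha j \<in> croots f"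
  using alpha_bij root_F(3) by (auto simp: bij_betw_def)

lemma theta_root: "z \<in> Zset m e \<Longrightarrow> theta z \<in> croots h" and theta_F: "z \<in> Zset m e \<Longrightarrow> theta z \<in> F"
  using theta_bij root_F(4) by (auto simp: bij_betw_def)

definition d where "d i = (p - 1) div e i"

lemma e_d: "i < m \<Longrightarrow> e i * d i = p - 1" using e_dvd by (simp add: d_def)

lemma e_pos: "i < m \<Longrightarrow> e i > 0" and d_pos: "i < m \<Longrightarrow> d i > 0" and d_le: "i < m \<Longrightarrow> d i \<le> p - 1"
proof -
  assume i: "i < m"
  have *: "e i * d i = p - 1" "p - 1 > 0" using e_d[OF i] p_gt_2 by auto
  show "e i > 0" "d i > 0" using * by (auto intro: Nat.gr0I)
  then show "d i \<le> p - 1" using *(1) by (metis dvd_imp_le *(2) dvd_triv_right)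
qed

lemma Zset_mem: "i < m \<Longrightarrow> a \<in> {1..<p} \<Longrightarrow> of_nat (3 * p * i) + lam a ^ d i \<in> Zset m e"
  using lam_root[of a] e_d[of i] by (auto simp: Zset_def intro!: exI[of _ i] simp flip: power_mult simp: mult.commute)

text \<open>Any d-th root y of z - 3pi satisfies y^(p-1) = - p, because e d = p - 1; so y is one of
  the \<open>lam a\<close>.\<close>

lemma Zset_cases:
  assumes "i < m" "(z - of_nat (3 * p * i)) ^ e i = - of_nat p"
  obtains a where "a \<in> {1..<p}" "z = of_nat (3 * p * i) + lam a ^ d i"
proof -
  define w where "w = z - of_nat (3 * p * i)"
  have "degree (monom 1 (d i) + [:- w:]) = d i"
    using d_pos[OF assms(1)] by (subst degree_add_eq_left) (auto simp: degree_monom_eq)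
  then obtain y where "poly (monom 1 (d i) + [:- w:]) y = 0"
    using complex_poly_root[of "monom 1 (d i) + [:- w:]"] d_pos[OF assms(1)] by auto
  then have y: "y ^ d i = w" by (simp add: poly_monom)
  have "y ^ (p - 1) = (y ^ d i) ^ e i" using e_d[OF assms(1)] by (simp add: mult.commute flip: power_mult)
  then have "y ^ (p - 1) = - of_nat p" using y assms(2) by (simp add: w_def)
  then have "y \<in> lam ` {1..<p}" using lam_bij by (auto simp: bij_betw_def)
  then obtain a where "a \<in> {1..<p}" "y = lam a" by blast
  then show ?thesis using that[of a] y by (simp add: w_def)
qed

lemma Zset_F: "z \<in> Zset m e \<Longrightarrow> z \<in> F"
proof -
  assume "z \<in> Zset m e"
  then obtain i where i: "i < m" "(z - of_nat (3 * p * i)) ^ e i = - of_nat p" by (auto simp: Zset_def)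
  then obtain a where "a \<in> {1..<p}" "z = of_nat (3 * p * i) + lam a ^ d i" by (rule Zset_cases)
  then show "z \<in> F"
    by (auto intro!: alg_field_add[OF S.alg_E] alg_field_of_nat[OF S.alg_E] alg_field_pow[OF S.alg_E] root_F(2)
      simp del: of_nat_mult)
qed

text \<open>On the roots \<open>zeta ^ j * proot\<close> of X^p - p such an automorphism acts as the
  affine map j -> u j + v: u is the slope, v the translation.\<close>

definition has_params :: "(complex \<Rightarrow> complex) \<Rightarrow> nat \<Rightarrow> nat \<Rightarrow> bool"
  where "has_params g u v \<longleftrightarrow> u \<in> {1..<p} \<and> v < p \<and> g zeta = zeta ^ u \<and> g proot = zeta ^ v * proot"

lemma G_params: assumes g: "g \<in> G" obtains u v where "has_params g u v"
proof -
  note gh = S.G_fhom[OF g]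
  have zF: "zeta \<in> F" using zeta_F[of 1] by simp
  have "g zeta ^ p = 1"
    using fhom_pow[OF S.alg_E gh zF, of p] fhom_1[OF S.alg_E gh] by (simp add: zeta_power_p)
  then obtain u where u: "u < p" "g zeta = zeta ^ u" by (rule root_of_unity_obtain)
  have "u \<noteq> 0"
  proof
    assume "u = 0"
    then have "g zeta = g 1" using u fhom_1[OF S.alg_E gh] by simp
    then have "zeta = 1" using inj_onD[OF S.G_inj[OF g] _ zF alg_field_1[OF S.alg_E]] by blast
    then show False using zeta_neq_1[of 1] p_gt_2 by simp
  qed
  have "g proot ^ p = of_nat p"
    using fhom_pow[OF S.alg_E gh proot_F, of p] fhom_Rats[OF S.alg_E gh Rats_of_nat, of p]
    unfolding proot_power by simp
  then have "(g proot / proot) ^ p = 1"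
    using p_pos by (simp add: proot_power power_divide)
  then obtain v where v: "v < p" "g proot / proot = zeta ^ v" by (rule root_of_unity_obtain)
  then have "g proot = zeta ^ v * proot" using proot_nonzero by (simp add: field_simps)
  then show ?thesis using that[of u v] u v \<open>u \<noteq> 0\<close> by (simp add: has_params_def)
qed

lemma params_zeta: "g \<in> G \<Longrightarrow> has_params g u v \<Longrightarrow> g (zeta ^ k) = zeta ^ (u * k)"
  using fhom_pow[OF S.alg_E S.G_fhom, of g zeta k] zeta_F[of 1] by (simp add: has_params_def power_mult)

lemma params_zp: "g \<in> G \<Longrightarrow> has_params g u v \<Longrightarrow> g (zeta ^ k * proot) = zeta ^ ((u * k + v) mod p) * proot"
  using fhom_mult[OF S.alg_E S.G_fhom zeta_F proot_F, of g k] params_zeta[of g u v k]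
  by (simp add: has_params_def zeta_mod power_add)

lemma mod_range: "u \<in> {1..<p} \<Longrightarrow> a \<in> {1..<p} \<Longrightarrow> u * a mod p \<in> {1..<p}"
proof -
  assume *: "u \<in> {1..<p}" "a \<in> {1..<p}"
  then have "\<not> p dvd u" "\<not> p dvd a" by (auto dest: dvd_imp_le)
  then have "\<not> p dvd u * a" using prime_dvd_mult_iff[OF l] by blast
  then show ?thesis using p_pos by (simp add: dvd_eq_mod_eq_0 Suc_le_eq)
qed

lemma fhom_croots: assumes "s \<in> croots w" "s \<in> F" "g \<in> G" shows "g s \<in> croots w"
  using fhom_poly_Rats[OF S.alg_E S.G_fhom[OF assms(3)] _ assms(2), of "map_poly of_int w"] assms(1)
    fhom_0[OF S.alg_E S.G_fhom[OF assms(3)]] by (simp add: croots_def coeff_map_poly)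

context
  fixes \<delta> u v assumes \<delta>: "\<delta> \<in> D.\<Delta>" and par: "has_params \<delta> u v"
begin

lemma \<delta>_G: "\<delta> \<in> G" using \<delta> D.\<Delta>_G by blast

lemma u_range: "u \<in> {1..<p}" using par by (simp add: has_params_def)

text \<open>As \<open>\<delta>\<close> preserves \<open>N\<close>, it carries near pairs to near
  pairs, and the partner of \<open>zeta ^ (u * a mod p) - 1\<close> is unique. The roots of f and h
  are treated in the same way.\<close>

lemma params_lam: assumes a: "a \<in> {1..<p}" shows "\<delta> (lam a) = lam (u * a mod p)"
proof (rule lam_unique[OF mod_range[OF u_range a]])
  note dh = S.G_fhom[OF \<delta>_G]
  have 1: "zeta ^ a - 1 \<in> F" by (intro alg_field_diff[OF S.alg_E] zeta_F alg_field_1[OF S.alg_E])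
  have "\<delta> (zeta ^ a - 1 - lam a) = zeta ^ (u * a mod p) - 1 - \<delta> (lam a)"
    using fhom_diff[OF S.alg_E dh 1 root_F(2)[OF a]] fhom_diff[OF S.alg_E dh zeta_F alg_field_1[OF S.alg_E], of a]
      fhom_1[OF S.alg_E dh] params_zeta[OF \<delta>_G par, of a] by (simp add: zeta_mod)
  then show "N (zeta ^ (u * a mod p) - 1 - \<delta> (lam a)) < pp"
    using D.\<Delta>_N[OF \<delta> alg_field_diff[OF S.alg_E 1 root_F(2)[OF a]]] lam_near[OF a] by simp
  show "\<delta> (lam a) ^ (p - 1) = - of_nat p"
    using fhom_pow[OF S.alg_E dh root_F(2)[OF a], of "p - 1"] lam_root[OF a] fhom_Rats[OF S.alg_E dh, of "- of_nat p"] by simp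
qed

lemma params_alpha: assumes j: "j < p" shows "\<delta> (alpha j) = alpha ((u * j + v) mod p)"
proof (rule alpha_unique)
  show "(u * j + v) mod p < p" using p_pos by simp
  show "\<delta> (alpha j) \<in> croots f" by (rule fhom_croots[OF alpha_root[OF j] alpha_F[OF j] \<delta>_G])
  have "\<delta> (zeta ^ j * proot - alpha j) = zeta ^ ((u * j + v) mod p) * proot - \<delta> (alpha j)"
    using fhom_diff[OF S.alg_E S.G_fhom[OF \<delta>_G] zp_F alpha_F[OF j]] params_zp[OF \<delta>_G par] by simp
  then show "N (zeta ^ ((u * j + v) mod p) * proot - \<delta> (alpha j)) < N proot * pp"
    using D.\<Delta>_N[OF \<delta> alg_field_diff[OF S.alg_E zp_F alpha_F[OF j]], of j] alpha_near[OF j] by simp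
qed

lemma params_Z: assumes "i < m" "a \<in> {1..<p}"
  shows "\<delta> (of_nat (3 * p * i) + lam a ^ d i) = of_nat (3 * p * i) + lam (u * a mod p) ^ d i"
proof -
  note dh = S.G_fhom[OF \<delta>_G]
  have "\<delta> (of_nat (3 * p * i) + lam a ^ d i) = \<delta> (of_nat (3 * p * i)) + \<delta> (lam a) ^ d i"
    using fhom_add[OF S.alg_E dh alg_field_of_nat[OF S.alg_E] alg_field_pow[OF S.alg_E root_F(2)[OF assms(2)]]]
      fhom_pow[OF S.alg_E dh root_F(2)[OF assms(2)]] by (simp del: of_nat_mult)
  then show ?thesis
    using params_lam[OF assms(2)] fhom_Rats[OF S.alg_E dh Rats_of_nat, of "3 * p * i"] by (simp del: of_nat_mult)
qed

lemma params_theta: assumes z: "z \<in> Zset m e" shows "\<delta> (theta z) = theta (\<delta> z)" "\<delta> z \<in> Zset m e"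
proof -
  note dh = S.G_fhom[OF \<delta>_G]
  obtain i where i: "i < m" "(z - of_nat (3 * p * i)) ^ e i = - of_nat p" using z by (auto simp: Zset_def)
  then obtain a where a: "a \<in> {1..<p}" "z = of_nat (3 * p * i) + lam a ^ d i" by (rule Zset_cases)
  show dz: "\<delta> z \<in> Zset m e" using params_Z[OF i(1) a(1)] Zset_mem[OF i(1) mod_range[OF u_range a(1)]] a(2) by simp
  show "\<delta> (theta z) = theta (\<delta> z)"
  proof (rule theta_unique[OF dz])
    show "\<delta> (theta z) \<in> croots h" by (rule fhom_croots[OF theta_root[OF z] theta_F[OF z] \<delta>_G])
    have "\<delta> (z - theta z) = \<delta> z - \<delta> (theta z)"
      using fhom_diff[OF S.alg_E dh Zset_F[OF z] theta_F[OF z]] .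
    then show "N (\<delta> z - \<delta> (theta z)) < c"
      using D.\<Delta>_N[OF \<delta> alg_field_diff[OF S.alg_E Zset_F[OF z] theta_F[OF z]]] theta_near[OF z] by simp
  qed
qed

end

text \<open>Slope and translation determine the action on the model roots, and by the matchings on
  all roots of \<open>Q\<close>. This is the upper bound p (p - 1) for the order of
  \<open>\<Delta>\<close>.\<close>

lemma params_inj:
  assumes "\<delta> \<in> D.\<Delta>" "\<delta>' \<in> D.\<Delta>" "has_params \<delta> u v" "has_params \<delta>' u v"
  shows "\<delta> = \<delta>'"
proof (rule S.G_eqI)
  show G: "\<delta> \<in> G" "\<delta>' \<in> G" using assms D.\<Delta>_G by auto
  fix s assume "poly Q s = 0"
  then consider j where "j < p" "s = zeta ^ j * proot" | a where "a \<in> {1..<p}" "s = lam a"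
    | "s \<in> croots f" | "s \<in> croots h"
    by (auto simp: Q_roots)
  then show "\<delta> s = \<delta>' s"
  proof cases
    case (1 j)
    then show ?thesis using params_zp[OF G(1) assms(3)] params_zp[OF G(2) assms(4)] by simp
  next
    case (2 a)
    then show ?thesis using params_lam[OF assms(1,3)] params_lam[OF assms(2,4)] by simp
  next
    case 3
    then obtain j where "j < p" "s = alpha j" using alpha_bij by (auto simp: bij_betw_def)
    then show ?thesis using params_alpha[OF assms(1,3)] params_alpha[OF assms(2,4)] by simp
  next
    case 4
    then obtain z where z: "z \<in> Zset m e" "s = theta z" using theta_bij by (auto simp: bij_betw_def)
    then obtain i where i: "i < m" "(z - of_nat (3 * p * i)) ^ e i = - of_nat p" by (auto simp: Zset_def)
    then obtain a where "a \<in> {1..<p}" "z = of_nat (3 * p * i) + lam a ^ d i" by (rule Zset_cases)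
    then have "\<delta> z = \<delta>' z" using params_Z[OF assms(1,3) i(1)] params_Z[OF assms(2,4) i(1)] by simp
    then show ?thesis using params_theta(1)[OF assms(1,3) z(1)] params_theta(1)[OF assms(2,4) z(1)] z(2) by simp
  qed
qed

lemma lam_sim: "a \<in> {1..<p} \<Longrightarrow> sim (lam a) (zeta ^ a - 1)"
proof -
  assume a: "a \<in> {1..<p}"
  have ne: "zeta ^ a \<noteq> 1" using a by (intro zeta_neq_1) auto
  have E1: "lam a \<in> qbar" "zeta ^ a - 1 \<in> qbar"
    using root_F(2)[OF a] F_qbar N_one_minus_root_of_unity(4)[OF zeta_pow_pow ne] by auto
  then show ?thesis
    using lam_near[OF a] N_diff_commute[OF E1] N_root_of_unity_minus_1[OF zeta_pow_pow ne] by (simp add: sim_def)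
qed

lemma N_lam: "a \<in> {1..<p} \<Longrightarrow> N (lam a) = pp"
  using sim_N[OF lam_sim] N_root_of_unity_minus_1[OF zeta_pow_pow zeta_neq_1] by simp

text \<open>The element \<open>proot\<close> of value p^(-1/p) and \<open>lam 1\<close> of value
  p^(-1/(p-1)) force p and p - 1 to divide the order; with the upper bound every pair of parameters
  must occur.\<close>

lemma card_\<Delta>: "card D.\<Delta> = p * (p - 1)"
  and exists_params: "u \<in> {1..<p} \<Longrightarrow> v < p \<Longrightarrow> \<exists>\<delta>\<in>D.\<Delta>. has_params \<delta> u v"
proof -
  have "\<forall>\<delta>\<in>D.\<Delta>. \<exists>uv. has_params \<delta> (fst uv) (snd uv)"
    using G_params D.\<Delta>_G by (metis fst_conv snd_conv subsetD)
  then obtain w where w: "\<And>\<delta>. \<delta> \<in> D.\<Delta> \<Longrightarrow> has_params \<delta> (fst (w \<delta>)) (snd (w \<delta>))" by metis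
  have inj: "inj_on w D.\<Delta>"
  proof (rule inj_onI)
    fix a b assume "a \<in> D.\<Delta>" "b \<in> D.\<Delta>" "w a = w b"
    then show "a = b" using params_inj w by metis
  qed
  have "w \<delta> \<in> {1..<p} \<times> {..<p}" if "\<delta> \<in> D.\<Delta>" for \<delta>
    using w[OF that] by (cases "w \<delta>") (auto simp: has_params_def)
  then have sub: "w ` D.\<Delta> \<subseteq> {1..<p} \<times> {..<p}" by blast
  have c0: "card ({1..<p} \<times> {..<p}) = p * (p - 1)" by (simp add: mult.commute)
  have "card D.\<Delta> \<le> card ({1..<p} \<times> {..<p})" by (rule card_inj_on_le[OF inj sub]) simp
  then have le: "card D.\<Delta> \<le> p * (p - 1)" unfolding c0 .
  have 1: "p dvd card D.\<Delta>"
    using D.value_power_card_\<Delta>[OF proot_F proot_nonzero] exponent_dvd[OF N_proot(1)] by blast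
  have one: "1 \<in> {1..<p}" using p_gt_2 by simp
  have "lam 1 \<noteq> 0" using lam_root[OF one] p_gt_2 by (auto simp: power_0_left)
  moreover have "N (lam 1) ^ (p - 1) = inverse (real p)" using N_lam[OF one] pp_power by simp
  ultimately have 2: "(p - 1) dvd card D.\<Delta>"
    using D.value_power_card_\<Delta>[OF root_F(2)[OF one]] exponent_dvd by blast
  have "coprime p (p - 1)" using coprime_diff_one_right_nat[OF p_pos] by simp
  then have "p * (p - 1) dvd card D.\<Delta>" using 1 2 by (simp add: divides_mult)
  then have "p * (p - 1) \<le> card D.\<Delta>" using D.card_\<Delta>_pos by (intro dvd_imp_le)
  then show cD: "card D.\<Delta> = p * (p - 1)" using le by simp
  have "w ` D.\<Delta> = {1..<p} \<times> {..<p}"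
    by (rule card_subset_eq[OF _ sub]) (use card_image[OF inj] cD c0 in auto)
  then show "\<exists>\<delta>\<in>D.\<Delta>. has_params \<delta> u v" if "u \<in> {1..<p}" "v < p"
  proof -
    have "(u, v) \<in> w ` D.\<Delta>" using \<open>w ` D.\<Delta> = _\<close> that by simp
    then obtain \<delta> where "\<delta> \<in> D.\<Delta>" "w \<delta> = (u, v)" by force
    then show ?thesis using w[of \<delta>] by auto
  qed
qed

lemma residue_trivial:
  assumes "\<delta> \<in> D.\<Delta>" "y \<in> F" "N y \<le> 1" shows "N (\<delta> y - y) < 1"
proof -
  have one: "1 \<in> {1..<p}" using p_gt_2 by simp
  \<comment> \<open>A uniformizer: its value is p to the power 1/p - 1/(p-1) = - 1/(p
    (p-1)).\<close>
  let ?r = "lam 1 / proot"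
  have rF: "?r \<in> F" by (rule alg_field_divide[OF S.alg_E root_F(2)[OF one] proot_F])
  have "N ?r ^ card D.\<Delta> = (N (lam 1) ^ (p - 1)) ^ p / (N proot ^ p) ^ (p - 1)"
    using N_divide[of "lam 1" proot] root_F(2)[OF one] F_qbar proot_E
    by (auto simp: card_\<Delta> power_divide mult.commute simp flip: power_mult)
  also have "\<dots> = inverse (real p) ^ p / inverse (real p) ^ (p - 1)"
    using N_lam[OF one] pp_power N_proot(1) by simp
  also have "\<dots> = inverse (real p)"
  proof -
    have "inverse (real p) ^ p = inverse (real p) * inverse (real p) ^ (p - 1)"
      using p_pos by (metis Suc_diff_1 power_Suc)
    then show ?thesis using p_pos by simp
  qed
  finally show ?thesis using D.totally_ramified_residue[OF rF _ assms(2,3,1)] by simp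
qed

end

lemma gen_image:
  assumes E: "alg_field (gen \<rat> S)" and g: "fhom (gen \<rat> S) g" and S: "g ` S = S"
  shows "g ` gen \<rat> S = gen \<rat> S"
proof
  have "g x \<in> gen \<rat> S" if "x \<in> gen \<rat> S" for x
  proof (rule fhom_image_gen[OF E g subrng_gen _ _ that])
    show "g x \<in> gen \<rat> S" if "x \<in> \<rat>" for x using fhom_Rats[OF E g that] gen_base[of \<rat> S] that by auto
    show "g x \<in> gen \<rat> S" if "x \<in> S" for x using S that gen_mem[of S \<rat>] by auto
  qed
  then show "g ` gen \<rat> S \<subseteq> gen \<rat> S" by blast
  have "subrng (g ` gen \<rat> S)"
    unfolding subrng_def
  proof (intro conjI ballI)
    show "1 \<in> g ` gen \<rat> S" using fhom_1[OF E g] alg_field_1[OF E] by (metis image_eqI)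
    fix a b assume "a \<in> g ` gen \<rat> S" "b \<in> g ` gen \<rat> S"
    then obtain x y where xy: "x \<in> gen \<rat> S" "y \<in> gen \<rat> S" "a = g x" "b = g y" by blast
    then have "a - b = g (x - y)" "a * b = g (x * y)"
      using fhom_diff[OF E g] fhom_mult[OF E g] by auto
    then show "a - b \<in> g ` gen \<rat> S" "a * b \<in> g ` gen \<rat> S"
      using alg_field_diff[OF E xy(1,2)] alg_field_mult[OF E xy(1,2)] by auto
  qed
  moreover have "\<rat> \<subseteq> g ` gen \<rat> S"
    using fhom_Rats[OF E g] gen_base[of \<rat> S] by (metis image_iff subsetD subsetI)
  moreover have "S \<subseteq> g ` gen \<rat> S" using S gen_mem[of S \<rat>] by blast
  ultimately show "gen \<rat> S \<subseteq> g ` gen \<rat> S" by (rule gen_minimal)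
qed

section \<open>An automorphism of order q moving the roots of h\<close>

context tower
begin

text \<open>Every root of h has 2-adic value 2^(-1/q). The rational norm of a root over
  \<open>G\<close> has that value to the power of the order of \<open>G\<close>, so q divides the
  order.\<close>

lemma q_dvd_card_G: "q dvd card G"
proof -
  obtain N2 where "absval qbar N2 2" using exists_absval_qbar[OF two_is_prime_nat] by blast
  then interpret N2: absval F N2 2 by (rule absval_mono[OF _ S.alg_E F_qbar])
  have Nh: "N2 s ^ q = inverse (real 2)" if s: "s \<in> croots h" for s
  proof -
    have sF: "s \<in> F" by (rule root_F(4)[OF s])
    \<comment> \<open>Modulo 4 rather than 2, so that the error has value at most 1/4, below the
      value 1/2 of the constant term.\<close>
    have "[:int 2 ^ 2:] dvd h - (monom 1 q + [:2:])" using h_mod4 by simp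
    then have "N2 (poly (map_poly of_int h) s - poly (map_poly of_int (monom 1 q + [:2:])) s) \<le> inverse (real 2) ^ 2"
      by (rule N2.N_poly_congruent[OF _ sF algebraic_int_croots[OF h(1) s]])
    then have "N2 (- (s ^ q + 2)) \<le> 1 / 4"
      using s by (simp add: croots_def map_poly_of_int_add map_poly_monom map_poly_pCons poly_monom power2_eq_square)
    moreover have 2: "(2::complex) \<in> F" using alg_field_of_nat[OF S.alg_E, of 2] by simp
    moreover have sq: "s ^ q \<in> F" by (rule alg_field_pow[OF S.alg_E sF])
    ultimately have le: "N2 (s ^ q + 2) \<le> 1 / 4" using N2.N_minus[of "s ^ q + 2"] alg_field_add[OF S.alg_E] by simp
    have N22: "N2 (- 2) = 1 / 2" using N2.N_l N2.N_minus[OF 2] by simp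
    have "N2 (- 2 + (s ^ q + 2)) = N2 (- 2)"
      using le N22 2 sq by (intro N2.N_add_eq alg_field_uminus[OF S.alg_E] alg_field_add[OF S.alg_E]) auto
    then show ?thesis using N22 N2.N_pow[OF sF, of q] by simp
  qed
  have q0: "q > 0" using q(2) by simp
  then obtain t where t: "t \<in> croots h" using h(4) by (metis card.empty equals0I less_irrefl)
  have tF: "t \<in> F" by (rule root_F(4)[OF t])
  have gt: "N2 (g t) = N2 t" if g: "g \<in> G" for g
  proof (rule power_eq_imp_eq_base)
    show "N2 (g t) ^ q = N2 t ^ q" using Nh[OF t] Nh[OF fhom_croots[OF t tF g]] by simp
  qed (use q0 tF g in \<open>auto intro: N2.N_nonneg S.G_closed\<close>)
  have "(\<Prod>g\<in>G. g t) \<in> \<rat>"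
  proof (rule S.fixed_Rats)
    show "(\<Prod>g\<in>G. g t) \<in> F" using S.G_closed tF by (intro alg_field_prod[OF S.alg_E]) auto
    show "g (\<Prod>g\<in>G. g t) = (\<Prod>g\<in>G. g t)" if "g \<in> G" for g
      by (rule S.prod_translate[OF _ S.G_compose that tF]) auto
  qed
  moreover have N2P: "N2 (\<Prod>g\<in>G. g t) = N2 t ^ card G"
    using N2.N_prod[of G "\<lambda>g. g t"] S.G_closed tF gt by simp
  moreover have "N2 t \<noteq> 0" using Nh[OF t] q0 by (auto simp: power_0_left)
  then have "(\<Prod>g\<in>G. g t) \<noteq> 0" using N2P N2.N_0 by auto
  ultimately obtain k where "N2 t ^ card G = real 2 powi k" using N2.N_Rats_value by metis
  then show ?thesis using N2.exponent_dvd[OF Nh[OF t]] by blast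
qed

text \<open>
  As \<open>q\<close> exceeds the degrees of the other factors, an automorphism of order \<open>q\<close> fixes their roots
  and permutes the roots of \<open>h\<close> cyclically.
\<close>

lemma move_theta:
  assumes t: "t \<in> croots h" "t' \<in> croots h"
  shows "\<exists>g\<in>G. (\<forall>s\<in>croots f. g s = s) \<and> g t = t'"
proof -
  define GG where "GG = Gal F \<rat>"
  have cG: "carrier GG = G" by (simp add: GG_def Gal_carrier[OF S.alg_E] G_def)
  interpret GG: group GG unfolding GG_def by (rule group_Gal[OF S.alg_E S.Rats_E])
  obtain k where "card G = q ^ 1 * k" using q_dvd_card_G by auto
  then obtain H where H: "subgroup H GG" "card H = q"
    using sylow_thm[of q GG 1 k] q(1) S.finite_G by (auto simp: Coset.order_def cG GG.is_group)
  have "H \<noteq> {\<one>\<^bsub>GG\<^esub>}" using H(2) prime_gt_1_nat[OF q(1)] by auto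
  then obtain g where g: "g \<in> H" "g \<noteq> \<one>\<^bsub>GG\<^esub>" using subgroup.one_closed[OF H(1)] by blast
  have gG: "g \<in> G" using g subgroup.subset[OF H(1)] cG by auto
  interpret H: group "GG\<lparr>carrier := H\<rparr>" by (rule GG.subgroup_imp_group[OF H(1)])
  have "g [^]\<^bsub>GG\<lparr>carrier := H\<rparr>\<^esub> q = \<one>\<^bsub>GG\<^esub>"
    using H.pow_order_eq_1[of g] g(1) H(2) by (simp add: Coset.order_def)
  then have gq: "g [^]\<^bsub>GG\<^esub> q = \<one>\<^bsub>GG\<^esub>" by (simp add: nat_pow_def)
  have pow_G: "g [^]\<^bsub>GG\<^esub> (k::nat) \<in> G" for k using GG.nat_pow_closed[of g k] gG cG by simp
  have pow: "(g [^]\<^bsub>GG\<^esub> (k::nat)) x = (g ^^ k) x" if "x \<in> F" for k x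
    using that
  proof (induction k arbitrary: x)
    case 0
    then show ?case by (simp add: GG_def Gal_one)
  next
    case (Suc k)
    have "(g [^]\<^bsub>GG\<^esub> Suc k) x = compose F (g [^]\<^bsub>GG\<^esub> k) g x"
      using pow_G[of k] gG by (simp add: GG_def Gal_mult[OF S.alg_E] G_def[symmetric])
    also have "\<dots> = (g ^^ k) (g x)" using Suc S.G_closed[OF gG] by (simp add: compose_def)
    finally show ?case by (simp add: funpow_swap1)
  qed
  have iter_q: "(g ^^ q) x = x" if "x \<in> F" for x
    using pow[OF that, of q] that by (simp add: gq) (simp add: GG_def Gal_one)
  have gfix: "g x = x" if w: "x \<in> croots w" "croots w \<subseteq> F" "finite (croots w)" "card (croots w) < q" for x w
  proof (rule ccontr)
    assume ne: "g x \<noteq> x"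
    have "g ` croots w \<subseteq> croots w" using fhom_croots[OF _ _ gG] w(2) by blast
    moreover have "inj_on g (croots w)" using S.G_inj[OF gG] w(2) by (rule inj_on_subset)
    ultimately have o: "card ((\<lambda>i. (g ^^ i) x) ` {..<q}) = q" "(\<lambda>i. (g ^^ i) x) ` {..<q} \<subseteq> croots w"
      using prime_order_orbit[OF q(1) w(3) _ _ w(1) iter_q[OF subsetD[OF w(2,1)]] ne] by simp_all
    then show False using card_mono[OF w(3) o(2)] o(1) w(4) by simp
  qed
  have finf: "finite (croots f)" "card (croots f) = p"
    using bij_betw_finite[OF alpha_bij] bij_betw_same_card[OF alpha_bij] by auto
  have fix_f: "g s = s" if "s \<in> croots f" for s
    using gfix[OF that] root_F(3) finf q(2) by blast
  have fix_p: "g (zeta ^ j * proot) = zeta ^ j * proot" if "j < p" for j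
  proof (rule gfix[of _ "monom 1 p - [:int p:]"])
    have "card (croots (monom 1 p - [:int p:])) \<le> p"
      unfolding Xp_roots using card_image_le[of "{..<p}" "\<lambda>j. zeta ^ j * proot"] by simp
    then show "card (croots (monom 1 p - [:int p:])) < q" using q(2) by simp
  qed (use that root_F(1) in \<open>auto simp: Xp_roots\<close>)
  have fix_l: "g (lam a) = lam a" if "a \<in> {1..<p}" for a
  proof -
    have r: "croots (monom 1 (p - 1) + [:int p:]) = lam ` {1..<p}"
      using lam_bij unfolding croots_def bij_betw_def
      by (simp add: map_poly_of_int_add map_poly_monom map_poly_pCons poly_monom add_eq_0_iff2)
    show ?thesis
    proof (rule gfix[of _ "monom 1 (p - 1) + [:int p:]"])
      have "card (lam ` {1..<p}) \<le> card {1..<p}" by (rule card_image_le) simp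
      then show "card (croots (monom 1 (p - 1) + [:int p:])) < q" unfolding r using q(2) by simp
    qed (unfold r, use that root_F(2) in auto)
  qed
  have "\<exists>t0\<in>croots h. g t0 \<noteq> t0"
  proof (rule ccontr)
    assume "\<not> ?thesis"
    then have "g s = s" if "poly Q s = 0" for s
      using that fix_f fix_p fix_l by (auto simp: Q_roots)
    then have "g = restrict (\<lambda>x. x) F"
      using S.roots_E by (intro S.G_eqI[OF gG S.G_id]) auto
    then show False using g(2) by (simp add: GG_def Gal_one)
  qed
  then obtain t0 where t0: "t0 \<in> croots h" "g t0 \<noteq> t0" by blast
  have finh: "finite (croots h)" using h(4) q(2) by (auto intro: card_ge_0_finite)
  have hF: "croots h \<subseteq> F" using root_F(4) by blast
  have "g ` croots h \<subseteq> croots h" using fhom_croots[OF _ _ gG] hF by blast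
  moreover have "inj_on g (croots h)" using S.G_inj[OF gG] hF by (rule inj_on_subset)
  ultimately have orb: "card ((\<lambda>i. (g ^^ i) t0) ` {..<q}) = q" "(\<lambda>i. (g ^^ i) t0) ` {..<q} \<subseteq> croots h"
    using prime_order_orbit[OF q(1) finh _ _ t0(1) iter_q[OF subsetD[OF hF t0(1)]] t0(2)] by simp_all
  then have "(\<lambda>i. (g ^^ i) t0) ` {..<q} = croots h" using h(4) by (intro card_subset_eq[OF finh]) auto
  then obtain i j where ij: "i < q" "t = (g ^^ i) t0" "j < q" "t' = (g ^^ j) t0" using t by blast
  \<comment> \<open>The exponent j - i is shifted by q to stay a natural number.\<close>
  have "(g ^^ (j + (q - i))) t = (g ^^ j) ((g ^^ (q - i + i)) t0)"
    unfolding ij(2) by (simp add: funpow_add)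
  also have "\<dots> = t'" using ij iter_q t0(1) hF by auto
  finally have tt: "(g ^^ (j + (q - i))) t = t'" .
  let ?g = "g [^]\<^bsub>GG\<^esub> (j + (q - i))"
  have "(g ^^ k) s = s" if "s \<in> croots f" for k s by (induction k) (use fix_f that in auto)
  then show ?thesis
    using pow_G[of "j + (q - i)"] pow tt t hF root_F(3) by (intro bexI[of _ ?g]) auto
qed

section \<open>The field L and its affine automorphisms\<close>

definition t0 where "t0 = (SOME t. t \<in> croots h)"

lemma t0: "t0 \<in> croots h" "t0 \<in> F"
proof -
  have "croots h \<noteq> {}" using h(4) q(2) by auto
  then show 1: "t0 \<in> croots h" unfolding t0_def by (metis equals0I someI)
  show "t0 \<in> F" by (rule root_F(4)[OF 1])
qed

definition L where "L = gen \<rat> (insert t0 (croots f))"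

lemma alg_L: "alg_field L"
  unfolding L_def using t0 root_F(3) alg_field_algebraic[OF S.alg_E] by (intro alg_field_gen alg_field_Rats_self) auto

lemma L_F: "L \<subseteq> F"
  unfolding L_def using t0 root_F(3) S.Rats_E by (intro gen_minimal alg_field_subrng[OF S.alg_E]) auto

lemma L_mem: "t0 \<in> L" "s \<in> croots f \<Longrightarrow> s \<in> L" "j < p \<Longrightarrow> alpha j \<in> L"
  unfolding L_def using gen_mem[of "insert t0 (croots f)" \<rat>] alpha_root by auto

lemma Rats_L: "\<rat> \<subseteq> L" unfolding L_def by (rule gen_base)

lemma L_eqI:
  assumes "fhom L g" "fhom L g'" "g t0 = g' t0" "\<And>j. j < p \<Longrightarrow> g (alpha j) = g' (alpha j)" "x \<in> L"
  shows "g x = g' x"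
proof (rule fhom_eq_on_gen[OF alg_L[unfolded L_def] assms(1)[unfolded L_def] assms(2)[unfolded L_def] _ _ assms(5)[unfolded L_def]])
  show "g x = g' x" if "x \<in> \<rat>" for x
    using fhom_Rats[OF alg_L assms(1) that] fhom_Rats[OF alg_L assms(2) that] by simp
  show "g x = g' x" if x: "x \<in> insert t0 (croots f)" for x
  proof (cases "x = t0")
    case False
    then obtain j where "j < p" "x = alpha j" using x alpha_bij by (auto simp: bij_betw_def)
    then show ?thesis using assms(4) by simp
  qed (use assms(3) in simp)
qed

definition acts where "acts g u v \<longleftrightarrow> g \<in> auts L \<rat> \<and> g t0 = t0 \<and> (\<forall>j<p. g (alpha j) = alpha ((u * j + v) mod p))"

text \<open>An element of \<open>\<Delta>\<close> realises the affine map on the roots of f but may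
  move \<open>t0\<close>; an automorphism from \<open>move_theta\<close>, trivial on the roots of f,
  brings \<open>t0\<close> back.\<close>

lemma acts_exists:
  assumes uv: "u \<in> {1..<p}" "v < p" shows "\<exists>g. acts g u v \<and> (\<exists>g'\<in>G. \<forall>x\<in>L. g x = g' x)"
proof -
  obtain \<delta> where \<delta>: "\<delta> \<in> D.\<Delta>" "has_params \<delta> u v" using exists_params[OF uv] by blast
  have \<delta>G: "\<delta> \<in> G" using \<delta>(1) D.\<Delta>_G by blast
  obtain g where g: "g \<in> G" "\<forall>s\<in>croots f. g s = s" "g (\<delta> t0) = t0"
    using move_theta[OF fhom_croots[OF t0(1) t0(2) \<delta>G] t0(1)] by blast
  let ?g = "compose F g \<delta>"
  have gG: "?g \<in> G" by (rule S.G_compose[OF g(1) \<delta>G])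
  have gt: "?g t0 = t0" using g(3) t0(2) by (simp add: compose_def)
  have ga: "?g (alpha j) = alpha ((u * j + v) mod p)" if j: "j < p" for j
    using params_alpha[OF \<delta> j] g(2) alpha_root[of "(u * j + v) mod p"] alpha_F[OF j] p_pos by (simp add: compose_def)
  have hL: "fhom L ?g" by (rule fhom_mono[OF S.G_fhom[OF gG] L_F])
  have fr: "fhom L (restrict ?g L)" by (rule fhom_cong[OF alg_L hL]) simp
  have "?g ` croots f \<subseteq> croots f" using fhom_croots[OF _ root_F(3) gG] by blast
  moreover have "inj_on ?g (croots f)" using S.G_inj[OF gG] root_F(3) by (meson inj_on_subset subsetI)
  moreover have "finite (croots f)" using bij_betw_finite[OF alpha_bij] by auto
  ultimately have "?g ` croots f = croots f" by (intro endo_inj_surj)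
  then have "?g ` insert t0 (croots f) = insert t0 (croots f)" using gt by simp
  then have "?g ` L = L" using gen_image alg_L hL unfolding L_def by blast
  then have "restrict ?g L ` L = L" by (simp add: image_def)
  then have "restrict ?g L \<in> auts L \<rat>"
    using fr fhom_Rats[OF alg_L fr] by (auto simp: auts_def)
  then have "acts (restrict ?g L) u v" using gt ga L_mem by (simp add: acts_def)
  then show ?thesis using gG by (intro exI[of _ "restrict ?g L"]) (auto intro!: bexI[of _ ?g])
qed

lemma acts_unique: "acts g u v \<Longrightarrow> acts g' u v \<Longrightarrow> g = g'"
  by (rule extensionalityI[of _ L]) (auto simp: acts_def auts_ext intro: L_eqI auts_fhom)

lemma acts_compose:
  assumes "acts g u v" "acts g' u' v'"
  shows "acts (compose L g g') (u * u' mod p) ((u * v' + v) mod p)"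
proof -
  have "compose L g g' \<in> auts L \<rat>"
    using assms auts_compose[OF alg_L _ _ Rats_L] by (simp add: acts_def)
  moreover have "compose L g g' t0 = t0" using assms L_mem by (simp add: acts_def compose_def)
  moreover have "compose L g g' (alpha j) = alpha ((u * u' mod p * j + (u * v' + v) mod p) mod p)" if j: "j < p" for j
  proof -
    have "compose L g g' (alpha j) = alpha ((u * ((u' * j + v') mod p) + v) mod p)"
      using assms j L_mem(3)[OF j] p_pos by (simp add: acts_def compose_def)
    also have "(u * ((u' * j + v') mod p) + v) mod p = (u * (u' * j + v') + v) mod p"
      unfolding cong_def[symmetric] by (intro cong_add cong_mult cong_refl) (auto simp: cong_def)
    also have "\<dots> = (u * u' * j + (u * v' + v)) mod p" by (simp add: algebra_simps)
    also have "\<dots> = (u * u' mod p * j + (u * v' + v) mod p) mod p"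
      unfolding cong_def[symmetric] by (intro cong_add cong_mult cong_refl) (auto simp: cong_def)
    finally show ?thesis .
  qed
  ultimately show ?thesis by (simp add: acts_def)
qed

lemma acts_inj:
  assumes "acts g u v" "acts g u' v'" "u < p" "u' < p" "v < p" "v' < p"
  shows "u = u'" "v = v'"
proof -
  have inj: "inj_on alpha {..<p}" using alpha_bij by (simp add: bij_betw_def)
  have eq: "(u * j + v) mod p = (u' * j + v') mod p" if "j < p" for j
  proof -
    have "alpha ((u * j + v) mod p) = alpha ((u' * j + v') mod p)" using assms(1,2) that by (simp add: acts_def)
    then show ?thesis using inj_onD[OF inj] p_pos by simp
  qed
  show v: "v = v'" using eq[of 0] assms p_pos by simp
  have "(u + v) mod p = (u' + v) mod p" using eq[of 1] p_gt_2 v by simp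
  then have "[u = u'] (mod p)" using cong_add_rcancel_nat by (metis cong_def)
  then show "u = u'" using assms(3,4) by (simp add: cong_def)
qed

end

section \<open>The metacyclic group inside the affine group, and its fixed field K\<close>

locale tower_group = tower +
  fixes r s :: nat
  assumes ps: "coprime p s" and r: "ord p s = r"
begin

definition \<Gamma> where "\<Gamma> = metacyclic_group p r s"

lemma r_pos: "r > 0" using ps r coprime_ord by blast

lemma carrier_\<Gamma>: "carrier \<Gamma> = {0..<int p} \<times> {0..<int r}"
  unfolding \<Gamma>_def by (rule metacyclic_carrier[OF p_pos r_pos])

definition us where "us i = s ^ nat i mod p"

lemma us_range: "us i \<in> {1..<p}"
proof -
  have "\<not> p dvd s" using coprime_common_divisor_nat[OF ps, of p] p_gt_2 by auto
  then have "\<not> p dvd s ^ nat i" using prime_dvd_power[OF l] by blast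
  then show ?thesis using p_pos by (simp add: us_def dvd_eq_mod_eq_0 Suc_le_eq)
qed

text \<open>The element (a, i), which is sigma^a tau^i, becomes the automorphism with j -> s^i j + a
  on the indices of \<open>alpha\<close>; existence is \<open>acts_exists\<close>, uniqueness
  \<open>acts_unique\<close>.\<close>

definition \<Phi> where "\<Phi> x = (SOME g. acts g (us (snd x)) (nat (fst x)))"

lemma acts_\<Phi>: assumes "x \<in> carrier \<Gamma>" shows "acts (\<Phi> x) (us (snd x)) (nat (fst x))"
proof -
  have "nat (fst x) < p" using assms by (auto simp: carrier_\<Gamma>)
  then show ?thesis unfolding \<Phi>_def using acts_exists[OF us_range] by (metis someI_ex)
qed

lemma us_add: assumes "i \<ge> 0" "j \<ge> 0" shows "us ((i + j) mod int r) = us i * us j mod p"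
proof -
  have "nat ((i + j) mod int r) = (nat i + nat j) mod r"
    using assms by (simp add: nat_mod_distrib nat_add_distrib)
  moreover have "[int s ^ ((nat i + nat j) mod r) = int s ^ (nat i + nat j)] (mod int p)"
    by (rule power_mod_order[OF ps r])
  then have "[s ^ ((nat i + nat j) mod r) = s ^ (nat i + nat j)] (mod p)"
    by (metis cong_int_iff of_nat_power)
  ultimately show ?thesis by (simp add: us_def cong_def power_add mod_mult_eq)
qed

lemma \<Phi>_mult:
  assumes "x \<in> carrier \<Gamma>" "y \<in> carrier \<Gamma>"
  shows "\<Phi> (x \<otimes>\<^bsub>\<Gamma>\<^esub> y) = compose L (\<Phi> x) (\<Phi> y)"
proof -
  obtain a i b j where xy: "x = (a, i)" "y = (b, j)" and ab: "0 \<le> a" "0 \<le> b" "0 \<le> i" "0 \<le> j" "b < int p"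
    using assms by (auto simp: carrier_\<Gamma>)
  have m: "x \<otimes>\<^bsub>\<Gamma>\<^esub> y = ((a + int s ^ nat i * b) mod int p, (i + j) mod int r)"
    unfolding \<Gamma>_def xy using ab by (intro metacyclic_mult p_pos r_pos) auto
  interpret \<Gamma>: group \<Gamma> unfolding \<Gamma>_def by (rule group_metacyclic_group[OF l ps r])
  have c: "x \<otimes>\<^bsub>\<Gamma>\<^esub> y \<in> carrier \<Gamma>" by (rule \<Gamma>.m_closed[OF assms])
  have "acts (\<Phi> (x \<otimes>\<^bsub>\<Gamma>\<^esub> y)) (us i * us j mod p) (nat ((a + int s ^ nat i * b) mod int p))"
    using acts_\<Phi>[OF c] us_add[OF ab(3,4)] by (simp add: m)
  moreover have "nat ((a + int s ^ nat i * b) mod int p) = (us i * nat b + nat a) mod p"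
  proof -
    have "int ((us i * nat b + nat a) mod p) = (int s ^ nat i * b + a) mod int p"
      using ab unfolding us_def zmod_int of_nat_add of_nat_mult of_nat_power cong_def[symmetric]
      by (intro cong_add cong_mult cong_refl) (auto simp: cong_def)
    then show ?thesis by (simp add: add.commute)
  qed
  moreover have "acts (compose L (\<Phi> x) (\<Phi> y)) (us i * us j mod p) ((us i * nat b + nat a) mod p)"
    using acts_compose[OF acts_\<Phi>[OF assms(1)] acts_\<Phi>[OF assms(2)]] by (simp add: xy)
  ultimately show ?thesis using acts_unique by metis
qed

lemma us_inj: assumes "0 \<le> i" "i < int r" "0 \<le> j" "j < int r" "us i = us j" shows "i = j"
proof -
  have "[s ^ nat i = s ^ nat j] (mod p)" using assms(5) by (simp add: us_def cong_def)
  then have "[nat i = nat j] (mod ord p s)" using order_divides_expdiff[OF ps] by blast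
  then have "nat i = nat j" using assms r by (simp add: cong_def)
  then show ?thesis using assms by simp
qed

lemma \<Phi>_inj: "inj_on \<Phi> (carrier \<Gamma>)"
proof (rule inj_onI)
  fix x y assume xy: "x \<in> carrier \<Gamma>" "y \<in> carrier \<Gamma>" "\<Phi> x = \<Phi> y"
  have r: "us (snd x) < p" "us (snd y) < p" "nat (fst x) < p" "nat (fst y) < p"
    using us_range[of "snd x"] us_range[of "snd y"] xy by (auto simp: carrier_\<Gamma>)
  note * = acts_inj[OF acts_\<Phi>[OF xy(1)] acts_\<Phi>[OF xy(2), folded xy(3)] r]
  have "snd x = snd y" using us_inj[OF _ _ _ _ *(1)] xy by (auto simp: carrier_\<Gamma>)
  moreover have "fst x = fst y" using *(2) xy by (auto simp: carrier_\<Gamma>)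
  ultimately show "x = y" by (simp add: prod_eq_iff)
qed

definition K where "K = {x \<in> L. \<forall>y\<in>carrier \<Gamma>. \<Phi> y x = x}"

lemma \<Phi>_auts: "y \<in> carrier \<Gamma> \<Longrightarrow> \<Phi> y \<in> auts L K"
  using acts_\<Phi>[of y] by (auto simp: acts_def auts_def K_def)

lemma \<Phi>_fhom: "y \<in> carrier \<Gamma> \<Longrightarrow> fhom L (\<Phi> y)" and \<Phi>_closed: "y \<in> carrier \<Gamma> \<Longrightarrow> x \<in> L \<Longrightarrow> \<Phi> y x \<in> L"
  using \<Phi>_auts auts_fhom auts_closed by blast+

lemma alg_K: "alg_field K" and K_L: "K \<subseteq> L" and t0_K: "t0 \<in> K"
proof -
  show KL: "K \<subseteq> L" by (auto simp: K_def)
  have "subrng K"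
    using alg_field_1[OF alg_L] alg_field_diff[OF alg_L] alg_field_mult[OF alg_L]
      fhom_1[OF alg_L \<Phi>_fhom] fhom_diff[OF alg_L \<Phi>_fhom] fhom_mult[OF alg_L \<Phi>_fhom]
    by (auto simp: subrng_def K_def)
  moreover have "\<rat> \<subseteq> K" using Rats_L fhom_Rats[OF alg_L \<Phi>_fhom] by (auto simp: K_def)
  ultimately show "alg_field K" using KL alg_field_algebraic[OF alg_L] by (auto simp: alg_field_def)
  show "t0 \<in> K" using acts_\<Phi> L_mem by (auto simp: K_def acts_def)
qed

end

section \<open>Passage to the algebraic structures of the statement\<close>

lemma complex_ring_simps:
  "carrier complex_ring = UNIV" "x \<otimes>\<^bsub>complex_ring\<^esub> y = x * y" "x \<oplus>\<^bsub>complex_ring\<^esub> y = x + y"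
  "\<one>\<^bsub>complex_ring\<^esub> = 1" "\<zero>\<^bsub>complex_ring\<^esub> = 0"
  by (simp_all add: ring_of_type_algebra_def)

interpretation CR: domain complex_ring
  by (rule field.axioms(1)[OF field_from_type_algebra])

lemma complex_ring_uminus: "\<ominus>\<^bsub>complex_ring\<^esub> x = - x"
  by (rule CR.minus_equality) (simp_all add: complex_ring_simps)

lemma subring_iff_subrng: "subring A complex_ring \<longleftrightarrow> subrng A"
proof
  assume A: "subring A complex_ring"
  have "x - y \<in> A" if "x \<in> A" "y \<in> A" for x y
    using subringE(7)[OF A that(1) subringE(5)[OF A that(2)]] by (simp add: complex_ring_simps complex_ring_uminus)
  then show "subrng A"
    using subringE(3,6)[OF A] by (auto simp: subrng_def complex_ring_simps)
next
  assume "subrng A"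
  then show "subring A complex_ring"
    by (intro CR.subringI) (auto simp: complex_ring_simps complex_ring_uminus intro: subrng_1 subrng_uminus subrng_mult subrng_add)
qed

lemma subfield_alg_field: assumes "alg_field K" shows "subfield K complex_ring"
proof (rule CR.subfieldI)
  show "subcring K complex_ring"
    using assms by (intro CR.subcringI') (simp add: subring_iff_subrng alg_field_subrng)
  show "Units (complex_ring\<lparr>carrier := K\<rparr>) = K - {\<zero>\<^bsub>complex_ring\<^esub>}"
  proof (intro equalityI subsetI)
    fix x assume "x \<in> Units (complex_ring\<lparr>carrier := K\<rparr>)"
    then show "x \<in> K - {\<zero>\<^bsub>complex_ring\<^esub>}" by (auto simp: Units_def complex_ring_simps)
  next
    fix x assume "x \<in> K - {\<zero>\<^bsub>complex_ring\<^esub>}"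
    then have x: "x \<in> K" "x \<noteq> 0" by (auto simp: complex_ring_simps)
    then have "inverse x \<in> K" "inverse x * x = 1" "x * inverse x = 1" using alg_field_inverse[OF assms] by auto
    then show "x \<in> Units (complex_ring\<lparr>carrier := K\<rparr>)"
      using x by (auto simp: Units_def complex_ring_simps intro!: bexI[of _ "inverse x"])
  qed
qed

lemma finite_extension_gen:
  assumes "alg_field K" shows "CR.finite_extension K xs = gen K (set xs)"
  using CR.finite_extension_minimal[of K xs] alg_field_subrng[OF assms]
  by (simp add: subring_iff_subrng complex_ring_simps gen_def)

lemma algebraic_over_alg_field:
  assumes K: "alg_field K" and x: "algebraic x" shows "(CR.algebraic over K) x"
proof -
  have "subfield (CR.simple_extension K x) complex_ring"
    using finite_extension_gen[OF K, of "[x]"] subfield_alg_field[OF alg_field_gen[OF K, of "{x}"]] x by simp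
  then show ?thesis
    using CR.simple_extension_subfield_imp_algebraic[of K x] alg_field_subrng[OF K]
    by (simp add: subring_iff_subrng complex_ring_simps)
qed

lemma finite_dimension_gen:
  assumes K: "alg_field K" and S: "finite S" "\<And>s. s \<in> S \<Longrightarrow> algebraic s"
  shows "CR.finite_dimension K (gen K S)"
proof -
  obtain xs where xs: "set xs = S" using finite_list[OF S(1)] by blast
  have "CR.finite_dimension K (CR.finite_extension K xs)"
    using xs S(2) algebraic_over_alg_field[OF K]
    by (intro CR.finite_extension_finite_dimension(1) subfield_alg_field[OF K]) (auto simp: complex_ring_simps)
  then show ?thesis unfolding finite_extension_gen[OF K, of xs] xs .
qed

lemma number_field_subfield_gen:
  assumes S: "finite S" "\<And>s. s \<in> S \<Longrightarrow> algebraic s" and K: "alg_field K" "K \<subseteq> gen \<rat> S"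
  shows "number_field K"
proof -
  have Q: "subfield \<rat> complex_ring" by (rule subfield_alg_field[OF alg_field_Rats_self])
  have "subalgebra \<rat> K complex_ring"
  proof (intro subalgebra.intro)
    show "subgroup K (add_monoid complex_ring)"
      using subring.axioms(1)[of K complex_ring] alg_field_subrng[OF K(1)] by (simp add: subring_iff_subrng)
    show "subalgebra_axioms \<rat> K complex_ring"
      using alg_field_mult[OF K(1)] alg_field_Rats[OF K(1)] by (auto simp: subalgebra_axioms_def complex_ring_simps)
  qed
  then have "CR.finite_dimension \<rat> K"
    using CR.subalbegra_incl_imp_finite_dimension[OF Q finite_dimension_gen[OF alg_field_Rats_self S] _ K(2)] by blast
  then show ?thesis using subfield_alg_field[OF K(1)] by (simp add: number_field_def)
qed

lemma finite_dimension_over: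
  assumes S: "finite S" "\<And>s. s \<in> S \<Longrightarrow> algebraic s" and K: "alg_field K" "K \<subseteq> gen \<rat> S"
  shows "CR.finite_dimension K (gen \<rat> S)"
proof -
  have "gen K S = gen \<rat> S"
  proof
    show "gen K S \<subseteq> gen \<rat> S" by (rule gen_minimal[OF subrng_gen K(2) gen_mem])
    have "\<rat> \<subseteq> K" using K(1) alg_field_Rats by blast
    then show "gen \<rat> S \<subseteq> gen K S"
      using gen_base[of K S] gen_mem[of S K] by (intro gen_minimal subrng_gen) auto
  qed
  then show ?thesis using finite_dimension_gen[OF K(1) S] by simp
qed

lemma linear_prod_coeffs:
  assumes L: "alg_field L" and a: "\<And>i. i \<in> A \<Longrightarrow> a i \<in> L"
  shows "coeff (\<Prod>i\<in>A. [:- a i, 1:]) j \<in> L"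
proof -
  have "\<forall>j. coeff (\<Prod>i\<in>A. [:- a i, 1:]) j \<in> L"
    using a
  proof (induction A rule: infinite_finite_induct)
    case (insert x F)
    then show ?case
      by (auto simp: coeff_pCons intro!: alg_field_diff[OF L] alg_field_mult[OF L] alg_field_uminus[OF L]
          alg_field_0[OF L] split: nat.split)
  qed (auto simp: alg_field_0[OF L] alg_field_1[OF L])
  then show ?thesis by blast
qed

lemma map_poly_linear_prod:
  assumes L: "alg_field L" and g: "fhom L g" and a: "\<And>i. i \<in> A \<Longrightarrow> a i \<in> L"
  shows "map_poly g (\<Prod>i\<in>A. [:- a i, 1:]) = (\<Prod>i\<in>A. [:- g (a i), 1:])"
  using a
proof (induction A rule: infinite_finite_induct)
  case (insert x F)
  have lin: "coeff [:- a x, 1:] j \<in> L" for j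
    using insert.prems alg_field_uminus[OF L] alg_field_0[OF L] alg_field_1[OF L]
    by (auto simp: coeff_pCons split: nat.split)
  have "map_poly g [:- a x, 1:] = [:- g (a x), 1:]"
    using fhom_0[OF L g] fhom_1[OF L g] fhom_uminus[OF L g, of "a x"] insert.prems by (simp add: map_poly_pCons)
  then show ?case
    using insert map_poly_fhom(2)[OF L g lin linear_prod_coeffs[OF L, of F a]] by simp
qed (simp_all add: fhom_1[OF L g])

text \<open>The element \<open>h0\<close> makes x a root of the product; a homomorphism fixing the
  coefficients sends x to another root, that is, to a conjugate under \<open>H\<close>. It serves
  both for the Galois group and for total reality.\<close>

lemma conjugate_of_invariant_poly:
  assumes L: "alg_field L" and H: "finite H" "h0 \<in> H" "\<And>g. g \<in> H \<Longrightarrow> g x \<in> L" and x: "x \<in> L" "h0 x = x"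
    and F: "alg_field F" "F \<subseteq> L" and f: "fhom F f" "x \<in> F"
    and c: "\<And>j. coeff (\<Prod>g\<in>H. [:- g x, 1:]) j \<in> F" "\<And>j. f (coeff (\<Prod>g\<in>H. [:- g x, 1:]) j) = coeff (\<Prod>g\<in>H. [:- g x, 1:]) j"
  shows "\<exists>g\<in>H. f x = g x"
proof -
  let ?P = "\<Prod>g\<in>H. [:- g x, 1:]"
  have "map_poly f ?P = ?P"
    by (intro poly_eqI) (simp add: coeff_map_poly fhom_0[OF F(1) f(1)] c(2))
  moreover have "poly ?P x = 0" using H(1,2) x(2) by (auto simp: poly_prod prod_zero_iff intro!: bexI[of _ h0])
  ultimately have "poly ?P (f x) = 0"
    using fhom_poly[OF F(1) f(1) c(1) f(2)] fhom_0[OF F(1) f(1)] by simp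
  then show ?thesis using H(1) by (auto simp: poly_prod prod_zero_iff)
qed

text \<open>Each vector is the coefficient list of a nonzero polynomial, and some natural number
  avoids the finitely many roots of all of them.\<close>

lemma generic_combination:
  fixes V :: "(nat \<Rightarrow> complex) set"
  assumes "finite V" "\<And>v. v \<in> V \<Longrightarrow> \<exists>j<n. v j \<noteq> 0"
  obtains t :: nat where "\<And>v. v \<in> V \<Longrightarrow> (\<Sum>j<n. v j * of_nat t ^ j) \<noteq> 0"
proof -
  define P where "P v = (\<Sum>j<n. monom (v j) j)" for v :: "nat \<Rightarrow> complex"
  have c: "coeff (P v) j = v j" if "j < n" for v j
    using that by (simp add: P_def coeff_sum coeff_monom if_distrib sum.delta cong: if_cong)
  have "P v \<noteq> 0" if v: "v \<in> V" for v
  proof -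
    obtain j where "j < n" "v j \<noteq> 0" using assms(2)[OF v] by blast
    then show ?thesis using c[of j v] by auto
  qed
  then have "finite (\<Union>v\<in>V. {z. poly (P v) z = 0})" using assms(1) poly_roots_finite by blast
  moreover have "infinite (range (of_nat :: nat \<Rightarrow> complex))" by (simp add: finite_image_iff inj_of_nat)
  ultimately have "\<exists>t::nat. of_nat t \<notin> (\<Union>v\<in>V. {z. poly (P v) z = 0})"
    by (meson finite_subset image_subsetI)
  then obtain t :: nat where "of_nat t \<notin> (\<Union>v\<in>V. {z. poly (P v) z = 0})" by blast
  then show ?thesis by (intro that[of t]) (auto simp: P_def poly_sum poly_monom)
qed

section \<open>Galois group and total reality\<close>

context tower_group
begin

lemma group_\<Gamma>: "group \<Gamma>"
  unfolding \<Gamma>_def by (rule group_metacyclic_group[OF l ps r])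

lemma finite_\<Gamma>: "finite (carrier \<Gamma>)" by (simp add: carrier_\<Gamma>)

lemma \<Phi>_one: "\<exists>y\<in>carrier \<Gamma>. \<forall>x\<in>L. \<Phi> y x = x"
proof -
  have c: "(0, 0) \<in> carrier \<Gamma>" using p_pos r_pos by (simp add: carrier_\<Gamma>)
  have "us 0 = 1" using p_gt_2 by (simp add: us_def)
  then have "acts (\<Phi> (0, 0)) 1 0" using acts_\<Phi>[OF c] by simp
  moreover have "acts (\<lambda>x\<in>L. x) 1 0"
    using auts_id[OF alg_L Rats_L] L_mem by (simp add: acts_def)
  ultimately have "\<Phi> (0, 0) = (\<lambda>x\<in>L. x)" by (rule acts_unique)
  then show ?thesis using c by (intro bexI[of _ "(0, 0)"]) auto
qed

text \<open>Applying \<open>\<Phi> z\<close> translates the index group by z and so only permutes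
  the linear factors.\<close>

lemma poly_\<Phi>_coeff_K:
  assumes x: "x \<in> L" shows "coeff (\<Prod>g\<in>\<Phi> ` carrier \<Gamma>. [:- g x, 1:]) j \<in> K"
proof -
  interpret \<Gamma>: group \<Gamma> by (rule group_\<Gamma>)
  have eq: "(\<Prod>g\<in>\<Phi> ` carrier \<Gamma>. [:- g x, 1:]) = (\<Prod>y\<in>carrier \<Gamma>. [:- \<Phi> y x, 1:])"
    by (simp add: prod.reindex[OF \<Phi>_inj])
  let ?P = "\<Prod>y\<in>carrier \<Gamma>. [:- \<Phi> y x, 1:]"
  have cL: "coeff ?P j \<in> L" for j using \<Phi>_closed[OF _ x] by (intro linear_prod_coeffs[OF alg_L])
  have "\<Phi> z (coeff ?P j) = coeff ?P j" if z: "z \<in> carrier \<Gamma>" for z j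
  proof -
    note zh = \<Phi>_fhom[OF z]
    have inj: "inj_on (\<lambda>y. z \<otimes>\<^bsub>\<Gamma>\<^esub> y) (carrier \<Gamma>)" using z by (rule \<Gamma>.inj_on_cmult)
    have im: "(\<lambda>y. z \<otimes>\<^bsub>\<Gamma>\<^esub> y) ` carrier \<Gamma> = carrier \<Gamma>"
      using z by (intro endo_inj_surj[OF finite_\<Gamma> _ inj]) auto
    have "map_poly (\<Phi> z) ?P = (\<Prod>y\<in>carrier \<Gamma>. [:- \<Phi> z (\<Phi> y x), 1:])"
      using \<Phi>_closed[OF _ x] by (intro map_poly_linear_prod[OF alg_L zh])
    also have "\<dots> = (\<Prod>y\<in>carrier \<Gamma>. [:- \<Phi> (z \<otimes>\<^bsub>\<Gamma>\<^esub> y) x, 1:])"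
      using \<Phi>_mult[OF z] x by (intro prod.cong) (auto simp: compose_def)
    also have "\<dots> = (\<Prod>y\<in>(\<lambda>y. z \<otimes>\<^bsub>\<Gamma>\<^esub> y) ` carrier \<Gamma>. [:- \<Phi> y x, 1:])"
      by (simp add: prod.reindex[OF inj])
    finally have "map_poly (\<Phi> z) ?P = ?P" unfolding im .
    then show ?thesis using coeff_map_poly[of "\<Phi> z" ?P j] fhom_0[OF alg_L zh] by simp
  qed
  then show ?thesis unfolding eq using cL by (simp add: K_def)
qed

text \<open>Artin's theorem. An automorphism over K agrees at every single element with some
  \<open>\<Phi> y\<close>, but y may depend on the element; agreement at one sufficiently general
  element fixes y once and for all.\<close>

lemma auts_eq: "auts L K = \<Phi> ` carrier \<Gamma>"
proof
  show "\<Phi> ` carrier \<Gamma> \<subseteq> auts L K" using \<Phi>_auts by blast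
  show "auts L K \<subseteq> \<Phi> ` carrier \<Gamma>"
  proof
    fix g assume g: "g \<in> auts L K"
    note gh = auts_fhom[OF g]
    let ?H = "\<Phi> ` carrier \<Gamma>"
    have pt: "\<exists>\<phi>\<in>?H. g x = \<phi> x" if x: "x \<in> L" for x
    proof -
      obtain y where "y \<in> carrier \<Gamma>" "\<Phi> y x = x" using \<Phi>_one x by blast
      then show ?thesis
        using auts_fix[OF g poly_\<Phi>_coeff_K[OF x]] subsetD[OF K_L poly_\<Phi>_coeff_K[OF x]] \<Phi>_closed[OF _ x] finite_\<Gamma>
        by (intro conjugate_of_invariant_poly[OF alg_L _ _ _ x _ alg_L subset_refl gh x, of ?H "\<Phi> y"]) blast+
    qed
    define V where "V = {v. (\<exists>\<phi>\<in>?H. v = (\<lambda>j. g (alpha j) - \<phi> (alpha j))) \<and> (\<exists>j<p. v j \<noteq> 0)}"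
    have finV: "finite V"
      by (rule finite_subset[of _ "(\<lambda>\<phi> j. g (alpha j) - \<phi> (alpha j)) ` ?H"]) (use finite_\<Gamma> in \<open>auto simp: V_def\<close>)
    have ne: "\<exists>j<p. v j \<noteq> 0" if "v \<in> V" for v using that unfolding V_def by blast
    obtain t :: nat where t: "\<And>v. v \<in> V \<Longrightarrow> (\<Sum>j<p. v j * of_nat t ^ j) \<noteq> 0"
      by (rule generic_combination[OF finV], erule ne, rule that)
    \<comment> \<open>With t from \<open>generic_combination\<close>, agreement of two of the maps
      at x forces agreement at every \<open>alpha j\<close>.\<close>
    define x where "x = (\<Sum>j<p. alpha j * of_nat t ^ j)"
    have tm: "alpha j * of_nat t ^ j \<in> L" if "j < p" for j
      using that by (intro alg_field_mult[OF alg_L] alg_field_pow[OF alg_L] alg_field_of_nat[OF alg_L] L_mem)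
    have xL: "x \<in> L" unfolding x_def using tm by (intro alg_field_sum[OF alg_L]) auto
    have hx: "\<phi> x = (\<Sum>j<p. \<phi> (alpha j) * of_nat t ^ j)" if "fhom L \<phi>" for \<phi>
    proof -
      have "\<phi> x = (\<Sum>j<p. \<phi> (alpha j * of_nat t ^ j))"
        unfolding x_def using tm by (intro fhom_sum[OF alg_L that]) auto
      also have "\<dots> = (\<Sum>j<p. \<phi> (alpha j) * of_nat t ^ j)"
      proof (intro sum.cong refl)
        fix j assume "j \<in> {..<p}"
        then show "\<phi> (alpha j * of_nat t ^ j) = \<phi> (alpha j) * of_nat t ^ j"
          using fhom_mult[OF alg_L that L_mem(3)[of j] alg_field_pow[OF alg_L alg_field_of_nat[OF alg_L, of t], of j]]
            fhom_Rats[OF alg_L that, of "of_nat t ^ j"] by simp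
      qed
      finally show ?thesis .
    qed
    obtain y where y: "y \<in> carrier \<Gamma>" "g x = \<Phi> y x" using pt[OF xL] by blast
    let ?v = "\<lambda>j. g (alpha j) - \<Phi> y (alpha j)"
    have "(\<Sum>j<p. ?v j * of_nat t ^ j) = 0"
      using y(2) hx[OF gh] hx[OF \<Phi>_fhom[OF y(1)]] by (simp add: left_diff_distrib sum_subtractf)
    then have "?v \<notin> V" using t by blast
    then have eq: "g (alpha j) = \<Phi> y (alpha j)" if "j < p" for j using that y(1) by (auto simp: V_def)
    have "g = \<Phi> y"
    proof (rule extensionalityI[of _ L])
      show "g \<in> extensional L" "\<Phi> y \<in> extensional L" using auts_ext[OF g] auts_ext[OF \<Phi>_auts[OF y(1)]] by auto
      show "g x = \<Phi> y x" if "x \<in> L" for x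
        by (rule L_eqI[OF gh \<Phi>_fhom[OF y(1)] _ eq that])
          (use auts_fix[OF g t0_K] auts_fix[OF \<Phi>_auts[OF y(1)] t0_K] in simp)
    qed
    then show "g \<in> \<Phi> ` carrier \<Gamma>" using y(1) by blast
  qed
qed

lemma carrier_Gal_L: "carrier (Gal L K) = \<Phi> ` carrier \<Gamma>"
  by (simp add: Gal_carrier[OF alg_L] auts_eq)

lemma \<Phi>_iso: "\<Phi> \<in> iso \<Gamma> (Gal L K)"
  using \<Phi>_inj \<Phi>_mult \<Phi>_auts
  by (auto simp: iso_def hom_def bij_betw_def carrier_Gal_L Gal_mult[OF alg_L])

definition \<psi> where "\<psi> = inv_into (carrier \<Gamma>) \<Phi>"

lemma \<psi>_iso: "\<psi> \<in> iso (Gal L K) \<Gamma>"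
  unfolding \<psi>_def using group.iso_set_sym[OF group_\<Gamma> \<Phi>_iso] .

lemma \<psi>_\<Phi>: "y \<in> carrier \<Gamma> \<Longrightarrow> \<psi> (\<Phi> y) = y"
  unfolding \<psi>_def using \<Phi>_inj by (rule inv_into_f_f)

lemma L_gens: "finite (insert t0 (croots f))" "z \<in> insert t0 (croots f) \<Longrightarrow> algebraic z"
  using bij_betw_finite[OF alpha_bij] L_mem alg_field_algebraic[OF alg_L] by auto

lemma number_fields: "number_field K" "number_field L"
  using number_field_subfield_gen[OF L_gens] alg_K alg_L K_L by (auto simp: L_def)

lemma galois_LK: "finite_galois_extension L K"
proof -
  have "{x \<in> L. \<forall>f\<in>carrier (Gal L K). f x = x} = K" unfolding carrier_Gal_L by (auto simp: K_def)
  moreover have "CR.finite_dimension K L"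
    using finite_dimension_over[OF L_gens alg_K] K_L by (simp add: L_def)
  ultimately show ?thesis
    using subfield_alg_field[OF alg_K] subfield_alg_field[OF alg_L] K_L by (simp add: finite_galois_extension_def)
qed

lemma G_L_real: assumes "g \<in> G" "x \<in> L" shows "g x \<in> \<real>"
proof (rule fhom_image_gen[OF alg_L[unfolded L_def] _ _ _ _ assms(2)[unfolded L_def]])
  show "fhom (gen \<rat> (insert t0 (croots f))) g"
    using fhom_mono[OF S.G_fhom[OF assms(1)] L_F] by (simp add: L_def)
  show "subrng (\<real> :: complex set)" by (auto simp: subrng_def)
  show "g x \<in> \<real>" if "x \<in> \<rat>" for x
    using fhom_Rats[OF S.alg_E S.G_fhom[OF assms(1)] that] that by (auto elim!: Rats_cases')
  show "g x \<in> \<real>" if "x \<in> insert t0 (croots f)" for x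
    using that fhom_croots[OF t0 assms(1)] fhom_croots[OF _ root_F(3) assms(1), of x f] f(3) h(3) by auto
qed

text \<open>An embedding of \<open>M\<close> agrees at each single element with some member of
  \<open>G\<close>, by \<open>conjugate_of_invariant_poly\<close>. Pointwise agreement suffices, as
  all members of \<open>G\<close> map \<open>L\<close> into the reals.\<close>

lemma totally_real_subfield:
  assumes M: "alg_field M" "M \<subseteq> L" shows "totally_real M"
  unfolding totally_real_def
proof (intro ballI subsetI)
  fix \<phi> y assume \<phi>: "\<phi> \<in> ring_hom (complex_ring\<lparr>carrier := M\<rparr>) complex_ring" and "y \<in> \<phi> ` M"
  then obtain x where x: "x \<in> M" "y = \<phi> x" by blast
  have h: "\<phi> 1 = 1" "\<And>a b. a \<in> M \<Longrightarrow> b \<in> M \<Longrightarrow> \<phi> (a * b) = \<phi> a * \<phi> b \<and> \<phi> (a + b) = \<phi> a + \<phi> b"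
    using \<phi> by (auto simp: ring_hom_def complex_ring_simps)
  have "\<phi> (a - b) = \<phi> a - \<phi> b" if "a \<in> M" "b \<in> M" for a b
    using h(2)[of "a - b" b] alg_field_diff[OF M(1)] that by simp
  then have \<phi>h: "fhom M \<phi>" using h by (simp add: fhom_def)
  have xF: "x \<in> F" using x M(2) L_F by blast
  let ?P = "\<Prod>g\<in>G. [:- g x, 1:]"
  have PQ: "coeff ?P j \<in> \<rat>" for j
  proof (rule S.fixed_Rats)
    show "coeff ?P j \<in> F" using S.G_closed[OF _ xF] by (intro linear_prod_coeffs[OF S.alg_E])
    fix z assume z: "z \<in> G"
    have bij: "bij_betw (compose F z) G G" using S.translate_bij[OF _ S.G_compose z] by blast
    have "map_poly z ?P = (\<Prod>g\<in>G. [:- z (g x), 1:])"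
      using S.G_closed[OF _ xF] by (intro map_poly_linear_prod[OF S.alg_E S.G_fhom[OF z]])
    also have "\<dots> = (\<Prod>g\<in>G. [:- compose F z g x, 1:])" using xF by (simp add: compose_def)
    also have "\<dots> = ?P" by (rule prod.reindex_bij_betw[OF bij, of "\<lambda>g. [:- g x, 1:]"])
    finally show "z (coeff ?P j) = coeff ?P j"
      using coeff_map_poly[of z ?P j] fhom_0[OF S.alg_E S.G_fhom[OF z]] by simp
  qed
  have "\<exists>g\<in>G. \<phi> x = g x"
  proof (rule conjugate_of_invariant_poly[OF S.alg_E S.finite_G S.G_id _ xF _ M(1) _ \<phi>h x(1)])
    show "M \<subseteq> F" using M(2) L_F by blast
    show "coeff ?P j \<in> M" for j using PQ alg_field_Rats[OF M(1)] by blast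
    show "\<phi> (coeff ?P j) = coeff ?P j" for j by (rule fhom_Rats[OF M(1) \<phi>h PQ])
  qed (use xF S.G_closed in auto)
  then show "y \<in> \<real>" using G_L_real x M(2) by auto
qed

lemma totally_real_KL: "totally_real K" "totally_real L"
  using totally_real_subfield[OF alg_K K_L] totally_real_subfield[OF alg_L] by auto

end

section \<open>The primes \<open>w\<^sub>i\<close>\<close>

text \<open>A subgroup containing sigma is determined by the powers of tau in it, the multiples of
  some \<open>k0\<close> dividing r. With d = r / k0, tau^i belongs to it iff r divides i d, which
  is a congruence for s^(i d) because s has order r.\<close>

lemma metacyclic_subgroup_obtain:
  assumes p: "Factorial_Ring.prime p" and ps: "coprime p s" and r: "ord p s = r"
    and D: "subgroup D (metacyclic_group p r s)" "generate (metacyclic_group p r s) {metacyclic_sigma} \<subseteq> D"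
  obtains d where "d dvd r" "d > 0"
    "\<And>y. y \<in> carrier (metacyclic_group p r s) \<Longrightarrow> y \<in> D \<longleftrightarrow> [(s ^ nat (snd y)) ^ d = 1] (mod p)"
proof -
  let ?G = "metacyclic_group p r s"
  have p1: "p > 1" "p > 0" using p prime_gt_1_nat prime_gt_0_nat by blast+
  have r0: "r > 0" using ps r coprime_ord by blast
  interpret group ?G by (rule group_metacyclic_group[OF p ps r])
  note mult = metacyclic_mult[OF p1(2) r0]
  note cl = subgroup.m_closed[OF D(1)]
  have sig: "(a, 0) \<in> D" if "0 \<le> a" "a < int p" for a
  proof -
    have "metacyclic_sigma \<in> D" using D(2) generate.incl[of metacyclic_sigma "{metacyclic_sigma}" ?G] by blast
    then have "metacyclic_sigma [^]\<^bsub>?G\<^esub> nat a \<in> D"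
      using subgroup_int_pow_closed[OF D(1), of metacyclic_sigma "int (nat a)"] by (simp only: int_pow_int)
    then show ?thesis using metacyclic_sigma_pow[OF p1(1) r0, where ?n = "nat a" and ?s = s] that by simp
  qed
  have D0: "(a, i) \<in> D \<longleftrightarrow> (0, i) \<in> D" if "0 \<le> a" "a < int p" "0 \<le> i" "i < int r" for a i
  proof
    assume "(0, i) \<in> D"
    then have "(a, 0) \<otimes>\<^bsub>?G\<^esub> (0, i) \<in> D" by (rule cl[OF sig[OF that(1,2)]])
    then show "(a, i) \<in> D" using that p1 by (simp add: mult)
  next
    assume a: "(a, i) \<in> D"
    have "((- a) mod int p, 0) \<otimes>\<^bsub>?G\<^esub> (a, i) \<in> D" using p1 by (intro cl[OF sig a]) auto
    then show "(0, i) \<in> D" using that p1 by (simp add: mult mod_simps)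
  qed
  define J where "J = {k::nat. (0, int (k mod r)) \<in> D}"
  have J_add: "k + k' \<in> J" if "k \<in> J" "k' \<in> J" for k k'
  proof -
    have "(0, int (k mod r)) \<otimes>\<^bsub>?G\<^esub> (0, int (k' mod r)) \<in> D" using that by (intro cl) (auto simp: J_def)
    then have "(0, (int (k mod r) + int (k' mod r)) mod int r) \<in> D" using p1 by (simp add: mult)
    also have "(int (k mod r) + int (k' mod r)) mod int r = int ((k + k') mod r)"
      by (simp add: zmod_int mod_simps)
    finally show ?thesis by (simp add: J_def)
  qed
  have J_r: "r \<in> J" using subgroup.one_closed[OF D(1)] by (simp add: J_def metacyclic_one)
  have J_mult: "k * n \<in> J" if "k \<in> J" for k n
    by (induction n) (use J_add[OF that] subgroup.one_closed[OF D(1)] in \<open>auto simp: J_def metacyclic_one\<close>)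
  have J_diff: "k' - k \<in> J" if "k \<in> J" "k' \<in> J" "k \<le> k'" for k k'
  proof -
    \<comment> \<open>Adding k (r - 1) has the same effect as subtracting k, since multiples of r do
      not matter.\<close>
    have "k' + k * (r - 1) \<in> J" by (intro J_add J_mult that)
    moreover have "k' + k * (r - 1) = (k' - k) + k * r" using that(3) r0 by (cases r) auto
    ultimately show ?thesis by (simp add: J_def)
  qed
  define k0 where "k0 = (LEAST k. k > 0 \<and> k \<in> J)"
  have k0: "k0 > 0" "k0 \<in> J"
    using LeastI[of "\<lambda>k. k > 0 \<and> k \<in> J" r] r0 J_r by (auto simp: k0_def)
  have J_iff: "k \<in> J \<longleftrightarrow> k0 dvd k" for k
  proof
    assume k: "k \<in> J"
    have "k - k0 * (k div k0) \<in> J" by (intro J_diff J_mult k k0) simp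
    then have "k mod k0 \<in> J" by (simp add: minus_mult_div_eq_mod)
    moreover have "k mod k0 < k0" using k0(1) by simp
    ultimately have "k mod k0 = 0" using not_less_Least[of "k mod k0" "\<lambda>k. k > 0 \<and> k \<in> J"] by (auto simp: k0_def)
    then show "k0 dvd k" by (simp add: dvd_eq_mod_eq_0)
  qed (use J_mult[OF k0(2)] in auto)
  define d where "d = r div k0"
  have kd: "k0 * d = r" using J_iff[of r] J_r by (simp add: d_def)
  show ?thesis
  proof (rule that[of d])
    show "d dvd r" "d > 0" using kd r0 by (auto intro: Nat.gr0I)
    fix y assume "y \<in> carrier ?G"
    then obtain a i where y: "y = (a, i)" "0 \<le> a" "a < int p" "0 \<le> i" "i < int r"
      by (auto simp: metacyclic_carrier[OF p1(2) r0])
    have "nat i mod r = nat i" using y by (simp add: nat_less_iff)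
    then have "y \<in> D \<longleftrightarrow> nat i \<in> J" using D0[of a i] y by (simp add: J_def)
    also have "\<dots> \<longleftrightarrow> r dvd nat i * d" unfolding J_iff using \<open>d > 0\<close> by (simp flip: kd)
    also have "\<dots> \<longleftrightarrow> [s ^ (nat i * d) = 1] (mod p)" using ord_divides[of s "nat i * d" p] r by simp
    finally show "y \<in> D \<longleftrightarrow> [(s ^ nat (snd y)) ^ d = 1] (mod p)" using y by (simp add: power_mult)
  qed
qed

lemma cring_ring_of_integers: assumes "alg_field L" shows "cring (ring_of_integers L)"
proof -
  have "subrng {x \<in> L. algebraic_int x}"
    using alg_field_1[OF assms] alg_field_diff[OF assms] alg_field_mult[OF assms]
    by (auto simp: subrng_def algebraic_int_diff algebraic_int_mult int_imp_algebraic_int)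
  then have "subcring {x \<in> L. algebraic_int x} complex_ring"
    by (intro CR.subcringI') (simp add: subring_iff_subrng)
  then show ?thesis
    using CR.subcring_iff[of "{x \<in> L. algebraic_int x}"] by (simp add: ring_of_integers_def complex_ring_simps)
qed

lemma ring_of_integers_simps:
  "carrier (ring_of_integers L) = {x \<in> L. algebraic_int x}" "x \<otimes>\<^bsub>ring_of_integers L\<^esub> y = x * y"
  "x \<oplus>\<^bsub>ring_of_integers L\<^esub> y = x + y" "\<zero>\<^bsub>ring_of_integers L\<^esub> = 0"
  by (simp_all add: ring_of_integers_def complex_ring_simps)

section \<open>The prime ideal of an absolute value\<close>

context absval
begin

definition prime_ideal :: "complex set" where "prime_ideal = {x \<in> E. algebraic_int x \<and> N x < 1}"

lemma prime_ideal_finite_prime: "prime_ideal \<in> finite_primes E"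
proof -
  let ?R = "ring_of_integers E"
  interpret R: cring ?R by (rule cring_ring_of_integers[OF E])
  have "subgroup prime_ideal (add_monoid ?R)"
  proof (rule R.add.subgroupI)
    show "prime_ideal \<subseteq> carrier ?R" by (auto simp: prime_ideal_def ring_of_integers_simps)
    show "prime_ideal \<noteq> {}" using alg_field_0[OF E] N_0 by (auto simp: prime_ideal_def intro!: exI[of _ 0])
    fix a assume a: "a \<in> prime_ideal"
    have "\<ominus>\<^bsub>?R\<^esub> a = - a"
      using a alg_field_uminus[OF E] by (intro R.minus_equality) (auto simp: prime_ideal_def ring_of_integers_simps)
    then show "\<ominus>\<^bsub>?R\<^esub> a \<in> prime_ideal"
      using a N_minus[of a] alg_field_uminus[OF E] by (auto simp: prime_ideal_def)
    fix b assume b: "b \<in> prime_ideal"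
    show "a \<oplus>\<^bsub>?R\<^esub> b \<in> prime_ideal"
      using a b N_add[of a b] alg_field_add[OF E] algebraic_int_plus by (auto simp: prime_ideal_def ring_of_integers_simps)
  qed
  then have add: "additive_subgroup prime_ideal ?R" by (rule additive_subgroup.intro)
  have mult: "x * a \<in> prime_ideal" if "a \<in> prime_ideal" "x \<in> E" "algebraic_int x" for a x
  proof -
    have "N (x * a) = N x * N a" using that by (intro N_mult) (auto simp: prime_ideal_def)
    also have "\<dots> \<le> 1 * N a" using that N_nonneg N_int by (intro mult_right_mono) (auto simp: prime_ideal_def)
    finally show ?thesis using that alg_field_mult[OF E] algebraic_int_mult by (auto simp: prime_ideal_def)
  qed
  have "primeideal prime_ideal ?R"
  proof (rule primeidealI2[OF add R.is_cring])
    show "x \<otimes>\<^bsub>?R\<^esub> a \<in> prime_ideal" "a \<otimes>\<^bsub>?R\<^esub> x \<in> prime_ideal" if "a \<in> prime_ideal" "x \<in> carrier ?R" for a x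
      using mult[OF that(1), of x] that(2) by (auto simp: ring_of_integers_simps mult.commute)
    have "1 \<in> carrier ?R" "1 \<notin> prime_ideal"
      using alg_field_1[OF E] N_1 by (auto simp: ring_of_integers_simps prime_ideal_def int_imp_algebraic_int)
    then show "carrier ?R \<noteq> prime_ideal" by blast
    fix a b assume ab: "a \<in> carrier ?R" "b \<in> carrier ?R" "a \<otimes>\<^bsub>?R\<^esub> b \<in> prime_ideal"
    show "a \<in> prime_ideal \<or> b \<in> prime_ideal"
    proof (rule ccontr)
      assume "\<not> ?thesis"
      then have "N a = 1" "N b = 1"
        using ab(1,2) N_int[of a] N_int[of b] by (fastforce simp: prime_ideal_def ring_of_integers_simps)+
      then have "N (a * b) = 1" using ab(1,2) N_mult[of a b] by (simp add: ring_of_integers_simps)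
      then show False using ab(3) by (simp add: prime_ideal_def ring_of_integers_simps)
    qed
  qed
  moreover have "of_nat l \<in> prime_ideal"
    using alg_field_of_nat[OF E, of l] N_l l_gt_1 by (auto simp: prime_ideal_def int_imp_algebraic_int inverse_less_1_iff)
  moreover have "of_nat l \<noteq> (0::complex)" using l_gt_1 by auto
  ultimately show ?thesis by (auto simp: finite_primes_def)
qed

text \<open>By \<open>absval_unique\<close> the prime ideal determines the absolute value. This
  links the decomposition groups of the statement with stabilisers of \<open>N\<close>.\<close>

lemma stabilizes_prime_ideal_iff:
  assumes f: "f \<in> auts E K" and K: "K \<subseteq> E"
  shows "f ` prime_ideal = prime_ideal \<longleftrightarrow> (\<forall>x\<in>E. N (f x) = N x)"
proof
  assume *: "f ` prime_ideal = prime_ideal"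
  have av: "absval E (\<lambda>x. N (f x)) l"
    by (rule absval_comp[OF absval_axioms E auts_fhom[OF f]]) (simp add: auts_image[OF f])
  have "N x = N (f x)" if "x \<in> E" for x
  proof (rule absval_unique[OF absval_axioms av _ that])
    fix x assume "x \<in> E" "algebraic_int x" "N x < 1"
    then have "f x \<in> prime_ideal" using * by (auto simp: prime_ideal_def)
    then show "N (f x) < 1" by (simp add: prime_ideal_def)
  qed
  then show "\<forall>x\<in>E. N (f x) = N x" by simp
next
  assume *: "\<forall>x\<in>E. N (f x) = N x"
  show "f ` prime_ideal = prime_ideal"
  proof
    show "f ` prime_ideal \<subseteq> prime_ideal"
      using * auts_closed[OF f] fhom_algebraic_int[OF E auts_fhom[OF f]] by (auto simp: prime_ideal_def)
    show "prime_ideal \<subseteq> f ` prime_ideal"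
    proof
      fix y assume y: "y \<in> prime_ideal"
      let ?h = "\<lambda>x\<in>E. inv_into E f x"
      note h = auts_inv[OF E f K]
      have yE: "y \<in> E" "algebraic_int y" using y by (auto simp: prime_ideal_def)
      have "f (?h y) = y" using yE auts_image[OF f] by (simp add: f_inv_into_f)
      moreover have "?h y \<in> E" "algebraic_int (?h y)"
        using auts_closed[OF h yE(1)] fhom_algebraic_int[OF E auts_fhom[OF h] yE] by auto
      moreover from this have "N (?h y) = N y" using * \<open>f (?h y) = y\<close> by metis
      ultimately show "y \<in> f ` prime_ideal" using y by (force simp: prime_ideal_def)
    qed
  qed
qed

text \<open>If x differs from 1, the sum of its first n powers vanishes; but every power is
  congruent to 1, so the sum is congruent to n, a unit.\<close>

lemma sim_one_root_of_unity:
  assumes x: "x \<in> E" "N (x - 1) < 1" "x ^ n = 1" and n: "\<not> l dvd n"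
  shows "x = 1"
proof (rule ccontr)
  assume ne: "x \<noteq> 1"
  have 1: "1 \<in> E" by (rule alg_field_1[OF E])
  have "N (x ^ k - 1) < 1" for k
  proof (cases "x = 0")
    case False
    have "sim x 1" using x 1 N_1 by (simp add: sim_def)
    from sim_pow[OF this, of k] show ?thesis by (simp add: sim_def N_1)
  qed (use x(2) N_minus[OF 1] N_1 in simp)
  moreover have d: "x ^ k - 1 \<in> E" for k by (intro alg_field_diff[OF E] alg_field_pow[OF E] x 1)
  ultimately have "N (\<Sum>k<n. x ^ k - 1) < 1" by (intro N_sum_less) auto
  moreover have "0 = (x - 1) * (\<Sum>k<n. x ^ k)" using x(3) power_diff_1_eq[of x n] by simp
  then have "(\<Sum>k<n. x ^ k) = 0" using ne by simp
  then have "(\<Sum>k<n. x ^ k - 1) = - of_nat n" by (simp add: sum_subtractf)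
  ultimately show False using N_of_int_coprime[of "int n"] N_minus[OF alg_field_of_nat[OF E, of n]] n by simp
qed

end

section \<open>Decomposition and inertia groups over K, and distinctness of the primes\<close>

context tower_group
begin

text \<open>The root of the i-th model factor whose stabiliser is wanted: by
  \<open>params_Z\<close>, slope u sends it to 3pi + \<open>lam u ^ d i\<close>.\<close>

definition z where "z i = of_nat (3 * p * i) + lam 1 ^ d i"

lemma one_range: "1 \<in> {1..<p}" using p_gt_2 by simp

lemma z_mem: "i < m \<Longrightarrow> z i \<in> Zset m e"
  unfolding z_def by (rule Zset_mem[OF _ one_range])

definition emb where "emb i = (SOME g. g \<in> G \<and> (\<forall>x\<in>croots f. g x = x) \<and> g t0 = theta (z i))"

lemma emb: assumes "i < m" shows "emb i \<in> G" "x \<in> croots f \<Longrightarrow> emb i x = x" "emb i t0 = theta (z i)"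
proof -
  have "\<exists>g. g \<in> G \<and> (\<forall>x\<in>croots f. g x = x) \<and> g t0 = theta (z i)"
    using move_theta[OF t0(1) theta_root[OF z_mem[OF assms]]] by blast
  from someI_ex[OF this] show "emb i \<in> G" "x \<in> croots f \<Longrightarrow> emb i x = x" "emb i t0 = theta (z i)"
    by (auto simp: emb_def)
qed

lemma emb_fhom: "i < m \<Longrightarrow> fhom L (emb i)" and emb_F: "i < m \<Longrightarrow> x \<in> L \<Longrightarrow> emb i x \<in> F"
  using fhom_mono[OF S.G_fhom[OF emb(1)] L_F] S.G_closed[OF emb(1)] L_F by auto

lemma absval_emb: assumes "i < m" shows "absval L (\<lambda>x. N (emb i x)) p"
  using emb_F[OF assms] by (intro absval_comp[OF D.absval_axioms alg_L emb_fhom[OF assms]]) auto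

lemma sim_F_qbar: "x \<in> F \<Longrightarrow> x \<in> qbar" using F_qbar by blast

text \<open>The quotient of the two powers is congruent to u^(d i), hence to 1; it is also an e-th
  root of unity with e prime to p, so it equals 1.\<close>

lemma lam_pow_eq:
  assumes i: "i < m" and u: "u \<in> {1..<p}" "[u ^ d i = 1] (mod p)"
  shows "lam u ^ d i = lam 1 ^ d i"
proof -
  have z1: "zeta - 1 \<in> qbar" "zeta - 1 \<noteq> 0"
    using N_one_minus_root_of_unity(4)[OF zeta_power_p] zeta_neq_1[of 1] p_gt_2 by auto
  have l1: "sim (lam 1 ^ d i) ((zeta - 1) ^ d i)" using sim_pow[OF lam_sim[OF one_range]] by simp
  have lu: "sim (lam u) (of_nat u * (zeta - 1))" using sim_trans[OF lam_sim[OF u(1)] sim_zeta] u(1) by auto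
  have "[int (u ^ d i) = int 1] (mod int p)" using u(2) by (subst cong_int_iff)
  then have "int p dvd int u ^ d i - 1" by (simp add: cong_iff_dvd_diff)
  then have "N (of_int (int u ^ d i - 1)) < 1" by (rule N_of_int_dvd)
  then have "sim (of_nat u ^ d i) 1"
    by (simp add: sim_def N_1 alg_field_1[OF E] alg_field_pow[OF E] alg_field_of_nat[OF E])
  from sim_mult[OF this sim_refl[OF alg_field_pow[OF E z1(1)], of "d i"]]
  have "sim ((of_nat u * (zeta - 1)) ^ d i) ((zeta - 1) ^ d i)" using z1 by (simp add: power_mult_distrib)
  from sim_trans[OF sim_pow[OF lu] this] have "sim (lam u ^ d i) (lam 1 ^ d i)" by (rule sim_trans[OF _ sim_sym[OF l1]])
  from sim_divide[OF this sim_refl[OF sim_E(2)[OF this] sim_nonzero(2)[OF this]]]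
  have s: "sim (lam u ^ d i / lam 1 ^ d i) 1" using sim_nonzero(1)[OF lam_sim[OF one_range]] by simp
  have pw: "(lam a ^ d i) ^ e i = - of_nat p" if "a \<in> {1..<p}" for a
    using lam_root[OF that] e_d[OF i] by (simp add: mult.commute flip: power_mult)
  have "\<not> p dvd e i"
    using e_dvd[OF i] e_pos[OF i] p_gt_2 by (auto dest!: dvd_imp_le)
  moreover have "(lam u ^ d i / lam 1 ^ d i) ^ e i = 1"
    using p_pos by (simp only: power_divide pw[OF u(1)] pw[OF one_range]) simp
  moreover have "N (lam u ^ d i / lam 1 ^ d i - 1) < 1" using s by (simp only: sim_def N_1)
  ultimately have "lam u ^ d i / lam 1 ^ d i = 1"
    using sim_one_root_of_unity[OF sim_E(1)[OF s]] by blast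
  then show ?thesis by simp
qed

lemma alpha_sim: "j < p \<Longrightarrow> sim (alpha j) (zeta ^ j * proot)"
proof -
  assume j: "j < p"
  have E1: "alpha j \<in> qbar" "zeta ^ j * proot \<in> qbar" using alpha_F[OF j] zp_F sim_F_qbar by auto
  have "N (alpha j - zeta ^ j * proot) < N proot * pp" using alpha_near[OF j] N_diff_commute[OF E1] by simp
  also have "\<dots> < N proot * 1" using N_proot pp_less_1 by (intro mult_strict_left_mono) auto
  also have "\<dots> = N (zeta ^ j * proot)" using N_mult[OF zeta_E proot_E] N_zeta by simp
  finally show ?thesis using E1 by (simp add: sim_def)
qed

text \<open>The relative difference of two roots of f has the leading term of the corresponding root
  of unity minus 1. So \<open>L\<close> can detect slopes although \<open>zeta\<close> itself need
  not lie in it.\<close>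

lemma alpha_diff_sim:
  assumes u: "u \<in> {1..<p}" and v: "v < p"
  shows "sim ((alpha ((u + v) mod p) - alpha v) / alpha v) (zeta ^ u - 1)"
proof -
  have ne: "zeta ^ u \<noteq> 1" using u by (intro zeta_neq_1) auto
  have zeta_nz: "zeta \<noteq> 0" using zeta_power_p p_pos by (auto simp: power_0_left)
  note zu = N_one_minus_root_of_unity(4)[OF zeta_pow_pow ne]
  have w: "(u + v) mod p < p" using p_pos by simp
  let ?a = "alpha ((u + v) mod p)" and ?za = "zeta ^ ((u + v) mod p) * proot" and ?b = "alpha v" and ?zb = "zeta ^ v * proot"
  have q: "?a \<in> qbar" "?b \<in> qbar" "?za \<in> qbar" "?zb \<in> qbar"
    using alpha_F[OF w] alpha_F[OF v] zp_F sim_F_qbar by auto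
  have e: "?za - ?zb = (zeta ^ u - 1) * ?zb" by (simp add: zeta_mod power_add algebra_simps)
  have e': "(?a - ?b) - (?za - ?zb) = (?zb - ?b) - (?za - ?a)" by simp
  have "N ((?a - ?b) - (?za - ?zb)) \<le> max (N (?zb - ?b)) (N (?za - ?a))"
    unfolding e' by (intro N_diff alg_field_diff[OF E] q)
  also have "\<dots> < N proot * pp" using alpha_near[OF w] alpha_near[OF v] by simp
  also have "\<dots> = N (?za - ?zb)"
    unfolding e using N_mult[OF zu q(4)] N_mult[OF zeta_E proot_E] N_zeta N_root_of_unity_minus_1[OF zeta_pow_pow ne] by simp
  finally have "sim (?a - ?b) ((zeta ^ u - 1) * ?zb)"
    unfolding e[symmetric] using q alg_field_diff[OF E] by (simp add: sim_def)
  from sim_divide[OF this alpha_sim[OF v]] show ?thesis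
    using proot_nonzero zeta_nz by simp
qed

text \<open>If u^(d i) is 1 modulo p, the element of \<open>\<Delta>\<close> with the same
  parameters fixes \<open>z i\<close> and induces \<open>\<Phi> y\<close> through the embedding, so
  value and residue are preserved. Conversely, a test element of \<open>L\<close> detects u^(d
  i).\<close>

lemma decomposition_condition:
  assumes i: "i < m" and y: "y \<in> carrier \<Gamma>"
  shows "(\<forall>x\<in>L. N (emb i (\<Phi> y x)) = N (emb i x)) \<longleftrightarrow> [us (snd y) ^ d i = 1] (mod p)"
    and "[us (snd y) ^ d i = 1] (mod p) \<Longrightarrow> x \<in> L \<Longrightarrow> N (emb i x) \<le> 1 \<Longrightarrow> N (emb i (\<Phi> y x - x)) < 1"
proof -
  let ?l = "\<forall>x\<in>L. N (emb i (\<Phi> y x)) = N (emb i x)" and ?r = "[us (snd y) ^ d i = 1] (mod p)"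
  let ?u = "us (snd y)" and ?v = "nat (fst y)"
  have u: "?u \<in> {1..<p}" by (rule us_range)
  have v: "?v < p" using y by (auto simp: carrier_\<Gamma>)
  note ac = acts_\<Phi>[OF y]
  have \<Phi>t: "\<Phi> y t0 = t0" and \<Phi>a: "\<And>j. j < p \<Longrightarrow> \<Phi> y (alpha j) = alpha ((?u * j + ?v) mod p)"
    using ac by (auto simp: acts_def)
  note gh = emb_fhom[OF i]
  have lift: "\<exists>\<delta>\<in>D.\<Delta>. \<forall>x\<in>L. emb i (\<Phi> y x) = \<delta> (emb i x)" if ?r
  proof -
    obtain \<delta> where \<delta>: "\<delta> \<in> D.\<Delta>" "has_params \<delta> ?u ?v" using exists_params[OF u v] by blast
    have \<delta>G: "\<delta> \<in> G" using \<delta>(1) D.\<Delta>_G by blast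
    have "emb i (\<Phi> y x) = \<delta> (emb i x)" if x: "x \<in> L" for x
    proof (rule L_eqI[OF _ _ _ _ x])
      show "fhom L (\<lambda>x. emb i (\<Phi> y x))"
        using \<Phi>_closed[OF y] by (intro fhom_comp[OF alg_L \<Phi>_fhom[OF y] gh]) auto
      show "fhom L (\<lambda>x. \<delta> (emb i x))"
        using emb_F[OF i] by (intro fhom_comp[OF alg_L gh S.G_fhom[OF \<delta>G]]) auto
      have "\<delta> (z i) = z i"
        unfolding z_def using params_Z[OF \<delta> i one_range] lam_pow_eq[OF i u \<open>?r\<close>] u by simp
      then show "emb i (\<Phi> y t0) = \<delta> (emb i t0)"
        using params_theta(1)[OF \<delta> z_mem[OF i]] emb(3)[OF i] \<Phi>t by simp
      fix j assume j: "j < p"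
      have "(?u * j + ?v) mod p < p" using p_pos by simp
      then show "emb i (\<Phi> y (alpha j)) = \<delta> (emb i (alpha j))"
        using \<Phi>a[OF j] emb(2)[OF i alpha_root] j params_alpha[OF \<delta> j] by simp
    qed
    then show ?thesis using \<delta>(1) by blast
  qed
  show "?l \<longleftrightarrow> ?r"
  proof
    assume r: ?r
    show ?l using lift[OF r] D.\<Delta>_N emb_F[OF i] by metis
  next
    assume l: ?l
    let ?a = "of_nat (3 * p * i) :: complex"
    \<comment> \<open>An element of \<open>L\<close> with leading term \<open>zeta - 1\<close>;
      slope u multiplies this leading term by u.\<close>
    define b where "b = (alpha 1 - alpha 0) / alpha 0"
    have j01: "1 < p" "0 < p" using p_gt_2 by auto
    have bL: "b \<in> L" unfolding b_def using L_mem j01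
      by (intro alg_field_divide[OF alg_L] alg_field_diff[OF alg_L]) auto
    have aL: "?a \<in> L" "t0 - ?a \<in> L"
      using L_mem(1) alg_field_of_nat[OF alg_L] alg_field_diff[OF alg_L] by blast+
    \<comment> \<open>The embedding sends \<open>t0 - ?a\<close> to an element with leading term
      \<open>(zeta - 1) ^ d i\<close>, so x has value below 1. Its image under
      \<open>\<Phi> y\<close> is congruent to u^(-d i) - 1, and preservation of the value makes this
      vanish modulo p.\<close>
    define x where "x = (t0 - ?a) / b ^ d i - 1"
    have xL: "x \<in> L" unfolding x_def
      by (intro alg_field_diff[OF alg_L] alg_field_divide[OF alg_L] alg_field_pow[OF alg_L] alg_field_1[OF alg_L] aL bL)
    have hx: "g x = (g t0 - ?a) / g b ^ d i - 1" if g: "fhom L g" for g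
    proof -
      have 1: "(t0 - ?a) / b ^ d i \<in> L" by (intro alg_field_divide[OF alg_L] alg_field_pow[OF alg_L] aL bL)
      show ?thesis unfolding x_def
        using fhom_diff[OF alg_L g 1 alg_field_1[OF alg_L]] fhom_divide[OF alg_L g aL(2) alg_field_pow[OF alg_L bL]]
          fhom_diff[OF alg_L g L_mem(1) aL(1)] fhom_pow[OF alg_L g bL] fhom_Rats[OF alg_L g Rats_of_nat] fhom_1[OF alg_L g]
        by (simp del: of_nat_mult)
    qed
    have hb: "g b = (g (alpha 1) - g (alpha 0)) / g (alpha 0)" if g: "fhom L g" for g
      unfolding b_def using fhom_divide[OF alg_L g alg_field_diff[OF alg_L L_mem(3,3)] L_mem(3)]
        fhom_diff[OF alg_L g L_mem(3) L_mem(3)] j01 by simp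
    have comp: "fhom L (\<lambda>x. emb i (\<Phi> y x))"
      using \<Phi>_closed[OF y] by (intro fhom_comp[OF alg_L \<Phi>_fhom[OF y] gh]) auto
    have fa: "emb i (alpha j) = alpha j" if "j < p" for j by (rule emb(2)[OF i alpha_root[OF that]])
    have gb1: "emb i b = (alpha ((1 + 0) mod p) - alpha 0) / alpha 0"
      using hb[OF gh] fa j01 by simp
    have s1: "sim (emb i b) (zeta - 1)" unfolding gb1 using alpha_diff_sim[OF one_range, of 0] j01 by simp
    have gb2: "emb i (\<Phi> y b) = (alpha ((?u + ?v) mod p) - alpha ?v) / alpha ?v"
      using hb[OF comp] fa j01 \<Phi>a[of 0] \<Phi>a[of 1] v p_pos by simp
    have s2: "sim (emb i (\<Phi> y b)) (of_nat ?u * (zeta - 1))"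
      unfolding gb2 using sim_trans[OF alpha_diff_sim[OF u v] sim_zeta[of ?u]] u by auto
    \<comment> \<open>The matching error is below c, which is at most 1/p = pp^(p-1) and so at most
      pp^(d i), the value of the leading term.\<close>
    have tz: "sim (theta (z i) - ?a) ((zeta - 1) ^ d i)"
    proof -
      have m1: "theta (z i) \<in> qbar" "z i \<in> qbar" using theta_F[OF z_mem[OF i]] Zset_F[OF z_mem[OF i]] sim_F_qbar by auto
      have zl: "lam 1 ^ d i \<in> qbar" using root_F(2)[OF one_range] sim_F_qbar alg_field_pow[OF E] by blast
      have Nl: "N (lam 1 ^ d i) = pp ^ d i"
        using N_pow[OF sim_F_qbar[OF root_F(2)[OF one_range]]] N_lam[OF one_range] by simp
      have "N ((theta (z i) - ?a) - lam 1 ^ d i) = N (theta (z i) - z i)" by (simp add: z_def algebra_simps)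
      also have "\<dots> < c" using theta_near[OF z_mem[OF i]] N_diff_commute[OF m1] by simp
      also have "\<dots> \<le> pp ^ (p - 1)" using c_le pp_power by simp
      also have "\<dots> \<le> pp ^ d i" using pp_pos pp_less_1 d_le[OF i] by (intro power_decreasing) auto
      finally have "sim (theta (z i) - ?a) (lam 1 ^ d i)"
        using m1 zl Nl alg_field_diff[OF E m1(1) alg_field_of_nat[OF E, of "3 * p * i"]] by (simp add: sim_def)
      then show ?thesis using sim_trans[OF _ sim_pow[OF lam_sim[OF one_range], of "d i"]] by simp
    qed
    have z1: "zeta - 1 \<noteq> 0" using zeta_neq_1[of 1] p_gt_2 by auto
    have "sim ((theta (z i) - ?a) / emb i b ^ d i) 1"
      using sim_divide[OF tz sim_pow[OF s1, of "d i"]] z1 by simp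
    then have "N (emb i x) < 1" unfolding hx[OF gh] emb(3)[OF i] by (simp add: sim_def N_1)
    then have "N (emb i (\<Phi> y x)) < 1" using l xL by simp
    then have lt: "N ((theta (z i) - ?a) / emb i (\<Phi> y b) ^ d i - 1) < 1"
      using hx[OF comp] \<Phi>t emb(3)[OF i] by simp
    have s3: "sim ((theta (z i) - ?a) / emb i (\<Phi> y b) ^ d i) (inverse (of_nat ?u ^ d i))"
    proof -
      have "(zeta - 1) ^ d i / (of_nat ?u * (zeta - 1)) ^ d i = inverse (of_nat ?u ^ d i)"
        using z1 u by (simp only: power_mult_distrib) (simp add: divide_inverse)
      then show ?thesis using sim_divide[OF tz sim_pow[OF s2, of "d i"]] by simp
    qed
    then have "sim ((theta (z i) - ?a) / emb i (\<Phi> y b) ^ d i) 1"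
      using lt sim_E(1)[OF s3] alg_field_1[OF E] by (simp add: sim_def N_1)
    from sim_inverse[OF sim_trans[OF sim_sym[OF s3] this]] have "sim (of_nat ?u ^ d i) 1" by simp
    then have "N (of_int (int ?u ^ d i - 1)) < 1" by (simp add: sim_def N_1)
    then have "int p dvd int ?u ^ d i - 1" by (simp only: N_of_int_less_1_iff)
    then have "[int (?u ^ d i) = int 1] (mod int p)" by (simp add: cong_iff_dvd_diff)
    then show ?r by (simp only: cong_int_iff)
  qed
  assume r: ?r and x: "x \<in> L" "N (emb i x) \<le> 1"
  obtain \<delta> where \<delta>: "\<delta> \<in> D.\<Delta>" "\<forall>x\<in>L. emb i (\<Phi> y x) = \<delta> (emb i x)" using lift[OF r] by blast
  have "emb i (\<Phi> y x - x) = \<delta> (emb i x) - emb i x"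
    using fhom_diff[OF alg_L gh \<Phi>_closed[OF y x(1)] x(1)] \<delta>(2) x(1) by simp
  then show "N (emb i (\<Phi> y x - x)) < 1" using residue_trivial[OF \<delta>(1) emb_F[OF i x(1)] x(2)] by simp
qed

definition w where "w i = absval.prime_ideal L (\<lambda>x. N (emb i x))"

lemma w_finite_prime: "i < m \<Longrightarrow> w i \<in> finite_primes L"
  unfolding w_def by (rule absval.prime_ideal_finite_prime[OF absval_emb])

lemma decomposition_w: assumes i: "i < m"
  shows "decomposition_group L K (w i) = \<Phi> ` {y \<in> carrier \<Gamma>. [us (snd y) ^ d i = 1] (mod p)}"
    and "inertia_group L K (w i) = decomposition_group L K (w i)"
proof -
  interpret a: absval L "\<lambda>x. N (emb i x)" p by (rule absval_emb[OF i])
  have iff: "\<Phi> y ` w i = w i \<longleftrightarrow> [us (snd y) ^ d i = 1] (mod p)" if y: "y \<in> carrier \<Gamma>" for y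
    unfolding w_def using a.stabilizes_prime_ideal_iff[OF \<Phi>_auts[OF y] K_L] decomposition_condition(1)[OF i y] by simp
  then show D: "decomposition_group L K (w i) = \<Phi> ` {y \<in> carrier \<Gamma>. [us (snd y) ^ d i = 1] (mod p)}"
    by (auto simp: decomposition_group_def carrier_Gal_L)
  have "\<Phi> y x - x \<in> w i" if y: "y \<in> carrier \<Gamma>" "[us (snd y) ^ d i = 1] (mod p)" and x: "x \<in> L" "algebraic_int x" for y x
  proof -
    have "algebraic_int (\<Phi> y x)" by (rule fhom_algebraic_int[OF alg_L \<Phi>_fhom[OF y(1)] x])
    moreover have "N (emb i (\<Phi> y x - x)) < 1" by (rule decomposition_condition(2)[OF i y x(1) a.N_int[OF x]])
    ultimately show ?thesis
      unfolding w_def a.prime_ideal_def using \<Phi>_closed[OF y(1) x(1)] x alg_field_diff[OF alg_L] algebraic_int_diff by blast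
  qed
  then show "inertia_group L K (w i) = decomposition_group L K (w i)"
    unfolding inertia_group_def D by (auto simp: ring_of_integers_simps)
qed

text \<open>If the primes below agreed, so would the two absolute values on K. The element (t0 -
  3pi)^(e i) + p of K has value below c for index i, and at least c for any other index.\<close>

lemma prime_below_w_inj: "inj_on (\<lambda>i. prime_below K (w i)) {..<m}"
proof (rule inj_onI)
  fix i j assume ij: "i \<in> {..<m}" "j \<in> {..<m}" and eq: "prime_below K (w i) = prime_below K (w j)"
  have i: "i < m" and j: "j < m" using ij by auto
  interpret ai: absval K "\<lambda>x. N (emb i x)" p by (rule absval_mono[OF absval_emb[OF i] alg_K K_L])
  interpret aj: absval K "\<lambda>x. N (emb j x)" p by (rule absval_mono[OF absval_emb[OF j] alg_K K_L])
  have same: "N (emb i x) = N (emb j x)" if "x \<in> K" for x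
  proof (rule absval_unique[OF ai.absval_axioms aj.absval_axioms _ that])
    fix x assume x: "x \<in> K" "algebraic_int x" "N (emb i x) < 1"
    then have "x \<in> prime_below K (w i)" using K_L
      by (auto simp: prime_below_def w_def absval.prime_ideal_def[OF absval_emb[OF i]] ring_of_integers_simps)
    then show "N (emb j x) < 1" unfolding eq
      by (auto simp: prime_below_def w_def absval.prime_ideal_def[OF absval_emb[OF j]])
  qed
  show "i = j"
  proof (rule ccontr)
    assume ne: "i \<noteq> j"
    let ?a = "of_nat (3 * p * i) :: complex"
    let ?P = "\<lambda>x. (x - ?a) ^ e i + of_nat p :: complex"
    have aK: "?a \<in> K" "of_nat p \<in> K" "t0 - ?a \<in> K"
      using alg_field_of_nat[OF alg_K] alg_field_diff[OF alg_K t0_K] by blast+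
    have xK: "?P t0 \<in> K" by (intro alg_field_add[OF alg_K] alg_field_pow[OF alg_K] aK)
    have hP: "emb k (?P t0) = ?P (theta (z k))" if k: "k < m" for k
    proof -
      have g: "fhom K (emb k)" by (rule fhom_mono[OF emb_fhom[OF k] K_L])
      show ?thesis
        using fhom_add[OF alg_K g alg_field_pow[OF alg_K aK(3)] aK(2)] fhom_pow[OF alg_K g aK(3)]
          fhom_diff[OF alg_K g t0_K aK(1)] fhom_Rats[OF alg_K g Rats_of_nat] emb(3)[OF k] by (simp del: of_nat_mult)
    qed
    \<comment> \<open>The difference of the two values is \<open>theta (z k) - z k\<close> times an
      algebraic integer, so the matching bound carries over.\<close>
    have close: "N (?P (theta (z k)) - ?P (z k)) < c" "?P (theta (z k)) - ?P (z k) \<in> qbar" "?P (z k) \<in> qbar" if k: "k < m" for k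
    proof -
      have ti: "algebraic_int (theta (z k))" by (rule algebraic_int_croots[OF h(1) theta_root[OF z_mem[OF k]]])
      have zi: "algebraic_int (z k)" by (rule Z_int[OF z_mem[OF k]])
      have ni: "algebraic_int (of_nat n :: complex)" for n by (simp add: int_imp_algebraic_int)
      have di: "algebraic_int (theta (z k) - ?a)" "algebraic_int (z k - ?a)"
        using algebraic_int_diff ti zi ni by blast+
      let ?S = "\<Sum>n<e i. (z k - ?a) ^ (e i - Suc n) * (theta (z k) - ?a) ^ n"
      have "?S \<in> {x. algebraic_int x}"
        using di by (intro subrng_sum[OF subrng_algebraic_int]) (auto intro: algebraic_int_mult algebraic_int_pow)
      then have Si: "algebraic_int ?S" by simp
      have e: "?P (theta (z k)) - ?P (z k) = (theta (z k) - z k) * ?S"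
        using power_diff_sumr2[of "theta (z k) - ?a" "e i" "z k - ?a"] by simp
      have q: "theta (z k) \<in> qbar" "z k \<in> qbar" using ti zi qbar_algebraic_int by auto
      then have dq: "theta (z k) - z k \<in> qbar" using alg_field_diff[OF E] by blast
      have Sq: "?S \<in> qbar" by (rule qbar_algebraic_int[OF Si])
      have "N (?P (theta (z k)) - ?P (z k)) = N (theta (z k) - z k) * N ?S" unfolding e by (rule N_mult[OF dq Sq])
      also have "\<dots> \<le> N (theta (z k) - z k) * 1" using N_nonneg[OF dq] N_int[OF Sq Si] by (intro mult_left_mono)
      also have "\<dots> < c" using theta_near[OF z_mem[OF k]] N_diff_commute[OF q] by simp
      finally show "N (?P (theta (z k)) - ?P (z k)) < c" .
      show "?P (theta (z k)) - ?P (z k) \<in> qbar" unfolding e by (rule alg_field_mult[OF E dq Sq])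
      show "?P (z k) \<in> qbar"
        by (intro alg_field_add[OF E] alg_field_pow[OF E] alg_field_of_nat[OF E] qbar_algebraic_int[OF di(2)])
    qed
    have rt: "(z k - of_nat (3 * p * k)) ^ e k = - of_nat p" if k: "k < m" for k
      unfolding z_def using lam_root[OF one_range] e_d[OF k] by (simp add: mult.commute flip: power_mult)
    have "?P (z i) = 0" using rt[OF i] by (simp del: of_nat_mult)
    then have lt: "N (emb i (?P t0)) < c" using close(1)[OF i] hP[OF i] by simp
    have "?P (z j) \<noteq> 0"
    proof
      assume "?P (z j) = 0"
      then have "(z j - ?a) ^ e i = - of_nat p" by (simp add: add_eq_0_iff2)
      then show False using Z_disjoint[OF i j _ rt[OF j]] ne by blast
    qed
    then have ge: "c \<le> N (?P (z j))" by (rule c_sep[OF z_mem[OF j] i])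
    have "N (?P (z j) + (?P (theta (z j)) - ?P (z j))) = N (?P (z j))"
      using close[OF j] ge by (intro N_add_eq) auto
    then have "N (emb j (?P t0)) = N (?P (z j))" unfolding hP[OF j] by (simp only: add_diff_eq add_diff_cancel_left')
    then show False using same[OF xK] lt ge by simp
  qed
qed

end

theorem theorem6p3:
  fixes p r s n :: nat
    and D I :: "nat \<Rightarrow> (int \<times> int) set"
  assumes "Factorial_Ring.prime p" and "odd p"
    and "coprime p s" and "ord p s = r"
    and "\<And>i. i \<in> {1..n} \<Longrightarrow> subgroup (D i) (metacyclic_group p r s)"
    and "\<And>i. i \<in> {1..n} \<Longrightarrow> subgroup (I i) (metacyclic_group p r s)"
    and "\<And>i. i \<in> {1..n} \<Longrightarrow> generate (metacyclic_group p r s) {metacyclic_sigma} \<subseteq> D i"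
    and "\<And>i. i \<in> {1..n} \<Longrightarrow> I i = D i"
  shows "\<exists>K L \<psi> w.
    number_field K \<and> number_field L \<and> finite_galois_extension L K \<and>
    totally_real K \<and> totally_real L \<and>
    \<psi> \<in> iso (Gal L K) (metacyclic_group p r s) \<and>
    (\<forall>i\<in>{1..n}. w i \<in> finite_primes L) \<and>
    inj_on (\<lambda>i. prime_below K (w i)) {1..n} \<and>
    (\<forall>i\<in>{1..n}. \<psi> ` decomposition_group L K (w i) = D i \<and>
                 \<psi> ` inertia_group L K (w i) = I i)"
proof -
  let ?G = "metacyclic_group p r s"
  have p1: "p > 1" using assms(1) by (rule prime_gt_1_nat)
  have "\<exists>d>0. d dvd r \<and> (\<forall>y\<in>carrier ?G. y \<in> D i \<longleftrightarrow> [(s ^ nat (snd y)) ^ d = 1] (mod p))" if "i \<in> {1..n}" for i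
    using metacyclic_subgroup_obtain[OF assms(1,3,4) assms(5,7)[OF that]] by metis
  then obtain d where d: "\<And>i. i \<in> {1..n} \<Longrightarrow> d i > 0" "\<And>i. i \<in> {1..n} \<Longrightarrow> d i dvd r"
    "\<And>i y. i \<in> {1..n} \<Longrightarrow> y \<in> carrier ?G \<Longrightarrow> y \<in> D i \<longleftrightarrow> [(s ^ nat (snd y)) ^ d i = 1] (mod p)"
    by metis
  have "r dvd p - 1" using order_divides_totient[of p s] assms(1,3,4) by (simp add: totient_prime)
  then have dp: "d i dvd p - 1" if "i \<in> {1..n}" for i using d(2)[OF that] dvd_trans by blast
  \<comment> \<open>Index 0 and all indices above n carry linear factors that serve only as
    padding.\<close>
  define e where "e i = (if i \<in> {1..n} then (p - 1) div d i else 1)" for i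
  have e: "e i dvd p - 1" "e i > 0" for i
    using dp[of i] p1 d(1)[of i] by (auto simp: e_def div_dvd_iff_mult dvd_div_eq_0_iff intro!: Nat.gr0I)
  have de: "(p - 1) div e i = d i" if "i \<in> {1..n}" for i
    using dp[OF that] that p1 by (auto simp: e_def elim!: dvdE)
  obtain q where q: "Factorial_Ring.prime q" "q > max p (sum e {..n})" using bigger_prime by blast
  \<comment> \<open>As many linear factors are appended as are missing for the total degree to be
    the prime q.\<close>
  define m where "m = Suc n + (q - sum e {..n})"
  have "(\<Sum>i<m. e i) = (\<Sum>i<Suc n. e i) + (\<Sum>i = Suc n..<m. e i)"
    using sum.atLeastLessThan_concat[of 0 "Suc n" m e] by (simp add: m_def atLeast0LessThan)
  also have "(\<Sum>i = Suc n..<m. e i) = (\<Sum>i = Suc n..<m. 1)" by (intro sum.cong) (auto simp: e_def)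
  finally have em: "(\<Sum>i<m. e i) = q" using q(2) by (simp add: m_def lessThan_Suc_atMost)
  obtain N where "absval qbar N p" using exists_absval_qbar[OF assms(1)] .
  then interpret padic N p using assms(2) by (simp add: padic_def padic_axioms_def)
  obtain lam where lam: "bij_betw lam {1..<p} {s. s ^ (p - 1) = - of_nat p}"
    "\<And>a. a \<in> {1..<p} \<Longrightarrow> N (zeta ^ a - 1 - lam a) < pp"
    "\<And>a r. a \<in> {1..<p} \<Longrightarrow> r ^ (p - 1) = - of_nat p \<Longrightarrow> N (zeta ^ a - 1 - r) < pp \<Longrightarrow> r = lam a"
    by (rule exists_lambda, rule that)
  obtain f alpha where f: "lead_coeff f = 1" "degree f = p" "croots f \<subseteq> \<real>"
    "bij_betw alpha {..<p} (croots f)"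
    "\<And>j. j < p \<Longrightarrow> N (zeta ^ j * proot - alpha j) < N proot * pp"
    "\<And>j r. j < p \<Longrightarrow> r \<in> croots f \<Longrightarrow> N (zeta ^ j * proot - r) < N proot * pp \<Longrightarrow> r = alpha j"
    by (rule exists_alpha, rule that)
  have q0: "q > 0" using q(2) by simp
  obtain h theta c where h: "lead_coeff h = 1" "degree h = q" "croots h \<subseteq> \<real>" "card (croots h) = q"
    "[:4:] dvd h - (monom 1 q + [:2:])"
    "finite (Zset m e)" "\<And>z. z \<in> Zset m e \<Longrightarrow> algebraic_int z"
    "bij_betw theta (Zset m e) (croots h)"
    "\<And>z. z \<in> Zset m e \<Longrightarrow> N (z - theta z) < c"
    "\<And>z r. z \<in> Zset m e \<Longrightarrow> r \<in> croots h \<Longrightarrow> N (z - r) < c \<Longrightarrow> r = theta z"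
    "\<And>(z::complex) i j. i < m \<Longrightarrow> j < m \<Longrightarrow> (z - of_nat (3 * p * i)) ^ e i = - of_nat p \<Longrightarrow>
      (z - of_nat (3 * p * j)) ^ e j = - of_nat p \<Longrightarrow> i = j"
    "c \<le> inverse (real p)"
    "\<And>z i. z \<in> Zset m e \<Longrightarrow> i < m \<Longrightarrow> (z - of_nat (3 * p * i)) ^ e i + of_nat p \<noteq> 0 \<Longrightarrow>
      c \<le> N ((z - of_nat (3 * p * i)) ^ e i + of_nat p)"
    by (rule exists_theta[OF e(2) em q0], rule that)
  have qp: "q > p" using q(2) by simp
  interpret T: tower_group N p m e q f h alpha theta c lam r s
    by (intro tower_group.intro tower.intro tower_axioms.intro tower_group_axioms.intro padic_axioms)
      (fact lam f h q(1) qp assms(3,4) | rule e(1))+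
  have im: "i < m" if "i \<in> {1..n}" for i using that by (simp add: m_def)
  have DG: "D i = {y \<in> carrier ?G. [T.us (snd y) ^ T.d i = 1] (mod p)}" if i: "i \<in> {1..n}" for i
  proof -
    have "[T.us k ^ d i = (s ^ nat k) ^ d i] (mod p)" for k
      by (intro cong_pow) (simp add: T.us_def)
    then have "[T.us k ^ d i = 1] (mod p) \<longleftrightarrow> [(s ^ nat k) ^ d i = 1] (mod p)" for k
      by (simp add: cong_def)
    then show ?thesis using d(3)[OF i] subgroup.subset[OF assms(5)[OF i]] de[OF i] by (auto simp: T.d_def)
  qed
  have img: "T.\<psi> ` decomposition_group T.L T.K (T.w i) = D i" if i: "i \<in> {1..n}" for i
    unfolding T.decomposition_w(1)[OF im[OF i]] DG[OF i] image_image
    using T.\<psi>_\<Phi> by (force simp: T.\<Gamma>_def)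
  show ?thesis
  proof (intro exI conjI ballI)
    show "number_field T.K" "number_field T.L" by (fact T.number_fields)+
    show "finite_galois_extension T.L T.K" by (rule T.galois_LK)
    show "totally_real T.K" "totally_real T.L" by (fact T.totally_real_KL)+
    show "T.\<psi> \<in> iso (Gal T.L T.K) ?G" using T.\<psi>_iso by (simp only: T.\<Gamma>_def)
    show "inj_on (\<lambda>i. prime_below T.K (T.w i)) {1..n}"
      by (rule inj_on_subset[OF T.prime_below_w_inj]) (use im in blast)
    fix i assume i: "i \<in> {1..n}"
    show "T.w i \<in> finite_primes T.L" by (rule T.w_finite_prime[OF im[OF i]])
    show "T.\<psi> ` decomposition_group T.L T.K (T.w i) = D i" by (rule img[OF i])
    then show "T.\<psi> ` inertia_group T.L T.K (T.w i) = I i"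
      by (simp only: T.decomposition_w(2)[OF im[OF i]] assms(8)[OF i])
  qed
qed

end
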